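(* Let $Q$ be a quaternion division algebra over an arbitrary field $k$, and let $F$ be the function field of the Severi--Brauer conic of $Q$. Let $(V,[s])$ be an anisotropic generalized quadratic space over $Q$. Then the generalized quadratic space over $Q\otimes_k F$ obtained from $(V,[s])$ by scalar extension from $k$ to $F$ is anisotropic. Hence also, for every field extension $\ell/k$ of odd degree, the generalized quadratic space over $Q\otimes_k\ell$ obtained from $(V,[s])$ by scalar extension from $k$ to $\ell$ is anisotropic.
   Context: The following definitions apply to an arbitrary quaternion algebra $Q$ (possibly split) over an arbitrary field $k$ (any characteristic), with reduced trace $\mathrm{Trd}_Q$ and canonical involution $\overline{x}=\mathrm{Trd}_Q(x)-x$. Let $V$ be a finitely generated right $Q$-module. A sesquilinear map on $V$ is a $k$-bilinear map $s\colon V\times V\to Q$ with $s(vx,wy)=\overline{x}\,s(v,w)\,y$ for $v,w\in V$, $x,y\in Q$; the $k$-vector space of such maps is $\mathrm{Sesq}(V)$. For $s\in\mathrm{Sesq}(V)$ define $s^\dagger\in \mathrm{Sesq}(V)$ by $s^\dagger(v,w)=\overline{s(w,v)}$. Let $\mathrm{Herm}^+(V)=\{s+s^\dagger\mid s\in\mathrm{Sesq}(V)\}$. Generalized quadratic forms on $V$ are the elements of $\mathrm{Quad}(V)=\mathrm{Sesq}(V)/\mathrm{Herm}^+(V)$; the class of $s$ is denoted $[s]$. Put $h_s=s-s^\dagger$ and $q_s\colon V\to Q/k$, $q_s(v)=s(v,v)+k$; both depend only on $[s]$. The form $[s]$ is nonsingular if the map $v\mapsto h_s(v,\cdot)$ from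 $V$ to $V^*=\mathrm{Hom}_Q(V,Q)$ is bijective. It is isotropic if there is a nonzero $v\in V$ with $q_s(v)=0$, i.e. $s(v,v)\in k$. A generalized quadratic space over $Q$ is a pair $(V,[s])$ with $V$ a finitely generated right $Q$-module and $[s]\in\mathrm{Quad}(V)$ nonsingular; it is isotropic if $[s]$ is isotropic, and anisotropic otherwise. For a field extension $L/k$, the scalar extension of $(V,[s])$ to $L$ is the generalized quadratic space $(V\otimes_kL,[s_L])$ over the quaternion $L$-algebra $Q\otimes_kL$, where $s_L$ is the $L$-bilinear extension of $s$. The Severi--Brauer conic of $Q$ is the variety of $2$-dimensional right ideals in $Q$. *)

theory Defs
  imports
    "HOL-Library.Poly_Mapping"
    "HOL-Algebra.Algebraic_Closure_Type"
    "HOL-Analysis.Cartesian_Space"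
begin

section \<open>Algebras and quaternion algebras\<close>

text \<open>
  A (unital, associative) \<open>k\<close>-algebra is a ring type with a structure map \<open>\<eta>\<close> from \<open>k\<close> into the
  centre. When the ring is a field, this is a field extension. The subset \<open>range \<eta>\<close> is what the
  literature writes as \<open>k \<subseteq> A\<close>.
\<close>

locale k_algebra =
  fixes \<eta> :: "'k::field \<Rightarrow> 'a::ring_1"
  assumes structure_add: "\<eta> (c + d) = \<eta> c + \<eta> d"
    and structure_mult: "\<eta> (c * d) = \<eta> c * \<eta> d"
    and structure_one: "\<eta> 1 = 1"
    and structure_central: "\<eta> c * x = x * \<eta> c"

definition alg_scale :: "('k::field \<Rightarrow> 'a::ring_1) \<Rightarrow> 'k \<Rightarrow> 'a \<Rightarrow> 'a" where
  "alg_scale \<eta> c x = \<eta> c * x"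

text \<open>The library's \<open>dim\<close> is \<open>0\<close> in the infinite-dimensional case.\<close>

definition alg_dim :: "('k::field \<Rightarrow> 'a::ring_1) \<Rightarrow> nat" where
  "alg_dim \<eta> = vector_space.dim (alg_scale \<eta>) (UNIV :: 'a set)"

definition two_sided_ideal :: "'a::ring_1 set \<Rightarrow> bool" where
  "two_sided_ideal I \<longleftrightarrow>
     0 \<in> I \<and> (\<forall>x\<in>I. \<forall>y\<in>I. x + y \<in> I) \<and> (\<forall>x\<in>I. \<forall>a. a * x \<in> I \<and> x * a \<in> I)"

locale quaternion_algebra = k_algebra \<eta> for \<eta> :: "'k::field \<Rightarrow> 'a::ring_1" +
  assumes center: "(\<forall>y. x * y = y * x) \<Longrightarrow> x \<in> range \<eta>"
    and simple: "two_sided_ideal (I :: 'a set) \<Longrightarrow> I = {0} \<or> I = UNIV"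
    and dim_four: "alg_dim \<eta> = 4"

text \<open>
  The reduced characteristic polynomial of \<open>x\<close> has degree \<open>2\<close>. It is \<open>(X - x)\<^sup>2\<close> if \<open>x \<in> k\<close>, and the
  minimal polynomial \<open>X\<^sup>2 - t X + n\<close> of \<open>x\<close> otherwise; the reduced trace is \<open>2 x\<close>, respectively \<open>t\<close>.
\<close>

definition reduced_trace :: "('k::field \<Rightarrow> 'a::ring_1) \<Rightarrow> 'a \<Rightarrow> 'k" where
  "reduced_trace \<eta> x =
     (if x \<in> range \<eta> then 2 * (THE c. \<eta> c = x)
      else (THE t. x * x - \<eta> t * x \<in> range \<eta>))"

definition canonical_involution :: "('k::field \<Rightarrow> 'a::ring_1) \<Rightarrow> 'a \<Rightarrow> 'a" where
  "canonical_involution \<eta> x = \<eta> (reduced_trace \<eta> x) - x"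


section \<open>Generalized quadratic forms\<close>

locale right_module =
  fixes act :: "'v::ab_group_add \<Rightarrow> 'a::ring_1 \<Rightarrow> 'v"
  assumes act_add_left: "act (v + w) x = act v x + act w x"
    and act_add_right: "act v (x + y) = act v x + act v y"
    and act_mult: "act v (x * y) = act (act v x) y"
    and act_one: "act v 1 = v"

definition finitely_generated :: "('v::ab_group_add \<Rightarrow> 'a::ring_1 \<Rightarrow> 'v) \<Rightarrow> bool" where
  "finitely_generated act \<longleftrightarrow> (\<exists>S. finite S \<and> (\<forall>v. \<exists>c. v = (\<Sum>x\<in>S. act x (c x))))"

definition k_bilinear ::
  "('k::field \<Rightarrow> 'a::ring_1) \<Rightarrow> ('v::ab_group_add \<Rightarrow> 'a \<Rightarrow> 'v) \<Rightarrow> ('v \<Rightarrow> 'v \<Rightarrow> 'a) \<Rightarrow> bool" where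
  "k_bilinear \<eta> act s \<longleftrightarrow>
     (\<forall>v v' w. s (v + v') w = s v w + s v' w) \<and>
     (\<forall>v w w'. s v (w + w') = s v w + s v w') \<and>
     (\<forall>v w c. s (act v (\<eta> c)) w = s v w * \<eta> c) \<and>
     (\<forall>v w c. s v (act w (\<eta> c)) = s v w * \<eta> c)"

definition Sesq ::
  "('k::field \<Rightarrow> 'a::ring_1) \<Rightarrow> ('v::ab_group_add \<Rightarrow> 'a \<Rightarrow> 'v) \<Rightarrow> ('v \<Rightarrow> 'v \<Rightarrow> 'a) set" where
  "Sesq \<eta> act =
     {s. k_bilinear \<eta> act s \<and> (\<forall>v w x y. s (act v x) (act w y) = canonical_involution \<eta> x * s v w * y)}"

definition dagger ::
  "('k::field \<Rightarrow> 'a::ring_1) \<Rightarrow> ('v \<Rightarrow> 'v \<Rightarrow> 'a) \<Rightarrow> 'v \<Rightarrow> 'v \<Rightarrow> 'a" where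
  "dagger \<eta> s v w = canonical_involution \<eta> (s w v)"

definition Herm_plus ::
  "('k::field \<Rightarrow> 'a::ring_1) \<Rightarrow> ('v::ab_group_add \<Rightarrow> 'a \<Rightarrow> 'v) \<Rightarrow> ('v \<Rightarrow> 'v \<Rightarrow> 'a) set" where
  "Herm_plus \<eta> act = {(\<lambda>v w. s v w + dagger \<eta> s v w) | s. s \<in> Sesq \<eta> act}"

text \<open>The class \<open>[s]\<close>, as a coset of \<open>Herm\<^sup>+(V)\<close>.\<close>

definition form_class ::
  "('k::field \<Rightarrow> 'a::ring_1) \<Rightarrow> ('v::ab_group_add \<Rightarrow> 'a \<Rightarrow> 'v) \<Rightarrow> ('v \<Rightarrow> 'v \<Rightarrow> 'a)
     \<Rightarrow> ('v \<Rightarrow> 'v \<Rightarrow> 'a) set" where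
  "form_class \<eta> act s = {(\<lambda>v w. s v w + h v w) | h. h \<in> Herm_plus \<eta> act}"

definition Quad ::
  "('k::field \<Rightarrow> 'a::ring_1) \<Rightarrow> ('v::ab_group_add \<Rightarrow> 'a \<Rightarrow> 'v) \<Rightarrow> ('v \<Rightarrow> 'v \<Rightarrow> 'a) set set" where
  "Quad \<eta> act = form_class \<eta> act ` Sesq \<eta> act"

definition h_form ::
  "('k::field \<Rightarrow> 'a::ring_1) \<Rightarrow> ('v \<Rightarrow> 'v \<Rightarrow> 'a) \<Rightarrow> 'v \<Rightarrow> 'v \<Rightarrow> 'a" where
  "h_form \<eta> s v w = s v w - dagger \<eta> s v w"

text \<open>The value \<open>q\<^sub>s(v)\<close> in the quotient group \<open>Q/k\<close>, as a coset; the zero of \<open>Q/k\<close> is \<open>range \<eta>\<close>.\<close>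

definition q_map ::
  "('k::field \<Rightarrow> 'a::ring_1) \<Rightarrow> ('v \<Rightarrow> 'v \<Rightarrow> 'a) \<Rightarrow> 'v \<Rightarrow> 'a set" where
  "q_map \<eta> s v = {s v v + \<eta> c | c. True}"

definition module_dual :: "('v::ab_group_add \<Rightarrow> 'a::ring_1 \<Rightarrow> 'v) \<Rightarrow> ('v \<Rightarrow> 'a) set" where
  "module_dual act = {f. (\<forall>v w. f (v + w) = f v + f w) \<and> (\<forall>v x. f (act v x) = f v * x)}"

text \<open>In the next two definitions the choice of the representative \<open>s\<close> of the class \<open>\<phi>\<close> is irrelevant.\<close>

definition nonsingular ::
  "('k::field \<Rightarrow> 'a::ring_1) \<Rightarrow> ('v::ab_group_add \<Rightarrow> 'a \<Rightarrow> 'v) \<Rightarrow> ('v \<Rightarrow> 'v \<Rightarrow> 'a) set \<Rightarrow> bool" where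
  "nonsingular \<eta> act \<phi> \<longleftrightarrow>
     (\<exists>s\<in>\<phi>. bij_betw (\<lambda>v. h_form \<eta> s v) UNIV (module_dual act))"

definition isotropic ::
  "('k::field \<Rightarrow> 'a::ring_1) \<Rightarrow> ('v::ab_group_add \<Rightarrow> 'v \<Rightarrow> 'a) set \<Rightarrow> bool" where
  "isotropic \<eta> \<phi> \<longleftrightarrow> (\<exists>s\<in>\<phi>. \<exists>v. v \<noteq> 0 \<and> q_map \<eta> s v = range \<eta>)"

abbreviation anisotropic ::
  "('k::field \<Rightarrow> 'a::ring_1) \<Rightarrow> ('v::ab_group_add \<Rightarrow> 'v \<Rightarrow> 'a) set \<Rightarrow> bool" where
  "anisotropic \<eta> \<phi> \<equiv> \<not> isotropic \<eta> \<phi>"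

definition generalized_quadratic_space ::
  "('k::field \<Rightarrow> 'a::ring_1) \<Rightarrow> ('v::ab_group_add \<Rightarrow> 'a \<Rightarrow> 'v) \<Rightarrow> ('v \<Rightarrow> 'v \<Rightarrow> 'a) set \<Rightarrow> bool" where
  "generalized_quadratic_space \<eta> act \<phi> \<longleftrightarrow>
     right_module act \<and> finitely_generated act \<and> \<phi> \<in> Quad \<eta> act \<and> nonsingular \<eta> act \<phi>"


section \<open>Tensor products and scalar extension\<close>

text \<open>
  The tensor product over \<open>k\<close> of two \<open>k\<close>-vector spaces \<open>A\<close>, \<open>B\<close> is the free vector space on \<open>A \<times> B\<close>
  modulo the subspace generated by the bilinearity relations. Since a type cannot depend on the
  scalar multiplications, we say when a map \<open>\<tau>: A \<times> B \<rightarrow> T\<close> identifies a vector space \<open>T\<close> with this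
  quotient, \<open>\<tau> a b\<close> being \<open>a \<otimes> b\<close>.
\<close>

definition free_scale :: "'k::field \<Rightarrow> ('p \<Rightarrow>\<^sub>0 'k) \<Rightarrow> ('p \<Rightarrow>\<^sub>0 'k)" where
  "free_scale c f = Poly_Mapping.map (\<lambda>d. c * d) f"

definition tensor_generators ::
  "('k::field \<Rightarrow> 'a::ab_group_add \<Rightarrow> 'a) \<Rightarrow> ('k \<Rightarrow> 'b::ab_group_add \<Rightarrow> 'b)
     \<Rightarrow> (('a \<times> 'b) \<Rightarrow>\<^sub>0 'k) set" where
  "tensor_generators scA scB =
     {Poly_Mapping.single (a + a', b) 1 - Poly_Mapping.single (a, b) 1
        - Poly_Mapping.single (a', b) 1 | a a' b. True} \<union>
     {Poly_Mapping.single (a, b + b') 1 - Poly_Mapping.single (a, b) 1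
        - Poly_Mapping.single (a, b') 1 | a b b'. True} \<union>
     {Poly_Mapping.single (scA c a, b) 1 - Poly_Mapping.single (a, b) c | c a b. True} \<union>
     {Poly_Mapping.single (a, scB c b) 1 - Poly_Mapping.single (a, b) c | c a b. True}"

definition tensor_relations ::
  "('k::field \<Rightarrow> 'a::ab_group_add \<Rightarrow> 'a) \<Rightarrow> ('k \<Rightarrow> 'b::ab_group_add \<Rightarrow> 'b)
     \<Rightarrow> (('a \<times> 'b) \<Rightarrow>\<^sub>0 'k) set" where
  "tensor_relations scA scB = Modules.module.span free_scale (tensor_generators scA scB)"

definition free_lift ::
  "('k::field \<Rightarrow> 't::ab_group_add \<Rightarrow> 't) \<Rightarrow> ('p \<Rightarrow> 't) \<Rightarrow> ('p \<Rightarrow>\<^sub>0 'k) \<Rightarrow> 't" where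
  "free_lift scT g f = (\<Sum>p\<in>Poly_Mapping.keys f. scT (Poly_Mapping.lookup f p) (g p))"

definition is_tensor_product ::
  "('k::field \<Rightarrow> 'a::ab_group_add \<Rightarrow> 'a) \<Rightarrow> ('k \<Rightarrow> 'b::ab_group_add \<Rightarrow> 'b)
     \<Rightarrow> ('k \<Rightarrow> 't::ab_group_add \<Rightarrow> 't) \<Rightarrow> ('a \<Rightarrow> 'b \<Rightarrow> 't) \<Rightarrow> bool" where
  "is_tensor_product scA scB scT \<tau> \<longleftrightarrow>
     vector_space scT \<and>
     surj (free_lift scT (\<lambda>(a, b). \<tau> a b)) \<and>
     {f. free_lift scT (\<lambda>(a, b). \<tau> a b) f = 0} = tensor_relations scA scB"

text \<open>
  Data presenting the scalar extension of \<open>(V, [s])\<close> along a field extension \<open>j : k \<rightarrow> L\<close>: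
  the \<open>L\<close>-algebra \<open>Q \<otimes>\<^sub>k L\<close> with structure map \<open>\<eta>L\<close> and pure tensors \<open>\<tau>Q\<close>, the right
  \<open>Q \<otimes>\<^sub>k L\<close>-module \<open>V \<otimes>\<^sub>k L\<close> with action \<open>actL\<close> and pure tensors \<open>\<tau>V\<close>, and the \<open>L\<close>-bilinear
  extension \<open>sL\<close> of \<open>s\<close>.
\<close>

locale scalar_extension =
  fixes \<eta> :: "'k::field \<Rightarrow> 'q::ring_1"
    and act :: "'v::ab_group_add \<Rightarrow> 'q \<Rightarrow> 'v"
    and s :: "'v \<Rightarrow> 'v \<Rightarrow> 'q"
    and j :: "'k \<Rightarrow> 'l::field"
    and \<tau>Q :: "'q \<Rightarrow> 'l \<Rightarrow> 'r::ring_1"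
    and \<eta>L :: "'l \<Rightarrow> 'r"
    and \<tau>V :: "'v \<Rightarrow> 'l \<Rightarrow> 'w::ab_group_add"
    and actL :: "'w \<Rightarrow> 'r \<Rightarrow> 'w"
    and sL :: "'w \<Rightarrow> 'w \<Rightarrow> 'r"
  assumes extension: "k_algebra j"
    and algebra_tensor:
      "is_tensor_product (alg_scale \<eta>) (alg_scale j) (\<lambda>c. alg_scale \<eta>L (j c)) \<tau>Q"
    and algebra_mult: "\<tau>Q x a * \<tau>Q y b = \<tau>Q (x * y) (a * b)"
    and algebra_one: "\<tau>Q 1 1 = 1"
    and algebra_structure: "\<eta>L a = \<tau>Q 1 a"
    and module_ext: "right_module actL"
    and module_tensor:
      "is_tensor_product (\<lambda>c v. act v (\<eta> c)) (alg_scale j) (\<lambda>c w. actL w (\<eta>L (j c))) \<tau>V"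
    and module_act: "actL (\<tau>V v a) (\<tau>Q x b) = \<tau>V (act v x) (a * b)"
    and form_bilinear: "k_bilinear \<eta>L actL sL"
    and form_extends: "sL (\<tau>V v 1) (\<tau>V w 1) = \<tau>Q (s v w) 1"


section \<open>The Severi--Brauer conic and its function field\<close>

text \<open>
  Let \<open>e\<close> be a \<open>k\<close>-basis of the quaternion algebra \<open>Q\<close> and \<open>K\<close> an algebraic closure of \<open>k\<close>. Then
  \<open>Q \<otimes>\<^sub>k K\<close> is \<open>K\<^sup>4\<close> with the multiplication given by the structure constants of \<open>Q\<close>. The
  Severi--Brauer conic is the closed subvariety of the Grassmannian of planes in \<open>Q\<close> formed by the
  right ideals; the Grassmannian is embedded in projective space by the Pluecker coordinates
  \<open>u\<^sub>m w\<^sub>n - u\<^sub>n w\<^sub>m\<close>.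
\<close>

definition is_basis4 :: "('k::field \<Rightarrow> 'q::ring_1) \<Rightarrow> (4 \<Rightarrow> 'q) \<Rightarrow> bool" where
  "is_basis4 \<eta> e \<longleftrightarrow>
     inj e \<and> \<not> Modules.module.dependent (alg_scale \<eta>) (range e) \<and>
     Modules.module.span (alg_scale \<eta>) (range e) = UNIV"

definition structure_const ::
  "('k::field \<Rightarrow> 'q::ring_1) \<Rightarrow> (4 \<Rightarrow> 'q) \<Rightarrow> 4 \<Rightarrow> 4 \<Rightarrow> 4 \<Rightarrow> 'k" where
  "structure_const \<eta> e i j m =
     Modules.module.representation (alg_scale \<eta>) (range e) (e i * e j) (e m)"

definition closure_mult ::
  "('k::field \<Rightarrow> 'q::ring_1) \<Rightarrow> (4 \<Rightarrow> 'q) \<Rightarrow> 'k alg_closure ^ 4 \<Rightarrow> 'k alg_closure ^ 4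
     \<Rightarrow> 'k alg_closure ^ 4" where
  "closure_mult \<eta> e u w =
     (\<chi> m. \<Sum>i\<in>UNIV. \<Sum>j\<in>UNIV. u $ i * w $ j * to_ac (structure_const \<eta> e i j m))"

definition conic_ideal ::
  "('k::field \<Rightarrow> 'q::ring_1) \<Rightarrow> (4 \<Rightarrow> 'q) \<Rightarrow> ('k alg_closure ^ 4) set \<Rightarrow> bool" where
  "conic_ideal \<eta> e J \<longleftrightarrow>
     vec.subspace J \<and> vec.dim J = 2 \<and> (\<forall>u\<in>J. \<forall>w. closure_mult \<eta> e u w \<in> J)"

definition pluecker :: "'f::field ^ 4 \<Rightarrow> 'f ^ 4 \<Rightarrow> 4 \<times> 4 \<Rightarrow> 'f" where
  "pluecker u w = (\<lambda>(m, n). u $ m * w $ n - u $ n * w $ m)"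

text \<open>All homogeneous coordinate vectors of the geometric points of the conic.\<close>

definition conic_points ::
  "('k::field \<Rightarrow> 'q::ring_1) \<Rightarrow> (4 \<Rightarrow> 'q) \<Rightarrow> (4 \<times> 4 \<Rightarrow> 'k alg_closure) set" where
  "conic_points \<eta> e =
     {pluecker u w | u w J. conic_ideal \<eta> e J \<and> vec.span {u, w} = J}"

type_synonym ('i, 'k) poly_in = "('i \<Rightarrow>\<^sub>0 nat) \<Rightarrow>\<^sub>0 'k"

definition eval_poly :: "('i, 'k::field) poly_in \<Rightarrow> ('i \<Rightarrow> 'k alg_closure) \<Rightarrow> 'k alg_closure" where
  "eval_poly f x =
     (\<Sum>m\<in>Poly_Mapping.keys f. to_ac (Poly_Mapping.lookup f m) *
        (\<Prod>i\<in>Poly_Mapping.keys m. x i ^ Poly_Mapping.lookup m i))"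

definition homogeneous :: "nat \<Rightarrow> ('i, 'k::field) poly_in \<Rightarrow> bool" where
  "homogeneous d f \<longleftrightarrow>
     (\<forall>m\<in>Poly_Mapping.keys f. (\<Sum>i\<in>Poly_Mapping.keys m. Poly_Mapping.lookup m i) = d)"

text \<open>
  Rational functions on a projective variety \<open>Z\<close> over \<open>k\<close>, given by the homogeneous coordinates
  of its points over the algebraic closure: fractions \<open>f/g\<close> of homogeneous polynomials over \<open>k\<close>
  of the same degree with \<open>g\<close> not vanishing identically on \<open>Z\<close>. The function field of \<open>Z\<close> consists
  of these fractions up to equality on \<open>Z\<close>.
\<close>

definition rational_fractions ::
  "('i \<Rightarrow> 'k::field alg_closure) set \<Rightarrow> (('i, 'k) poly_in \<times> ('i, 'k) poly_in) set" where
  "rational_fractions Z =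
     {(f, g). (\<exists>d. homogeneous d f \<and> homogeneous d g) \<and> (\<exists>x\<in>Z. eval_poly g x \<noteq> 0)}"

definition same_fraction ::
  "('i \<Rightarrow> 'k::field alg_closure) set \<Rightarrow> ('i, 'k) poly_in \<times> ('i, 'k) poly_in
     \<Rightarrow> ('i, 'k) poly_in \<times> ('i, 'k) poly_in \<Rightarrow> bool" where
  "same_fraction Z = (\<lambda>(f, g) (f', g').
     \<forall>x\<in>Z. eval_poly f x * eval_poly g' x = eval_poly f' x * eval_poly g x)"

text \<open>
  The field extension \<open>j : k \<rightarrow> F\<close> is isomorphic to the function field of \<open>Z\<close> via \<open>\<Phi>\<close>.
\<close>

definition is_function_field ::
  "('i \<Rightarrow> 'k::field alg_closure) set \<Rightarrow> ('k \<Rightarrow> 'f::field) \<Rightarrow> bool" where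
  "is_function_field Z j \<longleftrightarrow>
     (\<exists>\<Phi> :: ('i, 'k) poly_in \<times> ('i, 'k) poly_in \<Rightarrow> 'f.
        \<Phi> ` rational_fractions Z = UNIV \<and>
        (\<forall>r\<in>rational_fractions Z. \<forall>r'\<in>rational_fractions Z.
           \<Phi> r = \<Phi> r' \<longleftrightarrow> same_fraction Z r r') \<and>
        (\<forall>(f, g)\<in>rational_fractions Z. \<forall>(f', g')\<in>rational_fractions Z.
           \<Phi> (f * g' + f' * g, g * g') = \<Phi> (f, g) + \<Phi> (f', g') \<and>
           \<Phi> (f * f', g * g') = \<Phi> (f, g) * \<Phi> (f', g')) \<and>
        (\<forall>c. \<Phi> (Poly_Mapping.single 0 c, 1) = j c))"

definition conic_function_field ::
  "('k::field \<Rightarrow> 'q::ring_1) \<Rightarrow> ('k \<Rightarrow> 'f::field) \<Rightarrow> bool" where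
  "conic_function_field \<eta> j \<longleftrightarrow>
     (\<exists>e. is_basis4 \<eta> e \<and> is_function_field (conic_points \<eta> e) j)"

end

theory Submission
  imports Defs "HOL-Library.Function_Algebras" "HOL-Computational_Algebra.Fraction_Field"
begin

text \<open>
  Write \<open>Q = K \<oplus> jK\<close> with \<open>K = k(i)\<close> a separable quadratic extension of \<open>k\<close>, \<open>j\<^sup>2 = b \<in> k\<close> and
  \<open>x j = j x'\<close> for \<open>x \<in> K\<close>, where \<open>x \<mapsto> x'\<close> is the nontrivial automorphism of \<open>K\<close>. Let \<open>c(v, w)\<close>
  be the component of \<open>s(v, w)\<close> in \<open>jK\<close>. It is \<open>K\<close>-bilinear, and \<open>s(v, v)\<close> lies in \<open>k\<close> if and only
  if \<open>c(v, v) = 0\<close> and \<open>c(v, vj) + c(vj, v) = 0\<close>. So the anisotropy of a generalized quadratic form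
  becomes a statement on the values of one quadratic form \<open>c(w, w)\<close> over \<open>K\<close>.

  Over \<open>K\<close> the conic is a projective line, with function field \<open>K(t)\<close>; the nontrivial automorphism
  extends to \<open>K(t)\<close> by \<open>t \<mapsto> \<tau> = 1 / (b t)\<close>, and \<open>F\<close> is the fixed field. It is the field of
  fractions of the ring \<open>A\<close> spanned by the elements \<open>\<kappa> t\<^sup>i + \<kappa>' \<tau>\<^sup>i\<close> with \<open>\<kappa> \<in> K\<close>. The algebra
  \<open>Q\<close> splits over \<open>F\<close>, and Morita equivalence replaces \<open>V \<otimes> F\<close> by the \<open>F\<close>-space generated by the
  vectors \<open>v + t vj\<close>, with the quadratic form \<open>w \<mapsto> c(w, w)\<close>; up to the constant factor \<open>t \<delta>\<close>
  its values are in \<open>F\<close>. After clearing denominators, a vector lies in the span \<open>M n\<close> of the vectors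
  \<open>t\<^sup>i x + t \<tau>\<^sup>i y\<close> with \<open>1 \<le> i \<le> n\<close> and \<open>(x, y) = (v, vj)\<close>. The heart of the proof is a descent
  on \<open>n\<close> (\<open>descent\<close>), in the spirit of the Cassels--Pfister theorem: if \<open>c(w, w) = 0\<close> with \<open>w\<close>
  in \<open>M n\<close> and \<open>n > 1\<close>, then combining \<open>w\<close> with the vector of index \<open>1\<close> belonging to the leading
  pair \<open>(x, y)\<close> of \<open>w\<close> gives an isotropic vector of \<open>M (n - 1)\<close>. In \<open>M 1\<close> an
  isotropic vector would make \<open>s\<close> itself isotropic. The lemma \<open>F_common_zero\<close> states the result
  in coordinates: with respect to a \<open>k\<close>-basis of \<open>V\<close>, the vector is isotropic when three quadratic
  forms vanish, namely the coordinates of \<open>s(x, x)\<close> along \<open>i\<close>, \<open>j\<close> and \<open>ji\<close>.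

  Only a homomorphism from the function field of the conic into \<open>F\<close> is needed. It is evaluation at the
  generic right ideal, whose Pluecker coordinates are, after division by \<open>t \<delta>\<close>, elements
  of \<open>A\<close> (\<open>function_field_common_zero\<close>).

  All this works over any field \<open>E\<close> over which the form is anisotropic and \<open>K\<close> stays a field. For an
  extension of odd degree the form is followed up a tower of simple extensions \<open>E(\<theta>)\<close> of odd
  degree. The minimal polynomial of \<open>\<theta>\<close> has a root \<open>\<alpha>\<close> of odd degree over the field \<open>F\<close> built from \<open>E\<close>.
  Over \<open>F\<close> the form has become an ordinary anisotropic quadratic form, and stays anisotropic over
  \<open>F(\<alpha>)\<close> by Springer's theorem; since \<open>E(\<theta>)\<close> embeds into \<open>F(\<alpha>)\<close>, the generalized quadratic form
  is anisotropic over \<open>E(\<theta>)\<close> (\<open>adjoin_common_zero\<close>).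
\<close>

hide_const (open) Polynomials.degree UnivPoly.up_ring.monom

section \<open>Minimal polynomials and Springer's theorem\<close>

definition is_subfield :: "'a::field set \<Rightarrow> bool" where
  "is_subfield E \<longleftrightarrow> 1 \<in> E \<and> (\<forall>x\<in>E. \<forall>y\<in>E. x - y \<in> E \<and> x * y \<in> E) \<and> (\<forall>x\<in>E. inverse x \<in> E)"

definition polys_over :: "'a::zero set \<Rightarrow> 'a poly set" where
  "polys_over E = {p. \<forall>i. coeff p i \<in> E}"

lemma subfield_one: "is_subfield E \<Longrightarrow> 1 \<in> E"
  and subfield_diff: "is_subfield E \<Longrightarrow> x \<in> E \<Longrightarrow> y \<in> E \<Longrightarrow> x - y \<in> E"
  and subfield_mult: "is_subfield E \<Longrightarrow> x \<in> E \<Longrightarrow> y \<in> E \<Longrightarrow> x * y \<in> E"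
  and subfield_inverse: "is_subfield E \<Longrightarrow> x \<in> E \<Longrightarrow> inverse x \<in> E"
  by (auto simp: is_subfield_def)

lemma subfield_zero: "is_subfield E \<Longrightarrow> 0 \<in> E"
  using subfield_diff[OF _ subfield_one subfield_one] by force
lemma subfield_uminus: "is_subfield E \<Longrightarrow> x \<in> E \<Longrightarrow> - x \<in> E"
  using subfield_diff[OF _ subfield_zero] by force
lemma subfield_add: "is_subfield E \<Longrightarrow> x \<in> E \<Longrightarrow> y \<in> E \<Longrightarrow> x + y \<in> E"
  using subfield_diff[of E x "- y"] subfield_uminus by force
lemma subfield_divide: "is_subfield E \<Longrightarrow> x \<in> E \<Longrightarrow> y \<in> E \<Longrightarrow> x / y \<in> E"
  by (simp add: divide_inverse subfield_mult subfield_inverse)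
lemma subfield_sum: "is_subfield E \<Longrightarrow> (\<And>x. x \<in> S \<Longrightarrow> f x \<in> E) \<Longrightarrow> sum f S \<in> E"
  by (induction S rule: infinite_finite_induct) (auto intro: subfield_add subfield_zero)
lemma subfield_power: "is_subfield E \<Longrightarrow> x \<in> E \<Longrightarrow> x ^ n \<in> E"
  by (induction n) (auto intro: subfield_one subfield_mult)

lemmas subfield_intros = subfield_zero subfield_one subfield_add subfield_diff subfield_uminus
  subfield_mult subfield_inverse subfield_divide subfield_power

lemma polys_over_coeff: "p \<in> polys_over E \<Longrightarrow> coeff p i \<in> E"
  by (simp add: polys_over_def)
lemma polys_over_zero: "is_subfield E \<Longrightarrow> 0 \<in> polys_over E"
  by (simp add: polys_over_def subfield_zero)
lemma polys_over_add: "is_subfield E \<Longrightarrow> p \<in> polys_over E \<Longrightarrow> q \<in> polys_over E \<Longrightarrow> p + q \<in> polys_over E"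
  by (simp add: polys_over_def subfield_add)
lemma polys_over_diff: "is_subfield E \<Longrightarrow> p \<in> polys_over E \<Longrightarrow> q \<in> polys_over E \<Longrightarrow> p - q \<in> polys_over E"
  by (simp add: polys_over_def subfield_diff)
lemma polys_over_mult: "is_subfield E \<Longrightarrow> p \<in> polys_over E \<Longrightarrow> q \<in> polys_over E \<Longrightarrow> p * q \<in> polys_over E"
  by (simp add: polys_over_def coeff_mult subfield_sum subfield_mult)
lemma polys_over_smult: "is_subfield E \<Longrightarrow> a \<in> E \<Longrightarrow> p \<in> polys_over E \<Longrightarrow> smult a p \<in> polys_over E"
  by (simp add: polys_over_def subfield_mult)
lemma polys_over_monom: "is_subfield E \<Longrightarrow> a \<in> E \<Longrightarrow> monom a n \<in> polys_over E"
  by (simp add: polys_over_def subfield_zero)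
lemma polys_over_sum: "is_subfield E \<Longrightarrow> (\<And>x. x \<in> S \<Longrightarrow> f x \<in> polys_over E) \<Longrightarrow> sum f S \<in> polys_over E"
  by (induction S rule: infinite_finite_induct) (auto intro: polys_over_add polys_over_zero)
lemma polys_over_pCons: "is_subfield E \<Longrightarrow> a \<in> E \<Longrightarrow> p \<in> polys_over E \<Longrightarrow> pCons a p \<in> polys_over E"
  by (auto simp: polys_over_def coeff_pCons split: nat.split)

lemma polys_over_division:
  assumes E: "is_subfield E" and q: "q \<in> polys_over E" "q \<noteq> 0"
  shows "p \<in> polys_over E \<Longrightarrow>
    \<exists>a\<in>polys_over E. \<exists>r\<in>polys_over E. p = q * a + r \<and> (r = 0 \<or> degree r < degree q)"
proof (induction "degree p" arbitrary: p rule: less_induct)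
  case less
  show ?case
  proof (cases "p = 0 \<or> degree p < degree q")
    case True
    then show ?thesis using less.prems E
      by (intro bexI[of _ 0] bexI[of _ p]) (auto intro: polys_over_zero)
  next
    case False
    define u where "u = monom (lead_coeff p / lead_coeff q) (degree p - degree q)"
    have u: "u \<in> polys_over E" unfolding u_def using less.prems q E
      by (intro polys_over_monom subfield_divide polys_over_coeff) auto
    have p': "p - q * u \<in> polys_over E" using less.prems q u E by (intro polys_over_diff polys_over_mult)
    have deg_qu: "degree (q * u) = degree p"
      using False q by (auto simp: u_def degree_mult_eq degree_monom_eq)
    have "lead_coeff p / lead_coeff q \<noteq> 0" using False q by simp
    then have "degree u = degree p - degree q" unfolding u_def by (rule degree_monom_eq)
    then have "lead_coeff u = lead_coeff p / lead_coeff q" by (simp only: u_def coeff_monom if_True refl)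
    then have "lead_coeff (q * u) = lead_coeff p" using q by (simp add: lead_coeff_mult)
    then have lc: "coeff (q * u) (degree p) = lead_coeff p" by (simp only: deg_qu)
    have "\<exists>a\<in>polys_over E. \<exists>r\<in>polys_over E. p - q * u = q * a + r \<and> (r = 0 \<or> degree r < degree q)"
    proof (cases "p - q * u = 0")
      case True
      then show ?thesis using E by (intro bexI[of _ 0]) (auto intro: polys_over_zero)
    next
      case nz: False
      have "degree (p - q * u) < degree p"
        using nz lc deg_qu eq_zero_or_degree_less[of "p - q * u" "degree p"]
        by (simp add: degree_diff_le)
      then show ?thesis by (rule less.hyps[OF _ p'])
    qed
    then obtain a r where *: "a \<in> polys_over E" "r \<in> polys_over E" "p - q * u = q * a + r"
      "r = 0 \<or> degree r < degree q" by blast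
    then have "p = q * (a + u) + r" by (simp add: algebra_simps)
    then show ?thesis using * polys_over_add[OF E *(1) u]
      by (intro bexI[of _ "a + u"] bexI[of _ r] conjI)
  qed
qed

text \<open>
  The leading coefficient is not normalized, so \<open>m\<close> is determined up to a nonzero factor in \<open>E\<close>.
\<close>

definition minimal_poly :: "'a::field set \<Rightarrow> 'a \<Rightarrow> 'a poly \<Rightarrow> bool" where
  "minimal_poly E \<alpha> m \<longleftrightarrow> m \<in> polys_over E \<and> m \<noteq> 0 \<and> poly m \<alpha> = 0 \<and>
     (\<forall>p\<in>polys_over E. poly p \<alpha> = 0 \<longrightarrow> (\<exists>a\<in>polys_over E. p = m * a))"

lemma minimal_polyD:
  assumes "minimal_poly E \<alpha> m" shows "m \<in> polys_over E" "m \<noteq> 0" "poly m \<alpha> = 0"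
  using assms by (auto simp: minimal_poly_def)

lemma minimal_poly_exists:
  assumes E: "is_subfield E" and p: "p \<in> polys_over E" "p \<noteq> 0" "poly p \<alpha> = 0"
  shows "\<exists>m. minimal_poly E \<alpha> m"
proof -
  define P where "P = (\<lambda>m. m \<in> polys_over E \<and> m \<noteq> 0 \<and> poly m \<alpha> = 0)"
  obtain m where m: "P m" and least: "\<And>m'. P m' \<Longrightarrow> degree m \<le> degree m'"
    using ex_has_least_nat[of P p degree] p unfolding P_def by blast
  have "\<exists>a\<in>polys_over E. q = m * a" if q: "q \<in> polys_over E" "poly q \<alpha> = 0" for q
  proof -
    obtain a r where *: "a \<in> polys_over E" "r \<in> polys_over E" "q = m * a + r" "r = 0 \<or> degree r < degree m"
      using polys_over_division[OF E _ _ q(1), of m] m unfolding P_def by blast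
    have "poly r \<alpha> = 0" using * q m by (simp add: P_def)
    then have "r = 0" using least[of r] * by (force simp: P_def)
    then show ?thesis using * by auto
  qed
  then show ?thesis using m unfolding minimal_poly_def P_def by blast
qed

lemma minimal_poly_dvd:
  assumes "minimal_poly E \<alpha> m" "p \<in> polys_over E" "poly p \<alpha> = 0"
  shows "\<exists>a\<in>polys_over E. p = m * a"
  using assms by (auto simp: minimal_poly_def)

lemma minimal_poly_degree_pos: "minimal_poly E \<alpha> m \<Longrightarrow> 0 < degree m"
  by (auto simp: minimal_poly_def intro!: Nat.gr0I elim!: degree_eq_zeroE)

lemma minimal_poly_degree_le:
  assumes "minimal_poly E \<alpha> m" "p \<in> polys_over E" "p \<noteq> 0" "poly p \<alpha> = 0"
  shows "degree m \<le> degree p"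
proof -
  obtain a where "p = m * a" using assms by (auto simp: minimal_poly_def)
  then show ?thesis using assms by (auto simp: degree_mult_eq)
qed

text \<open>
  Some irreducible factor has odd degree: as long as a root has a minimal polynomial of even degree, it
  is divided out. This replaces a factorization into irreducible polynomials.
\<close>

lemma odd_degree_root:
  fixes h :: "'a::alg_closed_field poly"
  assumes E: "is_subfield E"
  shows "h \<in> polys_over E \<Longrightarrow> odd (degree h) \<Longrightarrow>
    \<exists>\<alpha> m. minimal_poly E \<alpha> m \<and> odd (degree m) \<and> poly h \<alpha> = 0 \<and> degree m \<le> degree h"
proof (induction "degree h" arbitrary: h rule: less_induct)
  case less
  have "0 < degree h" using less.prems by (auto intro: Nat.gr0I)
  then obtain \<alpha> where \<alpha>: "poly h \<alpha> = 0" using alg_closed_imp_poly_has_root by blast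
  have "h \<noteq> 0" using less.prems by auto
  then obtain m where m: "minimal_poly E \<alpha> m" using minimal_poly_exists[OF E] less.prems \<alpha> by blast
  then obtain a where a: "a \<in> polys_over E" "h = m * a" using less.prems \<alpha> by (auto simp: minimal_poly_def)
  have deg: "degree h = degree m + degree a"
    using a \<open>h \<noteq> 0\<close> by (auto simp: degree_mult_eq)
  show ?case
  proof (cases "odd (degree m)")
    case True
    moreover have "degree m \<le> degree h" using deg by simp
    ultimately show ?thesis using m \<alpha> by blast
  next
    case False
    then have "odd (degree a)" "degree a < degree h"
      using deg less.prems minimal_poly_degree_pos[OF m] by auto
    from less.hyps[OF this(2) a(1) this(1)] show ?thesis using deg a by fastforce
  qed
qed

text \<open>
  An isotropic vector over \<open>E(\<alpha>)\<close> is a vector of polynomials \<open>W\<close> of degree at most \<open>n\<close>, below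
  the degree of \<open>m\<close>. By anisotropy \<open>q(W)\<close> has degree exactly \<open>2 n\<close>, so its quotient by \<open>m\<close> has odd
  degree less than that of \<open>m\<close> and some root of the quotient has odd degree over \<open>E\<close>. At this root \<open>W\<close> is isotropic,
  so it vanishes there by induction, and dividing by the minimal polynomial of the root decreases \<open>n\<close>.
\<close>

theorem springer:
  fixes E :: "'a::alg_closed_field set"
  assumes E: "is_subfield E" and B: "finite B"
    and d: "\<And>b b'. b \<in> B \<Longrightarrow> b' \<in> B \<Longrightarrow> d b b' \<in> E"
    and anis: "\<And>x. (\<And>b. b \<in> B \<Longrightarrow> x b \<in> E) \<Longrightarrow> (\<Sum>b\<in>B. \<Sum>b'\<in>B. x b * x b' * d b b') = 0 \<Longrightarrow>
       \<forall>b\<in>B. x b = 0"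
  shows "minimal_poly E \<alpha> m \<Longrightarrow> odd (degree m) \<Longrightarrow> (\<And>b. b \<in> B \<Longrightarrow> W b \<in> polys_over E) \<Longrightarrow>
    (\<Sum>b\<in>B. \<Sum>b'\<in>B. poly (W b) \<alpha> * poly (W b') \<alpha> * d b b') = 0 \<Longrightarrow> \<forall>b\<in>B. poly (W b) \<alpha> = 0"
proof (induction "degree m" arbitrary: \<alpha> m W rule: less_induct)
  case less
  have m0: "m \<in> polys_over E" "m \<noteq> 0" using less.prems(1) by (auto simp: minimal_poly_def)
  note springer_IH = less.hyps and m = less.prems(1,2)
  define q where "q = (\<lambda>x. \<Sum>b\<in>B. \<Sum>b'\<in>B. x b * x b' * d b b')"
  have q_scale: "q (\<lambda>b. a * x b) = a\<^sup>2 * q x" for a x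
    by (simp add: q_def sum_distrib_left power2_eq_square mult_ac)
  define bad where "bad = (\<lambda>n W. (\<forall>b\<in>B. W b \<in> polys_over E \<and> degree (W b) \<le> n) \<and>
      q (\<lambda>b. poly (W b) \<alpha>) = 0 \<and> (\<exists>b\<in>B. poly (W b) \<alpha> \<noteq> 0))"
  have "\<not> bad n W" for n W
  proof (induction n arbitrary: W rule: less_induct)
    case (less n)
    show ?case
    proof
      assume bad: "bad n W"
      then have W: "\<And>b. b \<in> B \<Longrightarrow> W b \<in> polys_over E" "\<And>b. b \<in> B \<Longrightarrow> degree (W b) \<le> n"
        and qW: "q (\<lambda>b. poly (W b) \<alpha>) = 0" and nzW: "\<exists>b\<in>B. poly (W b) \<alpha> \<noteq> 0"
        by (auto simp: bad_def)
      have "n < degree m"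
      proof (rule ccontr)
        assume n: "\<not> n < degree m"
        have "\<forall>b\<in>B. \<exists>r. r \<in> polys_over E \<and> poly r \<alpha> = poly (W b) \<alpha> \<and> degree r \<le> degree m - 1"
        proof
          fix b assume b: "b \<in> B"
          obtain a r where "a \<in> polys_over E" "r \<in> polys_over E" "W b = m * a + r" "r = 0 \<or> degree r < degree m"
            using polys_over_division[OF E m0 W(1)[OF b]] by blast
          then show "\<exists>r. r \<in> polys_over E \<and> poly r \<alpha> = poly (W b) \<alpha> \<and> degree r \<le> degree m - 1"
            using minimal_polyD(3)[OF m(1)] minimal_poly_degree_pos[OF m(1)] by (intro exI[of _ r]) auto
        qed
        then obtain R where R: "\<And>b. b \<in> B \<Longrightarrow> R b \<in> polys_over E \<and> poly (R b) \<alpha> = poly (W b) \<alpha> \<and> degree (R b) \<le> degree m - 1"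
          by metis
        then have "bad (degree m - 1) R"
          using qW nzW by (auto simp: bad_def q_def)
        moreover have "degree m - 1 < n" using n minimal_poly_degree_pos[OF m(1)] by linarith
        ultimately show False using less.IH[of "degree m - 1" R] by simp
      qed
      define x where "x = (\<lambda>b. coeff (W b) n)"
      have "\<exists>b\<in>B. x b \<noteq> 0"
      proof (rule ccontr)
        assume *: "\<not> (\<exists>b\<in>B. x b \<noteq> 0)"
        have "degree (W b) \<le> n - 1" if "b \<in> B" for b
          using W(2)[OF that] * that unfolding x_def
          by (cases "degree (W b) = n") (auto simp: le_degree)
        then have "bad (n - 1) W" using bad by (auto simp: bad_def)
        moreover have "0 < n"
          using nzW W(2) * unfolding x_def by (force intro!: Nat.gr0I elim!: degree_eq_zeroE)
        ultimately show False using less.IH[of "n - 1" W] by simp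
      qed
      then have qx: "q x \<noteq> 0" using anis[of x] W(1) unfolding q_def x_def by (auto intro: polys_over_coeff)
      define P where "P = (\<Sum>b\<in>B. \<Sum>b'\<in>B. smult (d b b') (W b * W b'))"
      have P: "P \<in> polys_over E" unfolding P_def using E d W
        by (auto intro!: polys_over_sum polys_over_smult polys_over_mult)
      have poly_P: "poly P y = q (\<lambda>b. poly (W b) y)" for y
        by (simp add: P_def q_def poly_sum mult_ac)
      have "degree P \<le> 2 * n" unfolding P_def
        by (intro degree_sum_le B order.trans[OF degree_smult_le] order.trans[OF degree_mult_le])
           (use W(2) in \<open>force simp: mult_2 intro: add_mono\<close>)
      have "coeff P (2 * n) = q x"
      proof -
        have "coeff (W b * W b') (2 * n) = x b * x b'" if "b \<in> B" "b' \<in> B" for b b'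
          using coeff_mult_degree_sum[of "W b" "W b'"] that W(2)
          unfolding x_def coeff_mult 
        proof -
          have "(\<Sum>i\<le>2 * n. coeff (W b) i * coeff (W b') (2 * n - i)) = (\<Sum>i\<in>{n}. coeff (W b) i * coeff (W b') (2 * n - i))"
          proof (rule sum.mono_neutral_right)
            show "\<forall>i\<in>{..2 * n} - {n}. coeff (W b) i * coeff (W b') (2 * n - i) = 0"
            proof
              fix i assume i: "i \<in> {..2 * n} - {n}"
              show "coeff (W b) i * coeff (W b') (2 * n - i) = 0"
              proof (cases "i < n")
                case True
                then show ?thesis using W(2)[OF that(2)] by (simp add: coeff_eq_0)
              next
                case False
                then show ?thesis using i W(2)[OF that(1)] by (simp add: coeff_eq_0)
              qed
            qed
          qed auto
          then show "(\<Sum>i\<le>2 * n. coeff (W b) i * coeff (W b') (2 * n - i)) = coeff (W b) n * coeff (W b') n"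
            by simp
        qed
        then show ?thesis by (simp add: P_def q_def coeff_sum mult_ac)
      qed
      then have "coeff P (2 * n) \<noteq> 0" using qx by simp
      then have "2 * n \<le> degree P" and "P \<noteq> 0" by (rule le_degree, metis coeff_0)
      then have deg_P: "degree P = 2 * n" using \<open>degree P \<le> 2 * n\<close> by simp
      have "poly P \<alpha> = 0" using qW by (simp add: poly_P)
      then obtain h where h: "h \<in> polys_over E" "P = m * h" using minimal_poly_dvd[OF m(1) P] by blast
      have deg: "2 * n = degree m + degree h"
        using h \<open>P \<noteq> 0\<close> deg_P by (auto simp: degree_mult_eq)
      then have "odd (degree h)" using m(2) by presburger
      then obtain \<gamma> m' where m': "minimal_poly E \<gamma> m'" "odd (degree m')" "poly h \<gamma> = 0" "degree m' \<le> degree h"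
        using odd_degree_root[OF E h(1)] by blast
      have "degree m' < degree m" using m'(4) deg \<open>n < degree m\<close> by linarith
      moreover have "(\<Sum>b\<in>B. \<Sum>b'\<in>B. poly (W b) \<gamma> * poly (W b') \<gamma> * d b b') = 0"
        using poly_P[of \<gamma>] m'(3) h(2) by (simp add: q_def)
      ultimately have "\<forall>b\<in>B. poly (W b) \<gamma> = 0"
        by (intro springer_IH[of m' \<gamma> W] m' W(1))
      then have "\<forall>b\<in>B. \<exists>a\<in>polys_over E. W b = m' * a" using minimal_poly_dvd[OF m'(1)] W(1) by blast
      then obtain V where V: "\<And>b. b \<in> B \<Longrightarrow> V b \<in> polys_over E" "\<And>b. b \<in> B \<Longrightarrow> W b = m' * V b"
        by metis
      have m'_\<alpha>: "poly m' \<alpha> \<noteq> 0" using nzW V by auto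
      have "q (\<lambda>b. poly (W b) \<alpha>) = q (\<lambda>b. poly m' \<alpha> * poly (V b) \<alpha>)"
        unfolding q_def using V by (intro sum.cong) auto
      then have "q (\<lambda>b. poly (V b) \<alpha>) = 0" using qW m'_\<alpha> by (simp add: q_scale)
      moreover have "degree (V b) \<le> n - degree m'" if "b \<in> B" for b
        using V(2)[OF that] W(2)[OF that] minimal_polyD(2)[OF m'(1)] by (cases "V b = 0") (auto simp: degree_mult_eq)
      ultimately have "bad (n - degree m') V" using V nzW by (auto simp: bad_def)
      moreover have "n - degree m' < n"
        using minimal_poly_degree_pos[OF m'(1)] minimal_poly_degree_pos[OF m(1)] deg by linarith
      ultimately show False using less.IH[of "n - degree m'" V] by simp
    qed
  qed
  moreover have "degree (W b) \<le> Max ((\<lambda>b. degree (W b)) ` B)" if "b \<in> B" for b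
    using B that by auto
  then have "bad (Max ((\<lambda>b. degree (W b)) ` B)) W" if "b \<in> B" "poly (W b) \<alpha> \<noteq> 0" for b
    using less.prems(3,4) that by (auto simp: bad_def q_def)
  ultimately show ?case by blast
qed

section \<open>The descent over the function field of the conic\<close>

text \<open>
  The set \<open>K\<close> is a field with involution \<open>cj\<close>, and \<open>G\<close> is the graph of \<open>v \<mapsto> vj\<close>, seen in a vector space
  over a larger field in which \<open>t\<close> lives. The axioms on \<open>G\<close> and \<open>c\<close> express that \<open>vj\<close> depends
  semilinearly on \<open>v\<close>, that \<open>vj\<^sup>2 = b v\<close>, and that \<open>c(vj, wj)\<close> is determined by \<open>c(v, w)\<close>;
  \<open>anisotropic\<close> is the anisotropy of the generalized quadratic form.
\<close>

locale conic_descent = vector_space sc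
  for sc :: "'o::field \<Rightarrow> 'x::ab_group_add \<Rightarrow> 'x" +
  fixes K :: "'o set" and cj :: "'o \<Rightarrow> 'o" and b \<delta> t :: 'o
    and G :: "('x \<times> 'x) set" and c :: "'x \<Rightarrow> 'x \<Rightarrow> 'o"
  assumes K_one: "1 \<in> K" and K_diff: "\<kappa> \<in> K \<Longrightarrow> \<mu> \<in> K \<Longrightarrow> \<kappa> - \<mu> \<in> K"
    and K_mult: "\<kappa> \<in> K \<Longrightarrow> \<mu> \<in> K \<Longrightarrow> \<kappa> * \<mu> \<in> K" and K_inverse: "\<kappa> \<in> K \<Longrightarrow> inverse \<kappa> \<in> K"
    and cj_K: "\<kappa> \<in> K \<Longrightarrow> cj \<kappa> \<in> K"
    and cj_diff: "\<kappa> \<in> K \<Longrightarrow> \<mu> \<in> K \<Longrightarrow> cj (\<kappa> - \<mu>) = cj \<kappa> - cj \<mu>"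
    and cj_mult: "\<kappa> \<in> K \<Longrightarrow> \<mu> \<in> K \<Longrightarrow> cj (\<kappa> * \<mu>) = cj \<kappa> * cj \<mu>"
    and cj_one: "cj 1 = 1"
    and cj_cj: "\<kappa> \<in> K \<Longrightarrow> cj (cj \<kappa>) = \<kappa>"
    and b_K: "b \<in> K" and b_nz: "b \<noteq> 0" and cj_b: "cj b = b"
    and \<delta>_K: "\<delta> \<in> K" and \<delta>_nz: "\<delta> \<noteq> 0" and cj_\<delta>: "cj \<delta> = - \<delta>"
    and t_transcendental:
      "(\<And>i. coeff p i \<in> K) \<Longrightarrow> poly p t = 0 \<Longrightarrow> p = 0"
    and G_zero: "(0, 0) \<in> G"
    and G_add: "(x, y) \<in> G \<Longrightarrow> (x', y') \<in> G \<Longrightarrow> (x + x', y + y') \<in> G"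
    and G_scale: "(x, y) \<in> G \<Longrightarrow> \<kappa> \<in> K \<Longrightarrow> (sc \<kappa> x, sc (cj \<kappa>) y) \<in> G"
    and G_swap: "(x, y) \<in> G \<Longrightarrow> (y, sc b x) \<in> G"
    and c_add_left: "c (x + x') y = c x y + c x' y"
    and c_add_right: "c x (y + y') = c x y + c x y'"
    and c_scale_left: "c (sc f x) y = f * c x y"
    and c_scale_right: "c x (sc f y) = f * c x y"
    and c_K: "(x, y) \<in> G \<Longrightarrow> (x', y') \<in> G \<Longrightarrow> c x x' \<in> K"
    and c_conj: "(x, y) \<in> G \<Longrightarrow> (x', y') \<in> G \<Longrightarrow> c y y' = - b * cj (c x x')"
    and anisotropic: "(x, y) \<in> G \<Longrightarrow> c x x = 0 \<Longrightarrow> c x y + c y x = 0 \<Longrightarrow> x = 0 \<and> y = 0"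
begin

text \<open>
  The automorphism of the function field exchanges \<open>t\<close> and \<open>\<tau>\<close> and extends \<open>cj\<close>, so \<open>al\<close> is a trace
  to its fixed field and \<open>A\<close> is a ring of invariants. The vectors \<open>g i x y\<close> are the traces of \<open>t\<^sup>i x\<close> under
  the matching semilinear automorphism, which maps \<open>x\<close> to \<open>t y\<close>.
\<close>

definition \<tau> :: 'o where "\<tau> = 1 / (b * t)"

definition al :: "'o \<Rightarrow> nat \<Rightarrow> 'o" where "al \<kappa> i = \<kappa> * t ^ i + cj \<kappa> * \<tau> ^ i"

definition g :: "nat \<Rightarrow> 'x \<Rightarrow> 'x \<Rightarrow> 'x" where "g i x y = sc (t ^ i) x + sc (t * \<tau> ^ i) y"

inductive_set A :: "'o set" where
  A_zero: "0 \<in> A"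
| A_const: "\<kappa> \<in> K \<Longrightarrow> cj \<kappa> = \<kappa> \<Longrightarrow> f \<in> A \<Longrightarrow> \<kappa> + f \<in> A"
| A_al: "\<kappa> \<in> K \<Longrightarrow> f \<in> A \<Longrightarrow> al \<kappa> i + f \<in> A"

inductive_set M :: "nat \<Rightarrow> 'x set" for n where
  M_zero: "0 \<in> M n"
| M_g: "(x, y) \<in> G \<Longrightarrow> 1 \<le> i \<Longrightarrow> i \<le> n \<Longrightarrow> w \<in> M n \<Longrightarrow> g i x y + w \<in> M n"

text \<open>
  Laurent polynomials in \<open>t\<close> with coefficients in \<open>K\<close> and degree at most \<open>d\<close>. They serve to read off leading
  coefficients.
\<close>

definition D :: "nat \<Rightarrow> 'o set" where
  "D d = {f. \<exists>N p. (\<forall>i. coeff p i \<in> K) \<and> degree p \<le> N + d \<and> t ^ N * f = poly p t}"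

lemma K_zero: "0 \<in> K"
  using K_diff[OF K_one K_one] by simp
lemma K_minus: "x \<in> K \<Longrightarrow> - x \<in> K"
  using K_diff[OF K_zero] by simp
lemma K_add: "x \<in> K \<Longrightarrow> y \<in> K \<Longrightarrow> x + y \<in> K"
  using K_diff[of x "- y"] K_minus by simp
lemma K_divide: "x \<in> K \<Longrightarrow> y \<in> K \<Longrightarrow> x / y \<in> K"
  by (simp add: divide_inverse K_mult K_inverse)
lemma K_power: "x \<in> K \<Longrightarrow> x ^ n \<in> K"
  by (induction n) (auto simp: K_one K_mult)

lemma cj_zero: "cj 0 = 0"
  using cj_diff[OF K_one K_one] by simp
lemma cj_minus: "x \<in> K \<Longrightarrow> cj (- x) = - cj x"
  using cj_diff[OF K_zero] by (simp add: cj_zero)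
lemma cj_add: "x \<in> K \<Longrightarrow> y \<in> K \<Longrightarrow> cj (x + y) = cj x + cj y"
  using cj_diff[of x "- y"] K_minus by (simp add: cj_minus)
lemma cj_power: "x \<in> K \<Longrightarrow> cj (x ^ n) = cj x ^ n"
  by (induction n) (auto simp: cj_one K_power cj_mult)
lemma cj_inverse: "x \<in> K \<Longrightarrow> cj (inverse x) = inverse (cj x)"
proof (cases "x = 0")
  case False
  assume x: "x \<in> K"
  have "cj x * cj (inverse x) = 1"
    using cj_mult[OF x K_inverse[OF x]] False by (simp add: cj_one)
  then show ?thesis by (metis inverse_unique)
qed (simp add: cj_zero)
lemma cj_divide: "x \<in> K \<Longrightarrow> y \<in> K \<Longrightarrow> cj (x / y) = cj x / cj y"
  by (simp add: divide_inverse cj_mult cj_inverse K_inverse)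

lemmas K_intros = K_one K_zero K_minus K_add K_diff K_divide K_mult K_power K_inverse cj_K b_K \<delta>_K
lemmas cj_simps = cj_one cj_zero cj_minus cj_add cj_diff cj_divide cj_mult cj_power cj_inverse
  cj_b cj_\<delta> cj_cj

lemma t_nz: "t \<noteq> 0"
proof
  assume "t = 0"
  then have "poly (monom 1 1) t = 0" by (simp add: poly_monom)
  moreover have "coeff (monom 1 1) i \<in> K" for i using K_one K_zero by auto
  ultimately show False using t_transcendental[of "monom 1 1"] by auto
qed

lemma \<tau>_t: "t * \<tau> = 1 / b" "\<tau> * t = 1 / b" and \<tau>_nz: "\<tau> \<noteq> 0"
  using t_nz b_nz by (auto simp: \<tau>_def)

lemma t_\<tau>_pow: "t ^ (j + i) * \<tau> ^ j = t ^ i / b ^ j" "\<tau> ^ (j + i) * t ^ j = \<tau> ^ i / b ^ j"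
  using t_nz b_nz by (simp_all add: \<tau>_def power_add power_mult_distrib field_simps)

subsection \<open>The ring of invariants\<close>

lemma A_add: "f \<in> A \<Longrightarrow> f' \<in> A \<Longrightarrow> f + f' \<in> A"
  by (induction rule: A.induct) (auto simp: add.assoc intro: A.intros)

lemma A_const': "\<kappa> \<in> K \<Longrightarrow> cj \<kappa> = \<kappa> \<Longrightarrow> \<kappa> \<in> A"
  using A_const[OF _ _ A_zero] by simp
lemma A_al': "\<kappa> \<in> K \<Longrightarrow> al \<kappa> i \<in> A"
  using A_al[OF _ A_zero] by simp

lemma al_mult_ge:
  assumes "\<kappa> \<in> K" "\<mu> \<in> K"
  shows "al \<kappa> (j + i) * al \<mu> j = al (\<kappa> * \<mu>) (j + i + j) + al (\<kappa> * cj \<mu> / b ^ j) i"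
proof -
  have "al \<kappa> (j + i) * al \<mu> j = \<kappa> * \<mu> * t ^ (j + i + j) + cj \<kappa> * cj \<mu> * \<tau> ^ (j + i + j)
     + \<kappa> * cj \<mu> * (t ^ (j + i) * \<tau> ^ j) + cj \<kappa> * \<mu> * (\<tau> ^ (j + i) * t ^ j)"
    by (simp add: al_def power_add algebra_simps)
  also have "\<dots> = al (\<kappa> * \<mu>) (j + i + j) + al (\<kappa> * cj \<mu> / b ^ j) i"
    unfolding t_\<tau>_pow using assms by (simp add: al_def cj_simps K_intros)
  finally show ?thesis .
qed

lemma A_al_mult:
  assumes "\<kappa> \<in> K" "\<mu> \<in> K" shows "al \<kappa> i * al \<mu> j \<in> A"
proof (cases "j \<le> i")
  case True
  then obtain k where "i = j + k" using le_Suc_ex by blast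
  then show ?thesis using assms by (auto simp: al_mult_ge intro!: A_add A_al' K_intros)
next
  case False
  then obtain k where j: "j = i + k" using le_Suc_ex nat_le_linear by blast
  have "al \<mu> j * al \<kappa> i \<in> A" unfolding j using assms
    by (auto simp: al_mult_ge intro!: A_add A_al' K_intros)
  then show ?thesis by (simp add: mult.commute)
qed

lemma A_const_mult:
  assumes "\<kappa> \<in> K" "cj \<kappa> = \<kappa>" shows "f \<in> A \<Longrightarrow> \<kappa> * f \<in> A"
proof (induction rule: A.induct)
  case (A_const \<mu> f)
  then show ?case using assms by (auto simp: distrib_left cj_simps intro!: A.A_const K_intros)
next
  case (A_al \<mu> f i)
  have "\<kappa> * al \<mu> i = al (\<kappa> * \<mu>) i" using assms A_al by (simp add: al_def cj_simps algebra_simps)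
  then show ?case using assms A_al by (auto simp: distrib_left intro!: A.A_al K_intros)
qed (auto intro: A.intros)

lemma A_al_mult':
  assumes "\<kappa> \<in> K" shows "f \<in> A \<Longrightarrow> al \<kappa> i * f \<in> A"
proof (induction rule: A.induct)
  case (A_const \<mu> f)
  then show ?case using assms by (auto simp: distrib_left mult.commute[of _ \<mu>] intro!: A_add A_const_mult A_al')
qed (use assms in \<open>auto simp: distrib_left intro!: A_add A_al_mult A_zero\<close>)

lemma A_mult: "f \<in> A \<Longrightarrow> f' \<in> A \<Longrightarrow> f * f' \<in> A"
  by (induction rule: A.induct) (auto simp: distrib_right intro: A_add A_const_mult A_al_mult' A_zero)

lemma A_one: "1 \<in> A" using A_const'[OF K_one cj_one] .
lemma A_minus: "f \<in> A \<Longrightarrow> - f \<in> A"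
  using A_const_mult[of "-1" f] by (simp add: cj_simps K_intros)
lemma A_sum: "(\<And>x. x \<in> S \<Longrightarrow> f x \<in> A) \<Longrightarrow> sum f S \<in> A"
  by (induction S rule: infinite_finite_induct) (auto intro: A_zero A_add)
lemma A_prod: "(\<And>x. x \<in> S \<Longrightarrow> f x \<in> A) \<Longrightarrow> prod f S \<in> A"
  by (induction S rule: infinite_finite_induct) (auto intro: A_one A_mult)
lemma A_power: "f \<in> A \<Longrightarrow> f ^ n \<in> A"
  by (induction n) (auto intro: A_one A_mult)

subsection \<open>The filtered module of vectors\<close>

lemma M_add: "w \<in> M n \<Longrightarrow> w' \<in> M n \<Longrightarrow> w + w' \<in> M n"
  by (induction rule: M.induct) (auto simp: add.assoc intro: M.intros)
lemma M_g': "(x, y) \<in> G \<Longrightarrow> 1 \<le> i \<Longrightarrow> i \<le> n \<Longrightarrow> g i x y \<in> M n"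
  using M_g[OF _ _ _ M_zero] by simp
lemma M_mono: "n \<le> m \<Longrightarrow> w \<in> M n \<Longrightarrow> w \<in> M m"
  by (rotate_tac, induction rule: M.induct) (auto intro!: M.intros)

lemma g_add: "g i (x + x') (y + y') = g i x y + g i x' y'"
  by (simp add: g_def scale_right_distrib algebra_simps)

lemma g_zero: "g 0 x y = g 1 y (sc b x)"
  using b_nz by (simp add: g_def \<tau>_t)

lemma M_g0: "(x, y) \<in> G \<Longrightarrow> 1 \<le> n \<Longrightarrow> i \<le> n \<Longrightarrow> g i x y \<in> M n"
  by (cases i) (auto simp: g_zero intro!: M_g' G_swap)

text \<open>
  The next two rules, one for each order of the two indices, make the span of the \<open>g i x y\<close> a module
  over \<open>A\<close> in which indices add up.
\<close>

lemma al_g_ge: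
  "sc (al \<kappa> j) (g (j + i) x y) =
     g (j + (j + i)) (sc \<kappa> x) (sc (cj \<kappa>) y) + g i (sc (cj \<kappa> / b ^ j) x) (sc (\<kappa> / b ^ j) y)"
proof -
  have "sc (al \<kappa> j) (g (j + i) x y) =
     sc (\<kappa> * t ^ (j + (j + i))) x + sc (t * cj \<kappa> * \<tau> ^ (j + (j + i))) y
   + sc (cj \<kappa> * (t ^ (j + i) * \<tau> ^ j)) x + sc (t * \<kappa> * (\<tau> ^ (j + i) * t ^ j)) y"
    unfolding g_def al_def scale_right_distrib scale_left_distrib
    by (simp add: power_add algebra_simps)
  also have "\<dots> = g (j + (j + i)) (sc \<kappa> x) (sc (cj \<kappa>) y)
     + g i (sc (cj \<kappa> / b ^ j) x) (sc (\<kappa> / b ^ j) y)"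
    unfolding t_\<tau>_pow by (simp add: g_def algebra_simps)
  finally show ?thesis .
qed

lemma al_g_less:
  "sc (al \<kappa> (i + k)) (g i x y) =
     g (i + k + i) (sc \<kappa> x) (sc (cj \<kappa>) y)
   + g (k + 1) (sc (\<kappa> / b ^ i) y) (sc (cj \<kappa> / b ^ i) (sc b x))"
proof -
  have "sc (al \<kappa> (i + k)) (g i x y) =
     sc (\<kappa> * t ^ (i + k + i)) x + sc (t * cj \<kappa> * \<tau> ^ (i + k + i)) y
   + sc (cj \<kappa> * (\<tau> ^ (i + k) * t ^ i)) x + sc (t * \<kappa> * (t ^ (i + k) * \<tau> ^ i)) y"
    unfolding g_def al_def scale_right_distrib scale_left_distrib
    by (simp add: power_add algebra_simps)
  also have "\<dots> = g (i + k + i) (sc \<kappa> x) (sc (cj \<kappa>) y)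
   + g (k + 1) (sc (\<kappa> / b ^ i) y) (sc (cj \<kappa> / b ^ i) (sc b x))"
    unfolding t_\<tau>_pow using b_nz t_nz
    by (simp add: g_def algebra_simps) (simp add: \<tau>_def)
  finally show ?thesis .
qed

lemma G_scale': "(x, y) \<in> G \<Longrightarrow> \<kappa> \<in> K \<Longrightarrow> (sc (cj \<kappa>) x, sc \<kappa> y) \<in> G"
  using G_scale[of x y "cj \<kappa>"] by (simp add: K_intros cj_simps)

lemma al_g_M:
  assumes "(x, y) \<in> G" "\<kappa> \<in> K" "1 \<le> i"
  shows "sc (al \<kappa> j) (g i x y) \<in> M (i + j)"
proof (cases "j \<le> i")
  case True
  then obtain k where i: "i = j + k" using le_Suc_ex by blast
  have "(sc (cj \<kappa> / b ^ j) x, sc (\<kappa> / b ^ j) y) \<in> G"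
    using G_scale'[OF assms(1), of "\<kappa> / b ^ j"] assms(2) by (simp add: cj_simps K_intros)
  then show ?thesis unfolding i al_g_ge using assms i
    by (intro M_add M_g0) (auto intro!: G_scale)
next
  case False
  then obtain k where j: "j = i + k" using le_Suc_ex nat_le_linear by blast
  have "(sc (\<kappa> / b ^ i) y, sc (cj \<kappa> / b ^ i) (sc b x)) \<in> G"
    using G_scale[OF G_swap[OF assms(1)], of "\<kappa> / b ^ i"] assms(2) by (simp add: cj_simps K_intros)
  then show ?thesis unfolding j al_g_less using assms j
    by (intro M_add M_g0) (auto intro!: G_scale)
qed

lemma M_const:
  assumes "\<kappa> \<in> K" "cj \<kappa> = \<kappa>" shows "w \<in> M n \<Longrightarrow> sc \<kappa> w \<in> M n"
proof (induction rule: M.induct)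
  case (M_g x y i w)
  have "sc \<kappa> (g i x y) = g i (sc \<kappa> x) (sc \<kappa> y)" by (simp add: g_def scale_right_distrib algebra_simps)
  then show ?case using M_g assms G_scale[of x y \<kappa>]
    by (auto simp: scale_right_distrib intro!: M.intros)
qed (simp add: M_zero)

lemma M_al:
  assumes "\<kappa> \<in> K" shows "w \<in> M n \<Longrightarrow> sc (al \<kappa> j) w \<in> M (n + j)"
proof (induction rule: M.induct)
  case (M_g x y i w)
  have "sc (al \<kappa> j) (g i x y) \<in> M (n + j)"
    by (rule M_mono[OF _ al_g_M]) (use M_g assms in auto)
  then show ?case using M_g by (auto simp: scale_right_distrib intro!: M_add)
qed (simp add: M_zero)

lemma A_M: "f \<in> A \<Longrightarrow> w \<in> M n \<Longrightarrow> \<exists>m. sc f w \<in> M m"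
proof (induction rule: A.induct)
  case (A_const \<kappa> f)
  then obtain m where "sc f w \<in> M m" by auto
  moreover have "sc \<kappa> w \<in> M n" using A_const M_const by auto
  ultimately have "sc \<kappa> w + sc f w \<in> M (max m n)" by (intro M_add) (auto intro: M_mono[rotated])
  then show ?case by (auto simp: scale_left_distrib)
next
  case (A_al \<kappa> f i)
  then obtain m where "sc f w \<in> M m" by auto
  moreover have "sc (al \<kappa> i) w \<in> M (n + i)" using A_al M_al by auto
  ultimately have "sc (al \<kappa> i) w + sc f w \<in> M (max m (n + i))"
    by (intro M_add) (auto intro: M_mono[rotated])
  then show ?case by (auto simp: scale_left_distrib)
qed (auto intro: M_zero)

lemma M_sum: "(\<And>x. x \<in> S \<Longrightarrow> \<exists>n. w x \<in> M n) \<Longrightarrow> \<exists>n. sum w S \<in> M n"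
proof (induction S rule: infinite_finite_induct)
  case (insert x S)
  then obtain n m where "w x \<in> M n" "sum w S \<in> M m" by auto blast
  then have "w x + sum w S \<in> M (max n m)" by (intro M_add) (auto intro: M_mono[rotated])
  then show ?case using insert by auto
qed (auto intro: M_zero)

text \<open>
  The pairs with the top index can be collected into one, since \<open>G\<close> is closed under addition.
\<close>

lemma M_split:
  "w \<in> M (Suc n) \<Longrightarrow> \<exists>x y w'. (x, y) \<in> G \<and> w' \<in> M n \<and> w = g (Suc n) x y + w'"
proof (induction rule: M.induct)
  case M_zero
  show ?case using G_zero M.M_zero by (intro exI[of _ 0]) (auto simp: g_def)
next
  case (M_g x y i w)
  then obtain x' y' w' where *: "(x', y') \<in> G" "w' \<in> M n" "w = g (Suc n) x' y' + w'" by blast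
  show ?case
  proof (cases "i = Suc n")
    case True
    show ?thesis using * M_g True G_add[of x y x' y']
      by (intro exI[of _ "x + x'"] exI[of _ "y + y'"] exI[of _ w']) (auto simp: g_add)
  next
    case False
    then have "g i x y + w' \<in> M n" using * M_g by (auto intro!: M.intros)
    moreover have "g i x y + w = g (Suc n) x' y' + (g i x y + w')" using * by (simp add: algebra_simps)
    ultimately show ?thesis using *(1) by blast
  qed
qed


subsection \<open>Values of the form\<close>

lemma c_swap:
  assumes "(x, y) \<in> G" "(x', y') \<in> G" shows "c y x' = - cj (c x y')"
proof -
  have "b * c y x' = b * (- cj (c x y'))"
    using c_conj[OF assms(1) G_swap[OF assms(2)]] by (simp add: c_scale_right)
  then show ?thesis using b_nz mult_left_cancel by blast
qed

lemma G_K: 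
  assumes "(x, y) \<in> G" "(x', y') \<in> G" 
  shows "c x x' \<in> K" "c x y' \<in> K" "c y x' \<in> K" "c y y' \<in> K"
  using assms G_swap[OF assms(1)] G_swap[OF assms(2)] by (blast intro: c_K)+

lemma c_g:
  "c (g i x y) (g j x' y') = t ^ (i + j) * c x x' + t ^ (i + 1) * \<tau> ^ j * c x y'
     + t ^ (j + 1) * \<tau> ^ i * c y x' + t\<^sup>2 * \<tau> ^ (i + j) * c y y'"
  by (simp add: g_def c_add_left c_add_right c_scale_left c_scale_right power_add power2_eq_square
      algebra_simps)

lemma c_g_al:
  assumes G: "(x, y) \<in> G" "(x', y') \<in> G" and j: "1 \<le> j"
  shows "c (g (j + k) x y) (g j x' y')
       = t * \<delta> * (al (c x x' / \<delta>) (j + k + j - 1) + al (c x y' / (b ^ j * \<delta>)) k)"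
    and "c (g j x y) (g (j + k) x' y')
       = t * \<delta> * (al (c x x' / \<delta>) (j + k + j - 1) + al (c y x' / (b ^ j * \<delta>)) k)"
proof -
  obtain l where j: "j = Suc l" using j by (cases j) auto
  have yy: "c y y' = - b * cj (c x x')" and yx: "c y x' = - cj (c x y')"
    using c_conj c_swap G by auto
  have xy: "c x y' = - cj (c y x')" using cj_minus[OF cj_K] cj_cj G_K[OF G] by (simp add: yx)
  have bt: "t * b * \<tau> = 1" using t_nz b_nz by (simp add: \<tau>_def)
  have P: "t * \<delta> * al (c x x' / \<delta>) n = t ^ Suc n * c x x' + t * (t * b * \<tau>) * \<tau> ^ n * c y y' / b" for n
    unfolding bt using b_nz \<delta>_nz G_K[OF G]
    by (simp add: al_def cj_simps K_intros yy field_simps)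
  have P': "t * \<delta> * al (c x x' / \<delta>) n = t ^ Suc n * c x x' + t\<^sup>2 * \<tau> ^ Suc n * c y y'" for n
    unfolding P using b_nz by (simp add: field_simps power2_eq_square)
  have R: "t * \<delta> * al (c x y' / (b ^ j * \<delta>)) k
      = t * (t ^ k / b ^ j) * c x y' + t * (\<tau> ^ k / b ^ j) * c y x'"
    using b_nz \<delta>_nz G_K[OF G] by (simp add: al_def cj_simps K_intros yx field_simps)
  have R': "t * \<delta> * al (c y x' / (b ^ j * \<delta>)) k
      = t * (t ^ k / b ^ j) * c y x' + t * (\<tau> ^ k / b ^ j) * c x y'"
    using b_nz \<delta>_nz G_K[OF G] unfolding xy by (simp add: al_def cj_simps K_intros field_simps)
  show "c (g (j + k) x y) (g j x' y')
       = t * \<delta> * (al (c x x' / \<delta>) (j + k + j - 1) + al (c x y' / (b ^ j * \<delta>)) k)"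
    unfolding distrib_left P' R c_g t_\<tau>_pow[symmetric] using j by (simp add: algebra_simps)
  show "c (g j x y) (g (j + k) x' y')
       = t * \<delta> * (al (c x x' / \<delta>) (j + k + j - 1) + al (c y x' / (b ^ j * \<delta>)) k)"
    unfolding distrib_left P' R' c_g t_\<tau>_pow[symmetric] using j by (simp add: algebra_simps)
qed

lemma al_0: "al 0 i = 0" by (simp add: al_def cj_zero)
lemma al_add: "\<kappa> \<in> K \<Longrightarrow> \<mu> \<in> K \<Longrightarrow> al (\<kappa> + \<mu>) i = al \<kappa> i + al \<mu> i"
  by (simp add: al_def cj_simps algebra_simps)

text \<open>
  Invariance forces the values of \<open>c\<close> into one line: dividing by \<open>t \<delta>\<close> makes them invariant because
  \<open>cj \<delta> = - \<delta>\<close> compensates the sign in \<open>c_conj\<close>.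
\<close>

lemma c_g_A:
  assumes "(x, y) \<in> G" "(x', y') \<in> G" "1 \<le> i" "1 \<le> j"
  shows "c (g i x y) (g j x' y') / (t * \<delta>) \<in> A"
proof (cases "j \<le> i")
  case True
  then obtain k where "i = j + k" using le_Suc_ex by blast
  then show ?thesis using assms t_nz \<delta>_nz G_K[OF assms(1,2)]
    by (auto simp: c_g_al intro!: A_add A_al' K_intros)
next
  case False
  then obtain k where "j = i + k" using le_Suc_ex nat_le_linear by blast
  then show ?thesis using assms t_nz \<delta>_nz G_K[OF assms(1,2)]
    by (auto simp: c_g_al intro!: A_add A_al' K_intros)
qed

lemma polar_g_g1:
  assumes G: "(x, y) \<in> G" "(x', y') \<in> G"
  shows "c (g (Suc i) x' y') (g 1 x y) + c (g 1 x y) (g (Suc i) x' y')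
    = t * \<delta> * (al ((c x x' + c x' x) / \<delta>) (Suc i) + al ((c x' y + c y x') / (b * \<delta>)) i)"
  using c_g_al(1)[OF G(2,1), of 1 i] c_g_al(2)[OF G, of 1 i] G_K[OF G] G_K[OF G(2,1)]
  by (simp add: add_divide_distrib al_add K_intros algebra_simps)

lemma D_add:
  assumes "f \<in> D d" "f' \<in> D d" shows "f + f' \<in> D d"
proof -
  from assms obtain N p N' p' where
    *: "\<And>i. coeff p i \<in> K" "degree p \<le> N + d" "t ^ N * f = poly p t"
       "\<And>i. coeff p' i \<in> K" "degree p' \<le> N' + d" "t ^ N' * f' = poly p' t"
    by (auto simp: D_def)
  let ?p = "monom 1 N' * p + monom 1 N * p'"
  have "coeff ?p i \<in> K" for i using * by (auto simp: coeff_monom_mult intro!: K_intros)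
  moreover have "degree ?p \<le> N + N' + d"
    using *(2,5) degree_mult_le[of "monom 1 N'" p] degree_mult_le[of "monom 1 N" p']
      degree_monom_le[of "1::'o" N] degree_monom_le[of "1::'o" N']
    by (intro degree_add_le) linarith+
  moreover have "t ^ (N + N') * (f + f') = poly ?p t"
    by (simp add: *(3,6)[symmetric] poly_monom power_add algebra_simps)
  ultimately show ?thesis unfolding D_def by blast
qed

lemma D_term: "\<kappa> \<in> K \<Longrightarrow> i \<le> j + d \<Longrightarrow> t ^ i * \<tau> ^ j * \<kappa> \<in> D d"
  unfolding D_def mem_Collect_eq
  by (intro exI[of _ j] exI[of _ "monom (\<kappa> / b ^ j) i"])
     (use t_nz b_nz in \<open>auto simp: poly_monom \<tau>_def power_mult_distrib field_simps
        intro!: K_intros order.trans[OF degree_monom_le]\<close>)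

lemma D_term': "\<kappa> \<in> K \<Longrightarrow> i \<le> d \<Longrightarrow> t ^ i * \<kappa> \<in> D d"
  using D_term[of \<kappa> i 0 d] by simp

lemma D_top:
  assumes f: "f \<in> D d" and \<kappa>: "\<kappa> \<in> K" and eq: "t ^ Suc d * \<kappa> + f = 0" shows "\<kappa> = 0"
proof -
  obtain N p where *: "\<And>i. coeff p i \<in> K" "degree p \<le> N + d" "t ^ N * f = poly p t"
    using f by (auto simp: D_def)
  let ?p = "monom \<kappa> (N + Suc d) + p"
  have "poly ?p t = t ^ N * (t ^ Suc d * \<kappa> + f)"
    by (simp add: poly_monom *(3)[symmetric] power_add algebra_simps)
  then have "?p = 0" using * \<kappa> eq by (intro t_transcendental) (auto intro!: K_intros)
  then have "coeff ?p (N + Suc d) = 0" by simp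
  moreover have "coeff p (N + Suc d) = 0" using *(2) by (intro coeff_eq_0) auto
  ultimately show ?thesis by simp
qed

lemma D_Suc: "f \<in> D d \<Longrightarrow> f \<in> D (Suc d)"
  unfolding D_def by (auto intro: le_SucI)

lemma c_g_D:
  assumes G: "(x, y) \<in> G" "(x', y') \<in> G" and "i \<le> j + d" "j \<le> i + d" "2 \<le> i + j + Suc d"
  shows "c (g i x y) (g j x' y') - t ^ (i + j) * c x x' \<in> D (Suc d)"
proof -
  have "t ^ (i + 1) * \<tau> ^ j * c x y' + (t ^ (j + 1) * \<tau> ^ i * c y x' + t\<^sup>2 * \<tau> ^ (i + j) * c y y') \<in> D (Suc d)"
    using assms G_K[OF G] by (intro D_add D_term) auto
  then show ?thesis by (simp add: c_g algebra_simps)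
qed


lemma c_zero_left: "c 0 y = 0" and c_zero_right: "c x 0 = 0"
  using c_scale_left[of 0 0 y] c_scale_right[of x 0 0] by auto

lemma D_0: "0 \<in> D d" using D_term'[of 0 0 d] K_zero by simp

lemma c_g_D':
  assumes "(x, y) \<in> G" "(x', y') \<in> G" "1 \<le> i" "1 \<le> j" "i + j \<le> d"
  shows "c (g i x y) (g j x' y') \<in> D d"
proof -
  from assms obtain e where "d = Suc e" by (cases d) auto
  then have "c (g i x y) (g j x' y') - t ^ (i + j) * c x x' \<in> D d"
    using assms by (auto intro!: c_g_D)
  moreover have "t ^ (i + j) * c x x' \<in> D d" using assms by (intro D_term' c_K) auto
  ultimately show ?thesis using D_add by fastforce
qed

lemma c_M_D: 
  assumes v: "v \<in> M j" "i + j \<le> d" shows "u \<in> M i \<Longrightarrow> c u v \<in> D d"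
proof (induction rule: M.induct)
  case (M_g x y a w)
  have "c (g a x y) v \<in> D d" using v(1)
  proof (induction rule: M.induct)
    case (M_g x' y' b' w')
    then show ?case using v \<open>(x, y) \<in> G\<close> \<open>1 \<le> a\<close> \<open>a \<le> i\<close>
      by (auto simp: c_add_right intro!: D_add c_g_D')
  qed (simp add: c_zero_right D_0)
  then show ?case using M_g by (simp add: c_add_left D_add)
qed (simp add: c_zero_left D_0)

text \<open>
  The two highest powers of \<open>t\<close> in \<open>c w w\<close> have exponents \<open>2 k + 4\<close> and \<open>2 k + 3\<close>, and their coefficients
  come from the two leading pairs alone.
\<close>

lemma isotropic_top:
  assumes G: "(x, y) \<in> G" "(x', y') \<in> G" and w: "w \<in> M k"
    and q: "c (g (k + 2) x y + g (k + 1) x' y' + w) (g (k + 2) x y + g (k + 1) x' y' + w) = 0"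
  shows "c x x = 0" "c x x' + c x' x = 0"
proof -
  let ?u = "g (k + 2) x y" and ?v = "g (k + 1) x' y'" and ?d = "2 * k + 2"
  have u: "?u \<in> M (k + 2)" and v: "?v \<in> M (k + 1)" using G by (auto intro!: M_g')
  have 1: "c ?u ?u - t ^ (k + 2 + (k + 2)) * c x x \<in> D ?d" 
    using c_g_D[OF G(1,1), of "k+2" "k+2" "2*k+1"] by simp
  have 2: "c ?u ?v - t ^ (k + 2 + (k + 1)) * c x x' \<in> D ?d"
    using c_g_D[OF G, of "k+2" "k+1" "2*k+1"] by simp
  have 3: "c ?v ?u - t ^ (k + 1 + (k + 2)) * c x' x \<in> D ?d"
    using c_g_D[OF G(2,1), of "k+1" "k+2" "2*k+1"] by simp
  have "c ?v ?v + (c ?u w + (c w ?u + (c ?v w + (c w ?v + c w w)))) \<in> D ?d"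
    by (intro D_add c_M_D[OF w _ u] c_M_D[OF w _ v] c_M_D[OF w _ w] c_M_D[OF u _ w] c_M_D[OF v _ v]
        c_M_D[OF v _ w]) auto
  from D_add[OF 1 D_add[OF 2 D_add[OF 3 this]]]
  have "c (?u + ?v + w) (?u + ?v + w)
     - (t ^ Suc (Suc ?d) * c x x + t ^ Suc ?d * (c x x' + c x' x)) \<in> D ?d" (is "?f \<in> _")
    by (simp add: mult_2 mult_2_right c_add_left c_add_right algebra_simps)
  then have f: "t ^ Suc (Suc ?d) * (- c x x) + (t ^ Suc ?d * (- (c x x' + c x' x)) + - ?f) = 0"
    and fD: "?f \<in> D ?d"
    using q by (simp_all add: algebra_simps)
  have fD': "- ?f \<in> D ?d"
  proof -
    have "- p \<in> D ?d" if "p \<in> D ?d" for p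
      using that unfolding D_def mem_Collect_eq
      by (metis (no_types, opaque_lifting) K_minus coeff_minus degree_minus minus_mult_right poly_minus)
    then show ?thesis using fD by blast
  qed
  have xx: "- (c x x' + c x' x) \<in> K" "- c x x \<in> K" using G by (auto intro!: K_intros c_K)
  have "- c x x = 0"
    by (rule D_top[OF D_add[OF D_term'[OF xx(1)] D_Suc[OF fD']] xx(2) f]) simp
  then show "c x x = 0" by simp
  then have "- (c x x' + c x' x) = 0" using f by (intro D_top[OF fD' xx(1)]) simp
  then show "c x x' + c x' x = 0" by (simp add: add_eq_0_iff)
qed

text \<open>
  Pairing with a vector of index \<open>1\<close> does not raise the filtration: the multiple \<open>\<beta>\<close> that is needed in the
  reflection along \<open>g 1 x y\<close> moves it by at most \<open>n\<close>.
\<close>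

lemma polar_g1:
  assumes G: "(x, y) \<in> G" 
  shows "w \<in> M n \<Longrightarrow> \<exists>\<beta>. c w (g 1 x y) + c (g 1 x y) w = t * \<delta> * \<beta> \<and> sc \<beta> (g 1 x y) \<in> M (n + 1)"
proof (induction rule: M.induct)
  case M_zero
  show ?case by (intro exI[of _ 0]) (auto simp: c_zero_left c_zero_right M.M_zero)
next
  case (M_g x' y' i w)
  then obtain \<beta> where \<beta>: "c w (g 1 x y) + c (g 1 x y) w = t * \<delta> * \<beta>" "sc \<beta> (g 1 x y) \<in> M (n + 1)"
    by blast
  from M_g obtain j where i: "i = Suc j" by (cases i) auto
  let ?\<beta> = "al ((c x x' + c x' x) / \<delta>) (Suc j) + al ((c x' y + c y x') / (b * \<delta>)) j"
  have "sc ?\<beta> (g 1 x y) \<in> M (n + 1)" unfolding scale_left_distrib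
    using M_g i G_K[OF G M_g(1)] G_K[OF M_g(1) G]
    by (intro M_add M_mono[OF _ al_g_M[OF G]] K_intros) auto
  with \<beta> show ?case using polar_g_g1[OF G M_g(1), of j] 
    by (intro exI[of _ "?\<beta> + \<beta>"]) (auto simp: i c_add_left c_add_right scale_left_distrib M_add algebra_simps)
qed

text \<open>
  Let \<open>(x, y)\<close> be the leading pair of \<open>w\<close> and \<open>e = g 1 x y\<close>. Then \<open>c e e = t \<delta> \<rho>\<close> with a constant \<open>\<rho>\<close>, which
  is not zero unless \<open>x = 0\<close>, by anisotropy. If \<open>t \<delta> \<beta>\<close> is the polar value of \<open>w\<close> and \<open>e\<close>, then
  \<open>\<rho> w - \<beta> e\<close> is proportional to the reflection of \<open>w\<close> along \<open>e\<close>, hence isotropic, and its leading terms cancel.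
  So it vanishes by induction, which makes \<open>w\<close> proportional to the anisotropic vector \<open>e\<close>.
\<close>

theorem descent: "w \<in> M n \<Longrightarrow> c w w = 0 \<Longrightarrow> w = 0"
proof (induction n arbitrary: w)
  case 0
  from \<open>w \<in> M 0\<close> show ?case by cases auto
next
  case (Suc n)
  obtain x y w' where G: "(x, y) \<in> G" and w': "w' \<in> M n" and w: "w = g (Suc n) x y + w'"
    using M_split[OF Suc.prems(1)] by blast
  note IH = Suc.IH and qw = Suc.prems(2)
  show ?case
  proof (cases n)
    case 0
    have "w' = 0" using w' unfolding 0 by cases auto
    let ?p = "[: c y y / (b * b), (c x y + c y x) / b, c x x :]"
    have "poly ?p t = c (g 1 x y) (g 1 x y)"
      using t_nz b_nz by (simp add: c_g \<tau>_def field_simps power2_eq_square)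
    also have "\<dots> = 0" using qw \<open>w' = 0\<close> by (simp add: w 0)
    finally have "?p = 0" using G_K[OF G G]
      by (intro t_transcendental) (auto simp: coeff_pCons split: nat.split intro!: K_intros)
    then have "x = 0 \<and> y = 0" using b_nz by (intro anisotropic[OF G]) auto
    then show ?thesis using \<open>w' = 0\<close> by (simp add: w g_def)
  next
    case (Suc k)
    obtain x' y' w'' where G': "(x', y') \<in> G" and w'': "w'' \<in> M k"
      and w'_eq: "w' = g (Suc k) x' y' + w''"
      using M_split[of w' k] w' Suc by blast
    have q: "c x x = 0" and p: "c x x' + c x' x = 0"
      using isotropic_top[OF G G' w''] qw unfolding w w'_eq Suc by (simp_all add: add.assoc)
    define e where "e = g 1 x y"
    define \<rho> where "\<rho> = (c x y + c y x) / (b * \<delta>)"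
    have \<rho>_K: "\<rho> \<in> K" using G_K[OF G G] by (auto simp: \<rho>_def intro!: K_intros)
    have "cj (c y x) = - c x y" using c_swap[OF G G] G_K[OF G G] by (simp add: cj_simps K_intros)
    then have cj_l: "cj \<rho> = \<rho>"
      using G_K[OF G G] c_swap[OF G G]
      by (simp add: \<rho>_def cj_simps K_intros diff_divide_distrib)
    have yy: "c y y = 0" using c_conj[OF G G] q by (simp add: cj_zero)
    have q_e: "c e e = t * \<delta> * \<rho>"
      using t_nz b_nz \<delta>_nz by (simp add: e_def c_g q yy \<rho>_def \<tau>_def field_simps power2_eq_square)
    show ?thesis
    proof (cases "\<rho> = 0")
      case True
      then have "x = 0 \<and> y = 0" using b_nz \<delta>_nz by (intro anisotropic[OF G q]) (simp add: \<rho>_def)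
      then have "w = w'" by (simp add: w g_def)
      then show ?thesis using IH w' qw by blast
    next
      case False
      obtain \<beta>'' where \<beta>'': "c w'' e + c e w'' = t * \<delta> * \<beta>''" "sc \<beta>'' e \<in> M (k + 1)"
        unfolding e_def using polar_g1[OF G w''] by blast
      define \<beta>' where "\<beta>' = al ((c x' y + c y x') / (b * \<delta>)) k + \<beta>''"
      define \<beta> where "\<beta> = al \<rho> (Suc k) + \<beta>'"
      have "sc (al ((c x' y + c y x') / (b * \<delta>)) k) e \<in> M (k + 1)"
        unfolding e_def using al_g_M[OF G, of "(c x' y + c y x') / (b * \<delta>)" 1 k] G_K[OF G' G] G_K[OF G G']
        by (auto intro!: K_intros)
      then have \<beta>'_M: "sc \<beta>' e \<in> M n"
        using \<beta>'' unfolding \<beta>'_def scale_left_distrib by (auto simp: Suc intro: M_add)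
      have g1: "c (g (Suc k) x' y') e + c e (g (Suc k) x' y') = t * \<delta> * al ((c x' y + c y x') / (b * \<delta>)) k"
        using polar_g_g1[OF G G', of k] p by (simp add: e_def al_0)
      have g2: "c (g (Suc n) x y) e + c e (g (Suc n) x y) = t * \<delta> * al \<rho> (Suc k)"
        using polar_g_g1[OF G G, of n] q by (simp add: e_def al_0 Suc \<rho>_def)
      have "c w e + c e w = (c (g (Suc n) x y) e + c e (g (Suc n) x y))
          + (c (g (Suc k) x' y') e + c e (g (Suc k) x' y')) + (c w'' e + c e w'')"
        by (simp add: w w'_eq c_add_left c_add_right)
      then have polar: "c w e + c e w = t * \<delta> * \<beta>"
        unfolding g1 g2 \<beta>''(1) by (simp add: \<beta>_def \<beta>'_def distrib_left)
      \<comment> \<open>A multiple of the reflection of the isotropic vector along \<open>e\<close>.\<close>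
      define v where "v = sc \<rho> w - sc \<beta> e"
      have "c v v = \<rho> * \<rho> * c w w - \<rho> * \<beta> * (c w e + c e w) + \<beta> * \<beta> * c e e"
      proof -
        have "v = sc \<rho> w + sc (- \<beta>) e" by (simp add: v_def)
        then show ?thesis by (simp only: c_add_left c_add_right c_scale_left c_scale_right) (simp add: algebra_simps)
      qed
      then have qv: "c v v = 0" using qw by (simp add: polar q_e)
      have "v \<in> M n"
      proof -
        have Gl: "(sc \<rho> x, sc \<rho> y) \<in> G" using G_scale[OF G \<rho>_K] by (simp add: cj_l)
        have G2: "(sc (- (\<rho> / b)) y, sc (- (\<rho> / b)) (sc b x)) \<in> G"
          using G_scale[OF G_swap[OF G], of "- (\<rho> / b)"] \<rho>_K by (simp add: cj_simps K_intros cj_l)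
        have "sc (al \<rho> (Suc k)) e = sc \<rho> (g (Suc n) x y) - g (Suc k) (sc (- (\<rho> / b)) y) (sc (- (\<rho> / b)) (sc b x))"
          using al_g_less[of \<rho> 1 k x y] unfolding e_def by (simp add: cj_l g_def Suc scale_right_distrib algebra_simps)
        then have "v = sc \<rho> w' + g (Suc k) (sc (- (\<rho> / b)) y) (sc (- (\<rho> / b)) (sc b x)) + sc (-1) (sc \<beta>' e)"
          unfolding v_def w \<beta>_def by (simp add: scale_left_distrib scale_right_distrib algebra_simps)
        moreover have "sc (-1) (sc \<beta>' e) \<in> M n"
          by (rule M_const[OF _ _ \<beta>'_M]) (auto simp: cj_simps K_intros)
        moreover have "g (Suc k) (sc (- (\<rho> / b)) y) (sc (- (\<rho> / b)) (sc b x)) \<in> M n"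
          using G2 by (rule M_g') (auto simp: Suc)
        ultimately show ?thesis using M_const[OF \<rho>_K cj_l w'] M_add by metis
      qed
      with qv have "v = 0" using IH by blast
      then have eq: "sc \<rho> w = sc \<beta> e" by (simp add: v_def)
      then have "c (sc \<beta> e) (sc \<beta> e) = 0"
        using qw by (metis c_scale_left c_scale_right mult_zero_right)
      then have "\<beta> = 0" using False t_nz \<delta>_nz by (simp add: c_scale_left c_scale_right q_e)
      then show ?thesis using eq False by simp
    qed
  qed
qed

definition F :: "'o set" where "F = {f / h |f h. f \<in> A \<and> h \<in> A \<and> h \<noteq> 0}"


lemma A_F: "f \<in> A \<Longrightarrow> f \<in> F"
  unfolding F_def using A_one by force

lemma F_one: "1 \<in> F" and F_zero: "0 \<in> F"
  by (simp_all add: A_F A_one A_zero)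

lemma F_diff: "f \<in> F \<Longrightarrow> f' \<in> F \<Longrightarrow> f - f' \<in> F"
proof -
  assume "f \<in> F" "f' \<in> F"
  then obtain p q p' q' where *: "p \<in> A" "q \<in> A" "q \<noteq> 0" "f = p / q" "p' \<in> A" "q' \<in> A" "q' \<noteq> 0" "f' = p' / q'"
    by (auto simp: F_def)
  then have "f - f' = (p * q' + - (p' * q)) / (q * q')" by (simp add: diff_frac_eq)
  moreover have "p * q' + - (p' * q) \<in> A" "q * q' \<in> A" using * by (blast intro: A_mult A_add A_minus)+
  moreover have "q * q' \<noteq> 0" using * by simp
  ultimately show ?thesis unfolding F_def by blast
qed

lemma F_mult: "f \<in> F \<Longrightarrow> f' \<in> F \<Longrightarrow> f * f' \<in> F"
proof -
  assume "f \<in> F" "f' \<in> F"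
  then obtain p q p' q' where *: "p \<in> A" "q \<in> A" "q \<noteq> 0" "f = p / q" "p' \<in> A" "q' \<in> A" "q' \<noteq> 0" "f' = p' / q'"
    by (auto simp: F_def)
  then have "f * f' = (p * p') / (q * q')" "p * p' \<in> A" "q * q' \<in> A" "q * q' \<noteq> 0"
    by (simp_all add: A_mult)
  then show ?thesis unfolding F_def by blast
qed

lemma F_inverse: "f \<in> F \<Longrightarrow> inverse f \<in> F"
proof (cases "f = 0")
  case False
  assume "f \<in> F"
  then obtain p q where "p \<in> A" "q \<in> A" "q \<noteq> 0" "f = p / q" by (auto simp: F_def)
  moreover from this False have "inverse f = q / p" "p \<noteq> 0" by simp_all
  ultimately show ?thesis unfolding F_def by blast
qed (simp add: F_zero)

lemma F_denominator:
  assumes "finite B" "\<And>b. b \<in> B \<Longrightarrow> f b \<in> F"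
  shows "\<exists>h\<in>A. h \<noteq> 0 \<and> (\<forall>b\<in>B. h * f b \<in> A)"
  using assms
proof (induction B rule: finite_induct)
  case empty
  show ?case using A_one by (intro bexI[of _ 1]) auto
next
  case (insert x B)
  obtain h where h: "h \<in> A" "h \<noteq> 0" "\<And>b. b \<in> B \<Longrightarrow> h * f b \<in> A"
    using insert.IH insert.prems by auto
  obtain p q where pq: "p \<in> A" "q \<in> A" "q \<noteq> 0" "f x = p / q"
    using insert.prems[of x] by (auto simp: F_def)
  have "h * q * f b \<in> A" if "b \<in> B" for b
    using A_mult[OF pq(2) h(3)[OF that]] by (simp add: mult_ac)
  moreover have "h * q * f x \<in> A" using pq A_mult[OF h(1) pq(1)] by simp
  ultimately show ?case using h pq A_mult[OF h(1) pq(2)] by (intro bexI[of _ "h * q"]) auto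
qed

text \<open>
  Clearing denominators moves the vector into some \<open>M n\<close>. Index \<open>0\<close> is allowed by \<open>g_zero\<close>, and \<open>g 0 x y\<close> is
  the vector \<open>x + t y\<close>.
\<close>

theorem F_anisotropic:
  assumes B: "finite B" "\<And>b. b \<in> B \<Longrightarrow> (x b, y b) \<in> G" "\<And>b. b \<in> B \<Longrightarrow> f b \<in> F"
    and q: "c (\<Sum>b\<in>B. sc (f b) (g 0 (x b) (y b))) (\<Sum>b\<in>B. sc (f b) (g 0 (x b) (y b))) = 0"
  shows "(\<Sum>b\<in>B. sc (f b) (g 0 (x b) (y b))) = 0" (is "?w = 0")
proof -
  obtain h where h: "h \<in> A" "h \<noteq> 0" "\<And>b. b \<in> B \<Longrightarrow> h * f b \<in> A"
    using F_denominator[of B f] B by blast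
  have "sc h ?w = (\<Sum>b\<in>B. sc (h * f b) (g 0 (x b) (y b)))" by (simp add: scale_sum_right)
  moreover have "\<exists>n. (\<Sum>b\<in>B. sc (h * f b) (g 0 (x b) (y b))) \<in> M n"
    by (intro M_sum A_M[of _ _ 1] h(3) M_g0 B(2)) auto
  ultimately obtain n where "sc h ?w \<in> M n" by auto
  moreover have "c (sc h ?w) (sc h ?w) = 0" using q by (simp add: c_scale_left c_scale_right)
  ultimately have "sc h ?w = 0" by (rule descent)
  then show ?thesis using h by simp
qed

lemma c_g0_F:
  assumes "(x, y) \<in> G" "(x', y') \<in> G" shows "c (g 0 x y) (g 0 x' y') / (t * \<delta>) \<in> F"
  unfolding g_zero using assms by (intro A_F c_g_A) (auto intro: G_swap)

end

section \<open>Quaternion algebras\<close>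

lemma k_algebra_vector_space: "k_algebra \<eta> \<Longrightarrow> vector_space (alg_scale \<eta>)"
  by unfold_locales
     (simp_all add: alg_scale_def k_algebra.structure_add k_algebra.structure_mult k_algebra.structure_one
        distrib_left distrib_right mult.assoc)

text \<open>
  A family with repeated members is dependent as well, which a statement on sets would not give.
\<close>

lemma (in vector_space) family_dependent:
  assumes "finite S" "span S = UNIV" "finite I" "card S < card I"
  shows "\<exists>u. (\<Sum>i\<in>I. scale (u i) (v i)) = 0 \<and> (\<exists>i\<in>I. u i \<noteq> 0)"
proof (cases "inj_on v I")
  case True
  have fin: "finite (v ` I)" using assms(3) by (rule finite_imageI)
  have "card (v ` I) = card I" using True by (rule card_image)
  then have "dependent (v ` I)"
    using independent_span_bound[OF assms(1), of "v ` I"] assms(2,4) by (metis linorder_not_le subset_UNIV)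
  then obtain u where u: "\<exists>y\<in>v ` I. u y \<noteq> 0" "(\<Sum>y\<in>v ` I. scale (u y) y) = 0"
    unfolding dependent_finite[OF fin] by blast
  then have "(\<Sum>i\<in>I. scale ((u \<circ> v) i) (v i)) = 0" using sum.reindex[OF True, of "\<lambda>y. scale (u y) y"] by simp
  moreover have "\<exists>i\<in>I. (u \<circ> v) i \<noteq> 0" using u(1) by auto
  ultimately show ?thesis by blast
next
  case False
  then obtain a b where ab: "a \<in> I" "b \<in> I" "a \<noteq> b" "v a = v b" unfolding inj_on_def by blast
  let ?u = "\<lambda>i. if i = a then (1::'a) else if i = b then - 1 else 0"
  have "(\<Sum>i\<in>I. scale (?u i) (v i)) = (\<Sum>i\<in>{a, b}. scale (?u i) (v i))"
    using assms ab by (intro sum.mono_neutral_right) auto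
  also have "\<dots> = 0" using ab by simp
  finally have "(\<Sum>i\<in>I. scale (?u i) (v i)) = 0" .
  moreover have "\<exists>i\<in>I. ?u i \<noteq> 0" using ab(1) by (intro bexI[of _ a]) simp_all
  ultimately show ?thesis by (intro exI[of _ ?u] conjI)
qed

context k_algebra begin

lemma \<eta>_zero: "\<eta> 0 = 0"
proof -
  have "\<eta> 0 + \<eta> 0 = \<eta> 0 + 0" using structure_add[of 0 0] by (simp only: add_0_right)
  then show ?thesis by (rule add_left_imp_eq)
qed
lemma \<eta>_minus: "\<eta> (- x) = - \<eta> x" using structure_add[of x "- x"] by (simp add: \<eta>_zero add_eq_0_iff2)
lemma \<eta>_diff: "\<eta> (x - y) = \<eta> x - \<eta> y" using structure_add[of x "- y"] by (simp add: \<eta>_minus)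
lemma \<eta>_inverse: "x \<noteq> 0 \<Longrightarrow> \<eta> x * \<eta> (inverse x) = 1"
  by (simp add: structure_mult[symmetric] structure_one)
lemma \<eta>_eq_0: "\<eta> x = 0 \<longleftrightarrow> x = 0"
proof
  assume 0: "\<eta> x = 0"
  show "x = 0"
  proof (rule ccontr)
    assume "x \<noteq> 0" from \<eta>_inverse[OF this] show False by (simp add: 0)
  qed
qed (simp add: \<eta>_zero)
lemma \<eta>_eq: "\<eta> x = \<eta> y \<longleftrightarrow> x = y"
  using \<eta>_eq_0[of "x - y"] by (simp add: \<eta>_diff)
lemma \<eta>_two: "\<eta> 2 = 2"
  using structure_add[of 1 1] by (simp add: structure_one)

lemma central_left: "x * (\<eta> c * y) = \<eta> c * (x * y)"
  by (simp only: mult.assoc[symmetric] structure_central[of c x])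

lemmas pull = structure_central[symmetric] central_left

lemma \<eta>_comm: "\<eta> c * \<eta> d = \<eta> d * \<eta> c" and \<eta>_left_comm: "\<eta> c * (\<eta> d * x) = \<eta> d * (\<eta> c * x)"
  by (rule structure_central, rule central_left)

lemma inverse_cancel: "c \<noteq> 0 \<Longrightarrow> \<eta> (inverse c) * (\<eta> c * x) = x"
  by (simp only: mult.assoc[symmetric] \<eta>_comm[of "inverse c"] \<eta>_inverse mult_1_left not_False_eq_True)

end

text \<open>
  The functions \<open>co x 0, \<dots>, co x 3\<close> are the coordinates of \<open>x\<close> with respect to \<open>1, i, j, ji\<close>. Any characteristic
  is covered because \<open>k(i)\<close> is separable over \<open>k\<close> (\<open>disc_nz\<close>); \<open>no_root\<close> says that it is a field.
\<close>

locale quaternion_generators = k_algebra \<eta> for \<eta> :: "'k::field \<Rightarrow> 'q::ring_1" +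
  fixes i j :: 'q and T N b :: 'k and co :: "'q \<Rightarrow> nat \<Rightarrow> 'k"
  assumes i_sq: "i * i = \<eta> T * i - \<eta> N"
    and j_sq: "j * j = \<eta> b"
    and i_j: "i * j = j * (\<eta> T - i)"
    and b_nz: "b \<noteq> 0"
    and disc_nz: "T * T - 4 * N \<noteq> 0"
    and no_root: "z * z - T * z + N \<noteq> 0"
    and conj_i: "canonical_involution \<eta> i = \<eta> T - i"
    and conj_j: "canonical_involution \<eta> j = - j"
    and co_expand: "x = \<eta> (co x 0) + \<eta> (co x 1) * i + j * (\<eta> (co x 2) + \<eta> (co x 3) * i)"
    and co_unique: "\<eta> u0 + \<eta> u1 * i + j * (\<eta> u2 + \<eta> u3 * i) = 0 \<Longrightarrow> u0 = 0 \<and> u1 = 0 \<and> u2 = 0 \<and> u3 = 0"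

context
  fixes \<eta> :: "'k::field \<Rightarrow> 'q::division_ring"
  assumes Q: "quaternion_algebra \<eta>"
begin

interpretation quaternion_algebra \<eta> by (rule Q)
interpretation vs: vector_space "alg_scale \<eta>" by (rule k_algebra_vector_space) unfold_locales

lemma basis_four: obtains S where "finite S" "vs.span S = UNIV" "card S = 4"
proof -
  obtain S where S: "vs.span S = UNIV" "card S = 4"
    using vs.basis_exists[of UNIV] dim_four unfolding alg_dim_def by (metis top.extremum_uniqueI)
  then have "finite S" by (intro card_ge_0_finite) simp
  then show ?thesis using that S by blast
qed

lemma five_dependent:
  fixes v :: "nat \<Rightarrow> 'q"
  shows "\<exists>u::nat \<Rightarrow> 'k. \<eta> (u 0) * v 0 + \<eta> (u 1) * v 1 + \<eta> (u 2) * v 2 + \<eta> (u 3) * v 3 + \<eta> (u 4) * v 4 = 0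
     \<and> (u 0 \<noteq> 0 \<or> u 1 \<noteq> 0 \<or> u 2 \<noteq> 0 \<or> u 3 \<noteq> 0 \<or> u 4 \<noteq> 0)"
proof -
  obtain S where S: "finite S" "vs.span S = UNIV" "card S = 4" using basis_four .
  have eq: "{..<5::nat} = {0, 1, 2, 3, 4}" by auto
  obtain u where u: "(\<Sum>i<5. alg_scale \<eta> (u i) (v i)) = 0" "\<exists>i<5. u i \<noteq> (0::'k)"
    using vs.family_dependent[OF S(1,2), of "{..<5}" v] S(3) by auto
  have "\<exists>i\<in>{..<5}. u i \<noteq> 0" using u(2) by auto
  then show ?thesis using u(1) unfolding eq by (intro exI[of _ u]) (auto simp: alg_scale_def add.assoc)
qed

lemma not_in_range: obtains x where "x \<notin> range \<eta>"
proof (rule ccontr)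
  assume *: "\<not> thesis"
  then have all: "x \<in> range \<eta>" for x using that by blast
  obtain S where S: "finite S" "vs.span S = UNIV" "card S = 4" using basis_four .
  have "UNIV \<subseteq> vs.span {1}"
  proof
    fix x :: 'q obtain c where "x = \<eta> c" using all by blast
    then have "x = alg_scale \<eta> c 1" by (simp add: alg_scale_def)
    then show "x \<in> vs.span {1}" by (auto intro: vs.span_scale vs.span_base)
  qed
  then have "vs.dim UNIV \<le> 1" using vs.dim_le_card[of UNIV "{1}"] by simp
  then show False using dim_four by (simp add: alg_dim_def)
qed

lemma not_central: assumes "x \<notin> range \<eta>" obtains y where "x * y \<noteq> y * x"
  using center[of x] assms by blast

lemma linear_zero: assumes "x \<notin> range \<eta>" "\<eta> a + \<eta> c * x = 0" shows "a = 0 \<and> c = 0"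
proof -
  have "c = 0"
  proof (rule ccontr)
    assume c: "c \<noteq> 0"
    have "x = \<eta> (inverse c) * (\<eta> c * x)" by (simp only: inverse_cancel[OF c])
    also have "\<eta> c * x = \<eta> (- a)" using assms(2) by (simp add: \<eta>_minus add_eq_0_iff)
    finally show False using assms(1) by (simp flip: structure_mult)
  qed
  then show ?thesis using assms(2) by (simp add: \<eta>_zero \<eta>_eq_0)
qed

text \<open>
  Five elements of the four-dimensional algebra are dependent. With \<open>y\<close> not commuting with \<open>x\<close>, the
  dependence between \<open>1, x, x\<^sup>2, y, x y\<close> cannot involve \<open>y\<close>: commuting it with \<open>x\<close> would kill \<open>x y - y x\<close>.
\<close>

lemma quadratic:
  assumes x: "x \<notin> range \<eta>" shows "\<exists>T N. x * x = \<eta> T * x - \<eta> N"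
proof -
  obtain y where y: "x * y \<noteq> y * x" using not_central[OF x] .
  define v where "v = (\<lambda>n::nat. if n = 0 then 1 else if n = 1 then x else if n = 2 then x * x else if n = 3 then y else x * y)"
  obtain u :: "nat \<Rightarrow> 'k" where "\<eta> (u 0) * v 0 + \<eta> (u 1) * v 1 + \<eta> (u 2) * v 2 + \<eta> (u 3) * v 3 + \<eta> (u 4) * v 4 = 0"
     and nz: "u 0 \<noteq> 0 \<or> u 1 \<noteq> 0 \<or> u 2 \<noteq> 0 \<or> u 3 \<noteq> 0 \<or> u 4 \<noteq> 0"
    using five_dependent[of v] by blast
  then have rel: "\<eta> (u 0) + \<eta> (u 1) * x + \<eta> (u 2) * (x * x) + (\<eta> (u 3) + \<eta> (u 4) * x) * y = 0"
    by (simp add: v_def algebra_simps)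
  let ?a = "\<eta> (u 0) + \<eta> (u 1) * x + \<eta> (u 2) * (x * x)" and ?c = "\<eta> (u 3) + \<eta> (u 4) * x"
  have comm_a: "x * ?a = ?a * x" and comm_c: "x * ?c = ?c * x"
    by (simp_all add: distrib_left distrib_right mult.assoc pull[of x])
  have "?c * y = - ?a" using rel by (simp add: add_eq_0_iff)
  then have "x * (?c * y) = (?c * y) * x" by (simp only: mult_minus_right mult_minus_left comm_a)
  then have "?c * (x * y - y * x) = 0"
    by (simp add: right_diff_distrib mult.assoc[symmetric] comm_c)
  then have "?c = 0" using y by simp
  then have "u 3 = 0" "u 4 = 0" using linear_zero[OF x] by auto
  then have rel': "\<eta> (u 0) + \<eta> (u 1) * x + \<eta> (u 2) * (x * x) = 0" using rel by (simp add: \<eta>_zero)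
  have "u 2 \<noteq> 0"
  proof
    assume "u 2 = 0"
    then show False using rel' linear_zero[OF x, of "u 0" "u 1"] nz \<open>u 3 = 0\<close> \<open>u 4 = 0\<close> by (simp add: \<eta>_zero)
  qed
  have "\<eta> (u 2) * (x * x) = - \<eta> (u 0) - \<eta> (u 1) * x" using rel' by (simp add: algebra_simps add_eq_0_iff)
  then have "\<eta> (inverse (u 2)) * (\<eta> (u 2) * (x * x)) = \<eta> (inverse (u 2)) * (- \<eta> (u 0) - \<eta> (u 1) * x)" by simp
  then have "x * x = \<eta> (inverse (u 2)) * (- \<eta> (u 0) - \<eta> (u 1) * x)"
    by (simp only: inverse_cancel[OF \<open>u 2 \<noteq> 0\<close>])
  also have "\<dots> = \<eta> (- (inverse (u 2) * u 1)) * x - \<eta> (inverse (u 2) * u 0)"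
    by (simp add: \<eta>_minus structure_mult algebra_simps \<eta>_comm \<eta>_left_comm)
  finally show ?thesis by blast
qed

text \<open>
  If every noncentral element were inseparable, the characteristic would be \<open>2\<close> and all squares central. Then
  \<open>x y + y x\<close> is always central, and applying this to \<open>i\<close>, \<open>y\<close> and to \<open>i\<close>, \<open>i y\<close> forces \<open>i\<close> to be central.
\<close>

lemma separable_element:
  "\<exists>i T N. i \<notin> range \<eta> \<and> i * i = \<eta> T * i - \<eta> N \<and> i + i \<noteq> \<eta> T"
proof (rule ccontr)
  assume no: "\<not> ?thesis"
  have insep: "x + x = \<eta> T" if "x \<notin> range \<eta>" "x * x = \<eta> T * x - \<eta> N" for x T N
    using that no by blast
  obtain i where i: "i \<notin> range \<eta>" using not_in_range .
  have two: "(2::'k) = 0"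
  proof (rule ccontr)
    assume "(2::'k) \<noteq> 0"
    obtain T N where "i * i = \<eta> T * i - \<eta> N" using quadratic[OF i] by blast
    then have "i + i = \<eta> T" by (rule insep[OF i])
    then have "\<eta> (- T) + \<eta> 2 * i = 0" by (simp add: \<eta>_minus \<eta>_two mult_2)
    then show False using linear_zero[OF i] \<open>2 \<noteq> 0\<close> by blast
  qed
  then have two_q: "x + x = 0" for x :: 'q using \<eta>_two by (metis \<eta>_zero mult_2 mult_zero_left)
  have neg: "- x = x" for x :: 'q using two_q[of x] by (simp add: add_eq_0_iff)
  have square: "x * x \<in> range \<eta>" for x
  proof (cases "x \<in> range \<eta>")
    case True then show ?thesis by (auto simp flip: structure_mult)
  next
    case False
    then obtain T N where TN: "x * x = \<eta> T * x - \<eta> N" using quadratic by blast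
    then have "T = 0" using insep[OF False TN] two_q[of x] \<eta>_eq_0 by simp
    then have "x * x = \<eta> (- N)" using TN by (simp add: \<eta>_zero \<eta>_minus)
    then show ?thesis by simp
  qed
  have anti: "x * y + y * x \<in> range \<eta>" for x y
  proof -
    obtain p q r where "(x + y) * (x + y) = \<eta> p" "x * x = \<eta> q" "y * y = \<eta> r" using square by (meson rangeE)
    then have "x * y + y * x = \<eta> (p - q - r)" by (simp add: \<eta>_diff structure_add distrib_left distrib_right)
         (simp add: algebra_simps)
    then show ?thesis by simp
  qed
  obtain y where y: "i * y \<noteq> y * i" using not_central[OF i] .
  obtain c where c: "i * y + y * i = \<eta> c" using anti by blast
  have "c \<noteq> 0"
  proof
    assume "c = 0"
    then have "i * y = - (y * i)" using c by (simp add: \<eta>_zero add_eq_0_iff2)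
    then show False using y neg by simp
  qed
  obtain d where "i * (i * y) + (i * y) * i = \<eta> d" using anti by blast
  then have "i * \<eta> c = \<eta> d" unfolding c[symmetric] by (simp add: distrib_left mult.assoc)
  then have "\<eta> (- d) + \<eta> c * i = 0" by (simp add: \<eta>_minus pull[of i])
  then show False using linear_zero[OF i] \<open>c \<noteq> 0\<close> by blast
qed

lemma reduced_trace_eq:
  assumes x: "x \<notin> range \<eta>" and eq: "x * x = \<eta> T * x - \<eta> N"
  shows "canonical_involution \<eta> x = \<eta> T - x"
proof -
  have "(THE t. x * x - \<eta> t * x \<in> range \<eta>) = T"
  proof (rule the_equality)
    show "x * x - \<eta> T * x \<in> range \<eta>" using eq by (auto intro: range_eqI[of _ _ "- N"] simp: \<eta>_minus)
    fix t assume "x * x - \<eta> t * x \<in> range \<eta>"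
    then obtain n where "x * x - \<eta> t * x = \<eta> n" by blast
    then have "\<eta> (- N - n) + \<eta> (T - t) * x = 0" by (simp add: eq \<eta>_diff \<eta>_minus algebra_simps)
    then show "t = T" using linear_zero[OF x] by force
  qed
  then show ?thesis using x by (simp add: canonical_involution_def reduced_trace_def)
qed

text \<open>
  The commutator \<open>j = i y - y i\<close> satisfies \<open>i j = j (T - i)\<close> by the quadratic equation of \<open>i\<close>, whatever the
  characteristic; this avoids the theorem of Skolem and Noether.
\<close>

theorem quaternion_generators_exist: "\<exists>i j T N b co. quaternion_generators \<eta> i j T N b co"
proof -
  obtain i T N where i: "i \<notin> range \<eta>" and i_sq: "i * i = \<eta> T * i - \<eta> N" and sep: "i + i \<noteq> \<eta> T"
    using separable_element by blast
  obtain y where y: "i * y \<noteq> y * i" using not_central[OF i] .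
  define j where "j = i * y - y * i"
  have j: "j \<noteq> 0" using y by (simp add: j_def)
  have i_j: "i * j = j * (\<eta> T - i)"
  proof -
    have iiy: "i * (i * y) = \<eta> T * (i * y) - \<eta> N * y"
      by (simp only: mult.assoc[symmetric] i_sq left_diff_distrib)
    show ?thesis unfolding j_def
      by (simp add: right_diff_distrib left_diff_distrib mult.assoc pull[of i] pull[of y] iiy i_sq)
  qed
  have indep: "u0 = 0 \<and> u1 = 0 \<and> u2 = 0 \<and> u3 = 0"
    if 0: "\<eta> u0 + \<eta> u1 * i + j * (\<eta> u2 + \<eta> u3 * i) = 0" for u0 u1 u2 u3
  proof -
    let ?a = "\<eta> u0 + \<eta> u1 * i" and ?c = "\<eta> u2 + \<eta> u3 * i"
    have a: "i * ?a = ?a * i" and c: "i * ?c = ?c * i"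
      by (simp_all add: distrib_left distrib_right mult.assoc pull[of i])
    have "j * ?c = - ?a" using 0 by (simp add: add_eq_0_iff)
    then have "i * (j * ?c) = (j * ?c) * i" by (simp only: mult_minus_right mult_minus_left a)
    then have "j * ((\<eta> T - i) * ?c) = j * (i * ?c)" unfolding c by (simp add: mult.assoc[symmetric] i_j)
    then have "(\<eta> T - i) * ?c = i * ?c" using j by simp
    then have "(\<eta> T - (i + i)) * ?c = 0" by (simp add: algebra_simps)
    then have "?c = 0" using sep by auto
    then have "?a = 0" using 0 by simp
    then show ?thesis using linear_zero[OF i] \<open>?c = 0\<close> by blast
  qed
  have span: "\<exists>u0 u1 u2 u3. x = \<eta> u0 + \<eta> u1 * i + j * (\<eta> u2 + \<eta> u3 * i)" for x
  proof -
    define v where "v = (\<lambda>n::nat. if n = 0 then 1 else if n = 1 then i else if n = 2 then j else if n = 3 then j * i else x)"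
    obtain u :: "nat \<Rightarrow> 'k" where "\<eta> (u 0) * v 0 + \<eta> (u 1) * v 1 + \<eta> (u 2) * v 2 + \<eta> (u 3) * v 3 + \<eta> (u 4) * v 4 = 0"
       and nz: "u 0 \<noteq> 0 \<or> u 1 \<noteq> 0 \<or> u 2 \<noteq> 0 \<or> u 3 \<noteq> 0 \<or> u 4 \<noteq> 0"
      using five_dependent[of v] by blast
    then have rel: "\<eta> (u 0) + \<eta> (u 1) * i + j * (\<eta> (u 2) + \<eta> (u 3) * i) + \<eta> (u 4) * x = 0"
      by (simp add: v_def algebra_simps pull[of j])
    have u4: "u 4 \<noteq> 0"
    proof
      assume "u 4 = 0"
      then have "u 0 = 0 \<and> u 1 = 0 \<and> u 2 = 0 \<and> u 3 = 0" using rel by (intro indep) (simp add: \<eta>_zero)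
      then show False using nz \<open>u 4 = 0\<close> by simp
    qed
    let ?d = "- inverse (u 4)"
    have "\<eta> (u 4) * x = - (\<eta> (u 0) + \<eta> (u 1) * i + j * (\<eta> (u 2) + \<eta> (u 3) * i))"
      using rel by (simp add: add_eq_0_iff)
    then have "\<eta> (inverse (u 4)) * (\<eta> (u 4) * x) = \<eta> (inverse (u 4)) * - (\<eta> (u 0) + \<eta> (u 1) * i + j * (\<eta> (u 2) + \<eta> (u 3) * i))"
      by simp
    then have "x = \<eta> (inverse (u 4)) * - (\<eta> (u 0) + \<eta> (u 1) * i + j * (\<eta> (u 2) + \<eta> (u 3) * i))"
      by (simp only: inverse_cancel[OF u4])
    also have "\<dots> = \<eta> (?d * u 0) + \<eta> (?d * u 1) * i + j * (\<eta> (?d * u 2) + \<eta> (?d * u 3) * i)"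
      by (simp add: \<eta>_minus structure_mult distrib_left right_diff_distrib pull[of j] mult.assoc)
    finally show ?thesis by blast
  qed
  define co where "co = (\<lambda>x. SOME f. x = \<eta> (f 0) + \<eta> (f 1) * i + j * (\<eta> (f 2) + \<eta> (f (3::nat)) * i))"
  have co: "x = \<eta> (co x 0) + \<eta> (co x 1) * i + j * (\<eta> (co x 2) + \<eta> (co x 3) * i)" for x
  proof -
    obtain u0 u1 u2 u3 where "x = \<eta> u0 + \<eta> u1 * i + j * (\<eta> u2 + \<eta> u3 * i)" using span[of x] by blast
    then have "\<exists>f. x = \<eta> (f 0) + \<eta> (f 1) * i + j * (\<eta> (f 2) + \<eta> (f (3::nat)) * i)"
      by (intro exI[of _ "\<lambda>n. if n = 0 then u0 else if n = 1 then u1 else if n = 2 then u2 else u3"]) simp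
    then show ?thesis unfolding co_def by (rule someI_ex)
  qed
  have "j * j \<in> range \<eta>"
  proof (rule center, rule allI)
    fix x
    have ij: "(\<eta> T - i) * j = j * i" using i_j by (simp add: algebra_simps pull[of j])
    have "i * (j * j) = j * ((\<eta> T - i) * j)" by (simp only: mult.assoc[symmetric] i_j)
    then have comm: "(j * j) * i = i * (j * j)" by (simp only: ij mult.assoc)
    have comm2: "(j * j) * (j * z) = j * ((j * j) * z)" for z by (simp add: mult.assoc)
    have comm3: "(j * j) * (\<eta> c * i) = (\<eta> c * i) * (j * j)" for c
      by (simp only: central_left comm mult.assoc) (simp only: comm[unfolded mult.assoc])
    have comm4: "(j * j) * \<eta> c = \<eta> c * (j * j)" for c by (rule structure_central[symmetric])
    have comm5: "(j * j) * (\<eta> a + \<eta> c * i) = (\<eta> a + \<eta> c * i) * (j * j)" for a c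
      by (simp only: distrib_left distrib_right comm3 comm4)
    have "(j * j) * (j * (\<eta> a + \<eta> c * i)) = (j * (\<eta> a + \<eta> c * i)) * (j * j)" for a c
      unfolding comm2 comm5 by (simp add: mult.assoc)
    then have "(j * j) * (\<eta> a + \<eta> c * i + j * (\<eta> a' + \<eta> c' * i)) = (\<eta> a + \<eta> c * i + j * (\<eta> a' + \<eta> c' * i)) * (j * j)" for a c a' c'
      using comm5 by (simp only: distrib_left[of "j * j"] distrib_right[of _ _ "j * j"])
    then show "j * j * x = x * (j * j)" by (subst (1 2) co[of x])
  qed
  then obtain b where b: "j * j = \<eta> b" by blast
  have "j \<notin> range \<eta>"
  proof
    assume "j \<in> range \<eta>"
    then obtain c where "j = \<eta> c" by blast
    then have "i * j = j * i" using structure_central[of c i] by simp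
    then have "j * (\<eta> T - i) = j * i" unfolding i_j .
    then have "\<eta> T - i = i" using j by simp
    then have "i + i = \<eta> T" by (simp add: diff_eq_eq)
    then show False using sep by simp
  qed
  then have conj_j: "canonical_involution \<eta> j = - j"
    using reduced_trace_eq[of j 0 "- b"] b by (simp add: \<eta>_zero \<eta>_minus)
  have sq: "(i + i - \<eta> T) * (i + i - \<eta> T) = \<eta> (T * T - 4 * N)"
  proof -
    have four: "\<eta> 4 = 4" using structure_add[of 2 2] by (simp add: \<eta>_two)
    have "(i + i - \<eta> T) * (i + i - \<eta> T)
        = (i * i + i * i + i * i + i * i) - (\<eta> T * i + \<eta> T * i + \<eta> T * i + \<eta> T * i) + \<eta> T * \<eta> T"
      by (simp add: distrib_left distrib_right right_diff_distrib left_diff_distrib pull[of i])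
    also have "\<dots> = \<eta> T * \<eta> T - (\<eta> N + \<eta> N + \<eta> N + \<eta> N)" unfolding i_sq by simp
    also have "\<eta> N + \<eta> N + \<eta> N + \<eta> N = (1 + 1 + 1 + 1) * \<eta> N" by (simp only: distrib_right mult_1_left)
    also have "(1 + 1 + 1 + 1 :: 'q) = 4" by simp
    finally show ?thesis by (simp add: \<eta>_diff structure_mult four)
  qed
  have disc: "T * T - 4 * N \<noteq> 0"
  proof
    assume "T * T - 4 * N = 0"
    then have "(i + i - \<eta> T) * (i + i - \<eta> T) = 0" using sq by (simp add: \<eta>_zero)
    then show False using sep by simp
  qed
  have no_root: "z * z - T * z + N \<noteq> 0" for z
  proof
    assume z: "z * z - T * z + N = 0"
    have "(i - \<eta> z) * (i - \<eta> (T - z)) = \<eta> T * i - \<eta> N - \<eta> T * i + \<eta> (z * (T - z))"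
      using i_sq by (simp add: algebra_simps pull[of i] \<eta>_diff structure_mult \<eta>_comm)
    also have "\<dots> = - \<eta> (z * z - T * z + N)" by (simp add: \<eta>_diff structure_add algebra_simps)
    finally have "(i - \<eta> z) * (i - \<eta> (T - z)) = 0" using z by (simp add: \<eta>_zero)
    then have "i = \<eta> z \<or> i = \<eta> (T - z)" by auto
    then show False using i by blast
  qed
  have "b \<noteq> 0"
  proof
    assume "b = 0"
    then have "j * j = 0" using b by (simp add: \<eta>_zero)
    then show False using j by simp
  qed
  have "quaternion_generators \<eta> i j T N b co"
    by unfold_locales
       (fact i_sq b i_j \<open>b \<noteq> 0\<close> disc no_root reduced_trace_eq[OF i i_sq] conj_j co indep)+
  then show ?thesis by blast
qed

end

context quaternion_generators begin

lemma co_eq: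
  assumes "x = \<eta> u0 + \<eta> u1 * i + j * (\<eta> u2 + \<eta> u3 * i)"
  shows "co x 0 = u0" "co x 1 = u1" "co x 2 = u2" "co x 3 = u3"
proof -
  have "\<eta> (co x 0 - u0) + \<eta> (co x 1 - u1) * i + j * (\<eta> (co x 2 - u2) + \<eta> (co x 3 - u3) * i)
    = (\<eta> (co x 0) + \<eta> (co x 1) * i + j * (\<eta> (co x 2) + \<eta> (co x 3) * i))
     - (\<eta> u0 + \<eta> u1 * i + j * (\<eta> u2 + \<eta> u3 * i))"
    by (simp add: \<eta>_diff algebra_simps)
  also have "\<dots> = 0" using co_expand[of x] assms by simp
  finally show "co x 0 = u0" "co x 1 = u1" "co x 2 = u2" "co x 3 = u3"
    using co_unique by force+
qed

lemma nat_less_4: "n < 4 \<Longrightarrow> n = 0 \<or> n = 1 \<or> n = 2 \<or> n = (3::nat)" by auto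

lemma co_add: "n < 4 \<Longrightarrow> co (x + y) n = co x n + co y n"
proof -
  have "x + y = \<eta> (co x 0 + co y 0) + \<eta> (co x 1 + co y 1) * i + j * (\<eta> (co x 2 + co y 2) + \<eta> (co x 3 + co y 3) * i)"
    by (subst co_expand[of x], subst co_expand[of y]) (simp add: structure_add algebra_simps)
  from co_eq[OF this] show "n < 4 \<Longrightarrow> ?thesis" using nat_less_4 by auto
qed

lemma co_scale: "n < 4 \<Longrightarrow> co (\<eta> c * x) n = c * co x n"
proof -
  have "\<eta> c * x = \<eta> (c * co x 0) + \<eta> (c * co x 1) * i + j * (\<eta> (c * co x 2) + \<eta> (c * co x 3) * i)"
    by (subst co_expand[of x]) (simp add: structure_mult distrib_left pull[of i] pull[of j] mult.assoc)
  from co_eq[OF this] show "n < 4 \<Longrightarrow> ?thesis" using nat_less_4 by auto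
qed

lemma co_range: "x \<in> range \<eta> \<longleftrightarrow> co x 1 = 0 \<and> co x 2 = 0 \<and> co x 3 = 0"
proof
  assume "x \<in> range \<eta>"
  then obtain c where "x = \<eta> c + \<eta> 0 * i + j * (\<eta> 0 + \<eta> 0 * i)" by (auto simp: \<eta>_zero)
  from co_eq[OF this] show "co x 1 = 0 \<and> co x 2 = 0 \<and> co x 3 = 0" by simp
next
  assume "co x 1 = 0 \<and> co x 2 = 0 \<and> co x 3 = 0"
  then have "x = \<eta> (co x 0)" using co_expand[of x] by (simp add: \<eta>_zero)
  then show "x \<in> range \<eta>" by (metis rangeI)
qed

lemma j_i: "(\<eta> T - i) * j = j * i"
  using i_j by (simp add: algebra_simps pull[of i] pull[of j] \<eta>_comm \<eta>_left_comm)

lemma co_times_i: "co (x * i) 2 = - N * co x 3" "co (x * i) 3 = co x 2 + T * co x 3"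
proof -
  have "x * i = \<eta> (- N * co x 1) + \<eta> (co x 0 + T * co x 1) * i + j * (\<eta> (- N * co x 3) + \<eta> (co x 2 + T * co x 3) * i)"
  proof -
    have "(\<eta> u + \<eta> v * i) * i = \<eta> (- N * v) + \<eta> (u + T * v) * i" for u v
      by (simp add: distrib_right mult.assoc i_sq structure_add structure_mult \<eta>_minus algebra_simps pull[of i] pull[of j] \<eta>_comm \<eta>_left_comm)
    then show ?thesis by (subst co_expand[of x]) (simp only: distrib_right mult.assoc)
  qed
  from co_eq(3,4)[OF this] show "co (x * i) 2 = - N * co x 3" "co (x * i) 3 = co x 2 + T * co x 3" .
qed

lemma co_conj_i_times: "co ((\<eta> T - i) * x) 2 = - N * co x 3" "co ((\<eta> T - i) * x) 3 = co x 2 + T * co x 3"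
proof -
  let ?a = "\<eta> (co x 0) + \<eta> (co x 1) * i" and ?c = "\<eta> (co x 2) + \<eta> (co x 3) * i"
  have "i * ?c = \<eta> (- N * co x 3) + \<eta> (co x 2 + T * co x 3) * i"
    by (simp add: distrib_left pull[of i] pull[of j] i_sq structure_add structure_mult \<eta>_minus algebra_simps pull[of i] pull[of j] \<eta>_comm \<eta>_left_comm)
  moreover have "(\<eta> T - i) * ?a = \<eta> (T * co x 0 + N * co x 1) + \<eta> (- co x 0) * i"
    by (simp add: distrib_left left_diff_distrib pull[of i] pull[of j] i_sq structure_add structure_mult \<eta>_minus algebra_simps pull[of i] pull[of j] \<eta>_comm \<eta>_left_comm)
  moreover have "(\<eta> T - i) * x = (\<eta> T - i) * ?a + j * (i * ?c)"
    by (subst co_expand[of x]) (simp only: distrib_left[of "\<eta> T - i"] mult.assoc[symmetric] j_i)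
  ultimately have "(\<eta> T - i) * x = \<eta> (T * co x 0 + N * co x 1) + \<eta> (- co x 0) * i
      + j * (\<eta> (- N * co x 3) + \<eta> (co x 2 + T * co x 3) * i)" by simp
  from co_eq(3,4)[OF this] show "co ((\<eta> T - i) * x) 2 = - N * co x 3" "co ((\<eta> T - i) * x) 3 = co x 2 + T * co x 3" .
qed

lemma K_j: "(\<eta> u + \<eta> v * i) * j = j * (\<eta> (u + T * v) + \<eta> (- v) * i)"
  by (simp add: distrib_right mult.assoc i_j structure_add structure_mult \<eta>_minus algebra_simps pull[of i] pull[of j] \<eta>_comm \<eta>_left_comm)

lemma times_j: "x * j = \<eta> (b * (co x 2 + T * co x 3)) + \<eta> (b * - co x 3) * i + j * (\<eta> (co x 0 + T * co x 1) + \<eta> (- co x 1) * i)"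
proof -
  have "x * j = j * (\<eta> (co x 0 + T * co x 1) + \<eta> (- co x 1) * i) + (j * j) * (\<eta> (co x 2 + T * co x 3) + \<eta> (- co x 3) * i)"
  proof -
    let ?a = "\<eta> (co x 0) + \<eta> (co x 1) * i" and ?c = "\<eta> (co x 2) + \<eta> (co x 3) * i"
    have "x * j = ?a * j + j * (?c * j)"
      by (subst co_expand[of x]) (simp only: distrib_right[of ?a "j * ?c" j] mult.assoc[of j ?c j])
    then show ?thesis unfolding K_j by (simp only: mult.assoc)
  qed
  then show ?thesis unfolding j_sq by (simp only: distrib_left[of "\<eta> b"] structure_mult mult.assoc add_ac)
qed

lemma minus_j_times: "- j * x = \<eta> (- b * co x 2) + \<eta> (- b * co x 3) * i + j * (\<eta> (- co x 0) + \<eta> (- co x 1) * i)"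
proof -
  have "- j * x = - (j * (\<eta> (co x 0) + \<eta> (co x 1) * i)) - (j * j) * (\<eta> (co x 2) + \<eta> (co x 3) * i)"
    by (subst co_expand[of x]) (simp add: distrib_left mult.assoc)
  then show ?thesis unfolding j_sq by (simp add: distrib_left right_diff_distrib structure_mult mult.assoc pull[of j] \<eta>_minus)
qed

lemma co_times_j: "co (x * j) 2 = co x 0 + T * co x 1" "co (x * j) 3 = - co x 1"
  using co_eq[OF times_j[of x]] by simp_all

lemma co_minus_j_times: "co (- j * x) 2 = - co x 0" "co (- j * x) 3 = - co x 1"
    "co (- j * x) 0 = - b * co x 2" "co (- j * x) 1 = - b * co x 3"
  using co_eq[OF minus_j_times[of x]] by simp_all

end

section \<open>Field extensions of odd degree\<close>

definition adjoin :: "'a::field set \<Rightarrow> 'a \<Rightarrow> 'a set" where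
  "adjoin E \<theta> = (\<lambda>p. poly p \<theta>) ` polys_over E"

lemma adjoin_reduced:
  assumes E: "is_subfield E" and m: "minimal_poly E \<theta> m" and x: "x \<in> adjoin E \<theta>"
  obtains p where "p \<in> polys_over E" "degree p < degree m" "poly p \<theta> = x"
proof -
  obtain q where q: "q \<in> polys_over E" "x = poly q \<theta>" using x by (auto simp: adjoin_def)
  obtain a r where r: "a \<in> polys_over E" "r \<in> polys_over E" "q = m * a + r" "r = 0 \<or> degree r < degree m"
    using polys_over_division[OF E minimal_polyD(1,2)[OF m] q(1)] by blast
  then have "poly r \<theta> = x" using q m by (auto simp: minimal_poly_def)
  moreover have "degree r < degree m" using r(4) minimal_poly_degree_pos[OF m] by auto
  ultimately show ?thesis using that r by blast
qed

lemma subset_adjoin: "is_subfield E \<Longrightarrow> E \<subseteq> adjoin E \<theta>"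
proof
  fix x assume "is_subfield E" "x \<in> E"
  then have "monom x 0 \<in> polys_over E" "poly (monom x 0) \<theta> = x" by (auto simp: poly_monom intro: polys_over_monom)
  then show "x \<in> adjoin E \<theta>" unfolding adjoin_def by (metis image_eqI)
qed

lemma is_subfield_adjoin:
  assumes E: "is_subfield E" and m: "minimal_poly E \<theta> m" shows "is_subfield (adjoin E \<theta>)"
proof -
  have 1: "1 \<in> adjoin E \<theta>" using subset_adjoin E subfield_one by blast
  have diff: "x - y \<in> adjoin E \<theta>" and mult: "x * y \<in> adjoin E \<theta>"
    if xy: "x \<in> adjoin E \<theta>" "y \<in> adjoin E \<theta>" for x y
  proof -
    obtain p q where "p \<in> polys_over E" "x = poly p \<theta>" "q \<in> polys_over E" "y = poly q \<theta>"
      using xy by (auto simp: adjoin_def)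
    then have "x - y = poly (p - q) \<theta>" "x * y = poly (p * q) \<theta>" "p - q \<in> polys_over E" "p * q \<in> polys_over E"
      using E by (simp_all add: polys_over_diff polys_over_mult)
    then show "x - y \<in> adjoin E \<theta>" "x * y \<in> adjoin E \<theta>" unfolding adjoin_def by blast+
  qed
  have inv: "inverse x \<in> adjoin E \<theta>" if x: "x \<in> adjoin E \<theta>" "x \<noteq> 0" for x
  proof -
    \<comment> \<open>Euclid's algorithm for \<open>m\<close> and \<open>p\<close>, which have no common factor because \<open>m\<close> has least degree.\<close>
    have *: "p \<in> polys_over E \<Longrightarrow> degree p < degree m \<Longrightarrow> p \<noteq> 0 \<Longrightarrow> \<exists>a\<in>polys_over E. poly (p * a) \<theta> = 1" for p
    proof (induction "degree p" arbitrary: p rule: less_induct)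
      case less
      obtain a r where r: "a \<in> polys_over E" "r \<in> polys_over E" "m = p * a + r" "r = 0 \<or> degree r < degree p"
        using polys_over_division[OF E less.prems(1,3), of m] m unfolding minimal_poly_def by blast
      have m0: "m \<noteq> 0" "poly m \<theta> = 0" using m by (auto simp: minimal_poly_def)
      have p\<theta>: "poly p \<theta> \<noteq> 0" using minimal_poly_degree_le[OF m less.prems(1,3)] less.prems(2) by auto
      show ?case
      proof (cases "r = 0")
        case True
        then have "poly a \<theta> = 0" "a \<noteq> 0" using r(3) m0 p\<theta> by auto
        then have "degree m \<le> degree a" using minimal_poly_degree_le[OF m r(1)] by blast
        moreover have "degree m = degree p + degree a" using True r(3) m0 less.prems by (auto simp: degree_mult_eq)
        ultimately have "degree p = 0" by simp
        then obtain u where u: "p = [:u:]" by (rule degree_eq_zeroE)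
        then have "u \<in> E" "u \<noteq> 0" using less.prems polys_over_coeff[of p E 0] by auto
        then have "monom (inverse u) 0 \<in> polys_over E" using E by (intro polys_over_monom subfield_inverse)
        then show ?thesis using u \<open>u \<noteq> 0\<close> by (intro bexI[of _ "monom (inverse u) 0"]) (auto simp: poly_monom)
      next
        case False
        then have deg: "degree r < degree p" using r(4) by blast
        then obtain a' where a': "a' \<in> polys_over E" "poly (r * a') \<theta> = 1"
          using less.hyps[OF deg r(2) less_trans[OF deg less.prems(2)] False] by blast
        have "poly (p * (0 - a * a')) \<theta> = poly (r * a') \<theta> - poly m \<theta> * poly a' \<theta>"
          unfolding r(3) by (simp add: algebra_simps)
        then have "poly (p * (0 - a * a')) \<theta> = 1" using a' m0 by simp
        moreover have "0 - a * a' \<in> polys_over E" using E r a' by (intro polys_over_diff polys_over_mult polys_over_zero)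
        ultimately show ?thesis by (intro bexI)
      qed
    qed
    obtain p where p: "p \<in> polys_over E" "degree p < degree m" "poly p \<theta> = x"
      using adjoin_reduced[OF E m x(1)] .
    then have "p \<noteq> 0" using x(2) by auto
    from *[OF p(1,2) this] obtain a where "a \<in> polys_over E" "poly (p * a) \<theta> = 1" by blast
    then have "inverse x = poly a \<theta>" using p(3) by (simp add: inverse_unique)
    then show ?thesis using \<open>a \<in> polys_over E\<close> by (auto simp: adjoin_def)
  qed
  have inv': "inverse x \<in> adjoin E \<theta>" if "x \<in> adjoin E \<theta>" for x
    using inv[OF that] that by (cases "x = 0") auto
  show ?thesis unfolding is_subfield_def by (intro conjI ballI 1 diff mult inv')
qed

locale field_extension = k_algebra j for j :: "'k::field \<Rightarrow> 'l::field"
begin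

sublocale vs: vector_space "alg_scale j" by (rule k_algebra_vector_space) unfold_locales

lemma j_zero: "j 0 = 0"
proof -
  have "j 0 + j 0 = j 0 + 0" using structure_add[of 0 0] by (simp only: add_0_right)
  then show ?thesis by (rule add_left_imp_eq)
qed
lemma j_minus: "j (- x) = - j x" using structure_add[of x "- x"] by (simp add: j_zero add_eq_0_iff2)
lemma j_diff: "j (x - y) = j x - j y" using structure_add[of x "- y"] by (simp add: j_minus)
lemma j_inverse: "j (inverse x) = inverse (j x)"
proof (cases "x = 0")
  case False
  then have "j x * j (inverse x) = 1" by (simp add: structure_mult[symmetric] structure_one)
  then show ?thesis by (metis inverse_unique)
qed (simp add: j_zero)

lemma is_subfield_range: "is_subfield (range j)"
proof -
  have "1 \<in> range j" using structure_one by (intro range_eqI[of _ _ 1]) simp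
  then show ?thesis unfolding is_subfield_def by (auto simp flip: structure_mult j_diff j_inverse)
qed

lemma j_eq_0: "j x = 0 \<longleftrightarrow> x = 0"
proof
  assume "j x = 0"
  then have "j (x * inverse x) = 0" by (simp add: structure_mult)
  then show "x = 0" using structure_one by (cases "x = 0") auto
qed (simp add: j_zero)

text \<open>
  A basis of \<open>E(\<theta>)\<close> consists of the products of a basis of \<open>E\<close> with the powers of \<open>\<theta>\<close> below
  the degree.
\<close>

lemma dim_adjoin:
  assumes fin: "finite Bas" "vs.span Bas = UNIV"
    and E: "is_subfield E" "range j \<subseteq> E" and m: "minimal_poly E \<theta> m"
  shows "vs.dim (adjoin E \<theta>) = degree m * vs.dim E"
proof -
  obtain B where B: "B \<subseteq> E" "vs.independent B" "E \<subseteq> vs.span B" "card B = vs.dim E"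
    by (rule vs.basis_exists[of E])
  have "finite B" using vs.independent_span_bound[OF fin(1) B(2)] fin(2) by auto
  let ?I = "{..<degree m}"
  let ?f = "\<lambda>(\<beta>, i). \<beta> * \<theta> ^ i"
  have zero: "u \<beta> i = 0" if sum0: "(\<Sum>\<beta>\<in>B. \<Sum>i\<in>?I. j (u \<beta> i) * (\<beta> * \<theta> ^ i)) = 0" and "\<beta> \<in> B" "i \<in> ?I" for u \<beta> i
  proof -
    define p where "p = (\<Sum>i\<in>?I. monom (\<Sum>\<beta>\<in>B. j (u \<beta> i) * \<beta>) i)"
    have cE: "(\<Sum>\<beta>\<in>B. j (u \<beta> i) * \<beta>) \<in> E" for i using E B by (intro subfield_sum subfield_mult) auto
    have "p \<in> polys_over E" unfolding p_def using E cE by (intro polys_over_sum polys_over_monom)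
    moreover have "poly p \<theta> = 0"
      using sum0 by (subst (asm) sum.swap) (simp add: p_def poly_sum poly_monom sum_distrib_left sum_distrib_right mult_ac)
    moreover have "p = 0 \<or> degree p < degree m"
      unfolding p_def using minimal_poly_degree_pos[OF m]
      by (intro disjI2 degree_sum_less) (auto intro: le_less_trans[OF degree_monom_le])
    ultimately have "p = 0" using minimal_poly_degree_le[OF m] by force
    have "coeff p i = (\<Sum>\<beta>\<in>B. j (u \<beta> i) * \<beta>)"
      using \<open>i \<in> ?I\<close> by (simp add: p_def coeff_sum)
    then have "(\<Sum>\<beta>\<in>B. alg_scale j (u \<beta> i) \<beta>) = 0" using \<open>p = 0\<close> by (simp add: alg_scale_def)
    then show ?thesis using vs.independentD[OF B(2) \<open>finite B\<close> order_refl, of "\<lambda>\<beta>. u \<beta> i"] \<open>\<beta> \<in> B\<close> by simp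
  qed
  have inj: "inj_on ?f (B \<times> ?I)"
  proof (rule inj_onI, clarify)
    fix \<beta> i \<gamma> l assume *: "\<beta> \<in> B" "i < degree m" "\<gamma> \<in> B" "l < degree m" and eq: "\<beta> * \<theta> ^ i = \<gamma> * \<theta> ^ l"
    show "\<beta> = \<gamma> \<and> i = l"
    proof (rule ccontr)
      assume ne: "\<not> (\<beta> = \<gamma> \<and> i = l)"
      define u where "u = (\<lambda>b n. if b = \<beta> \<and> n = i then 1 else if b = \<gamma> \<and> n = l then - 1 else (0::'k))"
      have u: "j (u b n) * (b * \<theta> ^ n) = (if b = \<beta> then if n = i then \<beta> * \<theta> ^ i else 0 else 0)
          - (if b = \<gamma> then if n = l then \<gamma> * \<theta> ^ l else 0 else 0)" for b n
        using ne by (auto simp: u_def structure_one j_minus j_zero)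
      have "(\<Sum>b\<in>B. \<Sum>n\<in>?I. j (u b n) * (b * \<theta> ^ n)) = \<beta> * \<theta> ^ i - \<gamma> * \<theta> ^ l"
      proof -
        have "(\<Sum>n\<in>?I. (if b = \<beta> then if n = i then \<beta> * \<theta> ^ i else 0 else 0)) = (if b = \<beta> then \<beta> * \<theta> ^ i else 0)" for b
          using * by auto
        moreover have "(\<Sum>n\<in>?I. (if b = \<gamma> then if n = l then \<gamma> * \<theta> ^ l else 0 else 0)) = (if b = \<gamma> then \<gamma> * \<theta> ^ l else 0)" for b
          using * by auto
        ultimately show ?thesis unfolding u sum_subtractf using * \<open>finite B\<close> by simp
      qed
      then have "u \<beta> i = 0" using * eq by (intro zero[of u \<beta> i]) auto
      then show False by (simp add: u_def)
    qed
  qed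
  show ?thesis
  proof (rule vs.dim_unique)
    show "?f ` (B \<times> ?I) \<subseteq> adjoin E \<theta>"
    proof (clarify)
      fix \<beta> i assume "\<beta> \<in> B" 
      then have "monom \<beta> i \<in> polys_over E" using B E by (intro polys_over_monom) auto
      then show "\<beta> * \<theta> ^ i \<in> adjoin E \<theta>" unfolding adjoin_def by (rule rev_image_eqI) (simp add: poly_monom)
    qed
    show "card (?f ` (B \<times> ?I)) = degree m * vs.dim E"
      using inj by (simp add: card_image card_cartesian_product B(4) mult.commute)
    show "vs.independent (?f ` (B \<times> ?I))"
    proof (rule vs.independent_if_scalars_zero)
      fix v x assume sum: "(\<Sum>x\<in>?f ` (B \<times> ?I). alg_scale j (v x) x) = 0" and x: "x \<in> ?f ` (B \<times> ?I)"
      have "(\<Sum>\<beta>\<in>B. \<Sum>i\<in>?I. j (v (\<beta> * \<theta> ^ i)) * (\<beta> * \<theta> ^ i)) = 0"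
        using sum unfolding sum.reindex[OF inj] by (simp add: sum.cartesian_product alg_scale_def case_prod_unfold)
      then show "v x = 0" using x zero[of "\<lambda>\<beta> i. v (\<beta> * \<theta> ^ i)"] by auto
    qed (use \<open>finite B\<close> in simp)
    show "adjoin E \<theta> \<subseteq> vs.span (?f ` (B \<times> ?I))"
    proof
      fix x assume "x \<in> adjoin E \<theta>"
      then obtain p where p: "p \<in> polys_over E" "degree p < degree m" "poly p \<theta> = x"
        using adjoin_reduced[OF E(1) m] by blast
      have "coeff p i * \<theta> ^ i \<in> vs.span (?f ` (B \<times> ?I))" if "i \<le> degree p" for i
      proof -
        have "coeff p i \<in> vs.span B" using B(3) polys_over_coeff[OF p(1)] by blast
        then obtain u where "coeff p i = (\<Sum>\<beta>\<in>B. alg_scale j (u \<beta>) \<beta>)"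
          using vs.span_finite[OF \<open>finite B\<close>] by auto
        then have "coeff p i * \<theta> ^ i = (\<Sum>\<beta>\<in>B. alg_scale j (u \<beta>) (\<beta> * \<theta> ^ i))"
          by (simp add: sum_distrib_right sum_distrib_left alg_scale_def mult_ac)
        also have "\<dots> \<in> vs.span (?f ` (B \<times> ?I))"
          using that p(2) by (intro vs.span_sum vs.span_scale vs.span_base) force
        finally show ?thesis .
      qed
      then show "x \<in> vs.span (?f ` (B \<times> ?I))"
        unfolding p(3)[symmetric] poly_altdef by (intro vs.span_sum) auto
    qed
  qed
qed

lemma algebraic:
  assumes fin: "finite Bas" "vs.span Bas = UNIV" and E: "is_subfield E" "range j \<subseteq> E"
  shows "\<exists>m. minimal_poly E \<theta> m"
proof -
  have "\<exists>p\<in>polys_over E. p \<noteq> 0 \<and> poly p \<theta> = 0"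
  proof (cases "inj (\<lambda>i::nat. \<theta> ^ i)")
    case False
    then obtain a b :: nat where ab: "a \<noteq> b" "\<theta> ^ a = \<theta> ^ b" by (auto simp: inj_def)
    then have "coeff (monom 1 a - monom 1 b) a \<noteq> (0::'l)" by simp
    then have "monom 1 a - monom 1 b \<noteq> (0::'l poly)" by (metis coeff_0)
    moreover have "monom 1 a - monom 1 b \<in> polys_over E" using E by (intro polys_over_diff polys_over_monom subfield_one)
    ultimately show ?thesis using ab by (intro bexI[of _ "monom 1 a - monom 1 b"]) (auto simp: poly_monom)
  next
    case True
    have "infinite (range (\<lambda>i::nat. \<theta> ^ i))" using range_inj_infinite[OF True] .
    then have "vs.dependent (range (\<lambda>i::nat. \<theta> ^ i))"
      using vs.independent_span_bound[OF fin(1), of "range (\<lambda>i::nat. \<theta> ^ i)"] fin(2) by auto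
    then obtain S u where S: "finite S" "S \<subseteq> range (\<lambda>i::nat. \<theta> ^ i)" "(\<Sum>x\<in>S. alg_scale j (u x) x) = 0" "\<exists>x\<in>S. u x \<noteq> 0"
      unfolding vs.dependent_explicit by auto
    obtain I where I: "finite I" "S = (\<lambda>i. \<theta> ^ i) ` I" using finite_subset_image[OF S(1,2)] by auto
    define p where "p = (\<Sum>i\<in>I. monom (j (u (\<theta> ^ i))) i)"
    have "p \<in> polys_over E" unfolding p_def using E by (intro polys_over_sum polys_over_monom) auto
    moreover have "poly p \<theta> = 0"
    proof -
      have "inj_on (\<lambda>i. \<theta> ^ i) I" using True by (rule inj_on_subset) simp
      then have "(\<Sum>i\<in>I. j (u (\<theta> ^ i)) * \<theta> ^ i) = 0"
        using S(3) unfolding I(2) by (simp only: sum.reindex o_def alg_scale_def)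
      then show ?thesis by (simp add: p_def poly_sum poly_monom)
    qed
    moreover have "p \<noteq> 0"
    proof -
      obtain i where i: "i \<in> I" "u (\<theta> ^ i) \<noteq> 0" using S(4) I(2) by auto
      then have "coeff p i = j (u (\<theta> ^ i))" using I(1) by (simp add: p_def coeff_sum)
      then have "coeff p i \<noteq> 0" using i(2) by (simp only: j_eq_0 not_False_eq_True)
      then show ?thesis by (metis coeff_0)
    qed
    ultimately show ?thesis by blast
  qed
  then show ?thesis using minimal_poly_exists[OF E(1)] by blast
qed

lemma finite_if_odd:
  assumes "odd (alg_dim j)" obtains Bas where "finite Bas" "vs.span Bas = UNIV"
proof -
  obtain B where B: "B \<subseteq> UNIV" "vs.independent B" "UNIV \<subseteq> vs.span B" "card B = vs.dim UNIV"
    by (rule vs.basis_exists)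
  have "card B \<noteq> 0" using assms B(4) unfolding alg_dim_def by (metis even_zero)
  then have "finite B" using card_ge_0_finite[of B] by simp
  moreover have "vs.span B = UNIV" using B(3) by auto
  ultimately show ?thesis by (rule that)
qed

lemma subset_dim_less:
  assumes fin: "finite Bas" "vs.span Bas = UNIV"
    and E: "is_subfield E" "range j \<subseteq> E" and m: "minimal_poly E \<theta> m" and \<theta>: "\<theta> \<notin> E"
  shows "vs.dim E < vs.dim (adjoin E \<theta>)"
proof -
  have "vs.dim E \<noteq> 0"
  proof
    assume "vs.dim E = 0"
    moreover obtain B where "B \<subseteq> E" "vs.independent B" "E \<subseteq> vs.span B" "card B = vs.dim E"
      by (rule vs.basis_exists[of E])
    moreover have "finite B" using vs.independent_span_bound[OF fin(1) \<open>vs.independent B\<close>] fin(2) by auto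
    ultimately have "E \<subseteq> {0}" by auto
    then show False using subfield_one[OF E(1)] by auto
  qed
  moreover have "degree m \<noteq> 1"
  proof
    assume "degree m = 1"
    then obtain a b where ab: "m = [:a, b:]" "b \<noteq> 0" using degree1_coeffs by blast
    have "a + \<theta> * b = 0" using minimal_polyD(3)[OF m] unfolding ab(1) by simp
    then have "\<theta> * b = - a" by (simp add: add_eq_0_iff2)
    moreover have "a \<in> E" "b \<in> E"
      using polys_over_coeff[OF minimal_polyD(1)[OF m], of 0] polys_over_coeff[OF minimal_polyD(1)[OF m], of 1]
      unfolding ab(1) by simp_all
    ultimately have "\<theta> = - a / b" by (simp only: nonzero_eq_divide_eq[OF ab(2)])
    then show False using \<theta> subfield_divide[OF E(1) subfield_uminus[OF E(1) \<open>a \<in> E\<close>] \<open>b \<in> E\<close>] by simp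
  qed
  moreover obtain d where "degree m = Suc (Suc d)"
  proof -
    have "degree m = Suc (Suc (degree m - 2))" using minimal_poly_degree_pos[OF m] \<open>degree m \<noteq> 1\<close> by linarith
    then show ?thesis by (rule that)
  qed
  ultimately show ?thesis unfolding dim_adjoin[OF fin E m] by simp
qed

text \<open>
  Adjoin elements one by one; each step multiplies the dimension.
\<close>

lemma dim_dvd:
  assumes fin: "finite Bas" "vs.span Bas = UNIV"
  shows "is_subfield E \<Longrightarrow> range j \<subseteq> E \<Longrightarrow> vs.dim E dvd vs.dim UNIV"
proof (induction "vs.dim UNIV - vs.dim E" arbitrary: E rule: less_induct)
  case less
  show ?case
  proof (cases "E = UNIV")
    case False
    then obtain \<theta> where \<theta>: "\<theta> \<notin> E" by blast
    obtain m where m: "minimal_poly E \<theta> m" using algebraic[OF fin less.prems] by blast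
    have sub: "range j \<subseteq> adjoin E \<theta>" "is_subfield (adjoin E \<theta>)"
      using order_trans[OF less.prems(2) subset_adjoin[OF less.prems(1)]] is_subfield_adjoin[OF less.prems(1) m] .
    have "vs.dim (adjoin E \<theta>) \<le> vs.dim UNIV"
    proof -
      obtain B where B: "B \<subseteq> adjoin E \<theta>" "vs.independent B" "adjoin E \<theta> \<subseteq> vs.span B"
          "card B = vs.dim (adjoin E \<theta>)"
        by (rule vs.basis_exists)
      obtain B' where B': "B' \<subseteq> UNIV" "vs.independent B'" "UNIV \<subseteq> vs.span B'" "card B' = vs.dim UNIV"
        by (rule vs.basis_exists)
      have "finite B'" using vs.independent_span_bound[OF fin(1) B'(2)] fin(2) by auto
      from vs.independent_span_bound[OF this B(2)] B'(3) have "card B \<le> card B'" by auto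
      then show ?thesis using B(4) B'(4) by simp
    qed
    then have "vs.dim (adjoin E \<theta>) dvd vs.dim UNIV"
      using subset_dim_less[OF fin less.prems m \<theta>] by (intro less.hyps sub) linarith
    then show ?thesis unfolding dim_adjoin[OF fin less.prems m] by (rule dvd_mult_right)
  qed auto
qed

lemma odd_minimal_poly:
  assumes odd: "odd (alg_dim j)" and E: "is_subfield E" "range j \<subseteq> E"
  shows "\<exists>m. minimal_poly E \<theta> m" "minimal_poly E \<theta> m \<Longrightarrow> odd (degree m)"
proof -
  obtain Bas where fin: "finite Bas" "vs.span Bas = UNIV" using finite_if_odd[OF odd] .
  show "\<exists>m. minimal_poly E \<theta> m" using algebraic[OF fin E] .
  assume m: "minimal_poly E \<theta> m"
  have "vs.dim (adjoin E \<theta>) dvd vs.dim UNIV"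
    using order_trans[OF E(2) subset_adjoin[OF E(1)]] is_subfield_adjoin[OF E(1) m] by (intro dim_dvd[OF fin])
  then have "degree m dvd vs.dim UNIV" unfolding dim_adjoin[OF fin E m] by (rule dvd_mult_left)
  then show "odd (degree m)" using odd unfolding alg_dim_def by (metis dvd_trans)
qed

text \<open>
  Any extension of odd degree is reached from \<open>k\<close> by adjoining elements whose degrees divide the total degree, hence
  are odd.
\<close>

theorem odd_tower_induct:
  assumes odd: "odd (alg_dim j)" and base: "P (range j)"
    and step: "\<And>E \<theta> m. is_subfield E \<Longrightarrow> range j \<subseteq> E \<Longrightarrow> P E \<Longrightarrow> minimal_poly E \<theta> m \<Longrightarrow> odd (degree m) \<Longrightarrow>
      P (adjoin E \<theta>)"
  shows "P UNIV"
proof -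
  obtain Bas where fin: "finite Bas" "vs.span Bas = UNIV" using finite_if_odd[OF odd] .
  have pos: "vs.dim UNIV > 0" using odd unfolding alg_dim_def by (auto intro: Nat.gr0I)
  have "P UNIV" if "is_subfield E" "range j \<subseteq> E" "P E" for E
    using that
  proof (induction "vs.dim UNIV - vs.dim E" arbitrary: E rule: less_induct)
    case less
    show ?case
    proof (cases "E = UNIV")
      case False
      then obtain \<theta> where \<theta>: "\<theta> \<notin> E" by blast
      obtain m where m: "minimal_poly E \<theta> m" using odd_minimal_poly(1)[OF odd less.prems(1,2)] by blast
      note m = m odd_minimal_poly(2)[OF odd less.prems(1,2) m]
      have sub: "range j \<subseteq> adjoin E \<theta>" "is_subfield (adjoin E \<theta>)"
        using order_trans[OF less.prems(2) subset_adjoin[OF less.prems(1)]] is_subfield_adjoin[OF less.prems(1) m(1)] .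
      have "vs.dim (adjoin E \<theta>) \<le> vs.dim UNIV" using dim_dvd[OF fin sub(2,1)] pos by (rule dvd_imp_le)
      then have "vs.dim UNIV - vs.dim (adjoin E \<theta>) < vs.dim UNIV - vs.dim E"
        using subset_dim_less[OF fin less.prems(1,2) m(1) \<theta>] by linarith
      then show ?thesis by (rule less.hyps[OF _ sub(2,1) step[OF less.prems m]])
    qed (use less.prems(3) in simp)
  qed
  from this[OF is_subfield_range order_refl base] show ?thesis .
qed

end

section \<open>Tensor products\<close>

lemma lookup_free_scale: "Poly_Mapping.lookup (free_scale c f) p = c * Poly_Mapping.lookup f p"
  unfolding free_scale_def map.rep_eq by (cases "Poly_Mapping.lookup f p = 0") simp_all

lemma vector_space_free_scale: "vector_space (free_scale :: 'k::field \<Rightarrow> ('p \<Rightarrow>\<^sub>0 'k) \<Rightarrow> _)"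
  by unfold_locales
     (rule poly_mapping_eqI, simp only: lookup_free_scale lookup_add distrib_left distrib_right mult.assoc mult_1_left)+

context
  fixes scT :: "'k::field \<Rightarrow> 't::ab_group_add \<Rightarrow> 't"
  assumes T: "vector_space scT"
begin

interpretation vector_space scT by (rule T)

lemma free_lift_superset:
  assumes "finite S" "Poly_Mapping.keys f \<subseteq> S"
  shows "free_lift scT g f = (\<Sum>p\<in>S. scT (Poly_Mapping.lookup f p) (g p))"
  unfolding free_lift_def using assms by (intro sum.mono_neutral_left) (auto simp: in_keys_iff)

lemma free_lift_add: "free_lift scT g (f + f') = free_lift scT g f + free_lift scT g f'"
proof -
  let ?S = "Poly_Mapping.keys f \<union> Poly_Mapping.keys f'"
  have "Poly_Mapping.keys (f + f') \<subseteq> ?S" by (rule Poly_Mapping.keys_add)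
  then show ?thesis
    by (simp add: free_lift_superset[of ?S] lookup_add scale_left_distrib sum.distrib)
qed

lemma free_lift_scale: "free_lift scT g (free_scale c f) = scT c (free_lift scT g f)"
proof -
  have "Poly_Mapping.keys (free_scale c f) \<subseteq> Poly_Mapping.keys f"
    by (auto simp: in_keys_iff lookup_free_scale)
  then show ?thesis
    by (simp add: free_lift_superset[of "Poly_Mapping.keys f"] lookup_free_scale scale_sum_right)
qed

lemma free_lift_single: "free_lift scT g (Poly_Mapping.single p c) = scT c (g p)"
  by (simp add: free_lift_superset[of "{p}"])

lemma free_lift_diff: "free_lift scT g (f - f') = free_lift scT g f - free_lift scT g f'"
  using free_lift_add[of g "f - f'" f'] by simp

lemma free_lift_zero: "free_lift scT g 0 = 0"
  by (simp add: free_lift_def)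

lemma free_lift_relations:
  assumes "\<And>a a' b. g (a + a', b) = g (a, b) + g (a', b)" "\<And>a b b'. g (a, b + b') = g (a, b) + g (a, b')"
    and "\<And>c a b. g (scA c a, b) = scT c (g (a, b))" "\<And>c a b. g (a, scB c b) = scT c (g (a, b))"
    and f: "f \<in> tensor_relations scA scB"
  shows "free_lift scT g f = 0"
proof -
  interpret free: vector_space "free_scale :: 'k \<Rightarrow> (('a \<times> 'b) \<Rightarrow>\<^sub>0 'k) \<Rightarrow> _" by (rule vector_space_free_scale)
  show ?thesis using f unfolding tensor_relations_def
  proof (induction rule: free.span_induct_alt)
    case base
    show ?case by (rule free_lift_zero)
  next
    case (step c x y)
    have "free_lift scT g x = 0" using step(1) unfolding tensor_generators_def
      by (elim UnE CollectE exE conjE) (simp_all add: free_lift_diff free_lift_single assms(1-4))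
    then show ?case using step(2) by (simp add: free_lift_add free_lift_scale)
  qed
qed

end

lemma tensor_universal:
  assumes tens: "is_tensor_product scA scB scT \<tau>" and vs: "vector_space scU"
    and g: "\<And>a a' b. g (a + a') b = g a b + g a' b" "\<And>a b b'. g a (b + b') = g a b + g a b'"
      "\<And>c a b. g (scA c a) b = scU c (g a b)" "\<And>c a b. g a (scB c b) = scU c (g a b)"
  obtains L where "\<And>x y. L (x + y) = L x + L y" "\<And>a b. L (\<tau> a b) = g a b"
proof -
  interpret T: vector_space scT using tens by (simp add: is_tensor_product_def)
  interpret U: vector_space scU by (rule vs)
  let ?\<tau> = "\<lambda>(a, b). \<tau> a b" and ?g = "\<lambda>(a, b). g a b"
  have surj: "surj (free_lift scT ?\<tau>)" and ker: "{f. free_lift scT ?\<tau> f = 0} = tensor_relations scA scB"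
    using tens by (simp_all add: is_tensor_product_def)
  have vanish: "free_lift scU ?g f = 0" if "free_lift scT ?\<tau> f = 0" for f
  proof (rule free_lift_relations[OF vs])
    show "f \<in> tensor_relations scA scB" unfolding ker[symmetric] using that by simp
  qed (simp_all add: g)
  have wd: "free_lift scU ?g f = free_lift scU ?g f'" if "free_lift scT ?\<tau> f = free_lift scT ?\<tau> f'" for f f'
    using vanish[of "f - f'"] that by (simp add: free_lift_diff[OF T.vector_space_axioms] free_lift_diff[OF vs])
  define L where "L = (\<lambda>x. free_lift scU ?g (inv_into UNIV (free_lift scT ?\<tau>) x))"
  have L: "L (free_lift scT ?\<tau> f) = free_lift scU ?g f" for f
    unfolding L_def by (rule wd) (rule surj_f_inv_f[OF surj])
  have add: "L (x + y) = L x + L y" for x y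
  proof -
    obtain f f' where "x = free_lift scT ?\<tau> f" "y = free_lift scT ?\<tau> f'"
      using surjD[OF surj, of x] surjD[OF surj, of y] by (elim exE)
    then show ?thesis using L[of "f + f'"]
      by (simp add: free_lift_add[OF T.vector_space_axioms] free_lift_add[OF vs] L)
  qed
  have "L (\<tau> a b) = g a b" for a b
    using L[of "Poly_Mapping.single (a, b) 1"] U.scale_one
    by (simp add: free_lift_single[OF T.vector_space_axioms] free_lift_single[OF vs])
  with add show ?thesis by (rule that)
qed

lemma tensor_bilinear:
  assumes tens: "is_tensor_product scA scB scT \<tau>" and A: "vector_space scA" and B: "vector_space scB"
  shows "\<tau> (a + a') b = \<tau> a b + \<tau> a' b" "\<tau> a (b + b') = \<tau> a b + \<tau> a b'"
    "\<tau> (scA c a) b = scT c (\<tau> a b)" "\<tau> a (scB c b) = scT c (\<tau> a b)"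
proof -
  interpret T: vector_space scT using tens by (simp add: is_tensor_product_def)
  interpret free: vector_space "free_scale :: 'a \<Rightarrow> (('b \<times> 'c) \<Rightarrow>\<^sub>0 'a) \<Rightarrow> _" by (rule vector_space_free_scale)
  note lift = free_lift_diff[OF T.vector_space_axioms] free_lift_single[OF T.vector_space_axioms]
  have 0: "free_lift scT (\<lambda>(a, b). \<tau> a b) f = 0" if "f \<in> tensor_generators scA scB" for f
  proof -
    have "f \<in> tensor_relations scA scB" unfolding tensor_relations_def using that by (rule free.span_base)
    then have "f \<in> {f. free_lift scT (\<lambda>(a, b). \<tau> a b) f = 0}"
      using tens unfolding is_tensor_product_def by (elim conjE) (simp only:)
    then show ?thesis by simp
  qed
  have gen: "Poly_Mapping.single (a + a', b) 1 - Poly_Mapping.single (a, b) 1 - Poly_Mapping.single (a', b) 1 \<in> tensor_generators scA scB"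
    "Poly_Mapping.single (a, b + b') 1 - Poly_Mapping.single (a, b) 1 - Poly_Mapping.single (a, b') 1 \<in> tensor_generators scA scB"
    "Poly_Mapping.single (scA c a, b) 1 - Poly_Mapping.single (a, b) c \<in> tensor_generators scA scB"
    "Poly_Mapping.single (a, scB c b) 1 - Poly_Mapping.single (a, b) c \<in> tensor_generators scA scB"
    unfolding tensor_generators_def by blast+
  show "\<tau> (a + a') b = \<tau> a b + \<tau> a' b"
    using 0[OF gen(1)] unfolding lift by (simp add: diff_eq_eq add.commute)
  show "\<tau> a (b + b') = \<tau> a b + \<tau> a b'"
    using 0[OF gen(2)] unfolding lift by (simp add: diff_eq_eq add.commute)
  show "\<tau> (scA c a) b = scT c (\<tau> a b)"
    using 0[OF gen(3)] unfolding lift by simp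
  show "\<tau> a (scB c b) = scT c (\<tau> a b)"
    using 0[OF gen(4)] unfolding lift by simp
qed

text \<open>
  The scalars can be absorbed into the first factor, so sums of pure tensors suffice.
\<close>

lemma tensor_induct:
  assumes tens: "is_tensor_product scA scB scT \<tau>" and B: "vector_space scB"  "vector_space scA"
    and add: "\<And>x y. P x \<Longrightarrow> P y \<Longrightarrow> P (x + y)" and zero: "P 0" and pure: "\<And>a b. P (\<tau> a b)"
  shows "P x"
proof -
  interpret T: vector_space scT using tens by (simp add: is_tensor_product_def)
  obtain f where f: "x = free_lift scT (\<lambda>(a, b). \<tau> a b) f"
    using tens surjD[of "free_lift scT (\<lambda>(a, b). \<tau> a b)" x] unfolding is_tensor_product_def by (elim conjE) (auto)
  have "P (\<Sum>p\<in>S. scT (u p) (case p of (a, b) \<Rightarrow> \<tau> a b))" if "finite S" for S u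
    using that
  proof (induction S rule: finite_induct)
    case (insert p S)
    obtain a b where p: "p = (a, b)" by (cases p)
    have "scT (u p) (\<tau> a b) = \<tau> (scA (u p) a) b" using tensor_bilinear(3)[OF tens B(2,1)] by simp
    then show ?case using insert add pure p by simp
  qed (simp add: zero)
  then show ?thesis unfolding f free_lift_def by simp
qed

section \<open>Sesquilinear forms over a quaternion algebra\<close>

subsection \<open>Springer's theorem for spanning families\<close>

text \<open>
  The subfield \<open>F\<close> need not contain all scalars of the vector space. A spanning subfamily of least size is
  linearly independent over \<open>F\<close>.
\<close>

lemma (in vector_space) minimal_spanning_family:
  assumes F: "is_subfield F" and B: "finite B"
  obtains B0 a where "B0 \<subseteq> B" "\<forall>b\<in>B. \<forall>b'\<in>B0. a b b' \<in> F"
    "\<forall>b\<in>B. v b = (\<Sum>b'\<in>B0. scale (a b b') (v b'))"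
    "\<forall>x. (\<forall>b\<in>B0. x b \<in> F) \<longrightarrow> (\<Sum>b\<in>B0. scale (x b) (v b)) = 0 \<longrightarrow> (\<forall>b\<in>B0. x b = 0)"
proof -
  define sp where "sp = (\<lambda>C. C \<subseteq> B \<and> (\<exists>a. \<forall>b\<in>B. (\<forall>b'\<in>C. a b b' \<in> F) \<and> v b = (\<Sum>b'\<in>C. scale (a b b') (v b'))))"
  have "sp B"
    unfolding sp_def
  proof (intro conjI order_refl exI ballI)
    fix b b' assume "b \<in> B"
    show "(if b = b' then 1 else 0) \<in> F" using F by (simp add: subfield_intros)
    show "v b = (\<Sum>b'\<in>B. scale (if b = b' then 1 else 0) (v b'))"
      using B \<open>b \<in> B\<close> by (simp add: if_distrib[of "\<lambda>c. scale c _"] cong: if_cong)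
  qed
  then obtain C where C: "sp C" and least: "\<And>C'. sp C' \<Longrightarrow> card C \<le> card C'"
    using ex_has_least_nat[of sp B card] by blast
  from C obtain a where CB: "C \<subseteq> B" and a: "\<And>b b'. b \<in> B \<Longrightarrow> b' \<in> C \<Longrightarrow> a b b' \<in> F"
    "\<And>b. b \<in> B \<Longrightarrow> v b = (\<Sum>b'\<in>C. scale (a b b') (v b'))" unfolding sp_def by blast
  have finC: "finite C" using CB B finite_subset by blast
  have indep: "x c = 0" if x: "\<And>b. b \<in> C \<Longrightarrow> x b \<in> F" "(\<Sum>b\<in>C. scale (x b) (v b)) = 0" and c: "c \<in> C" for x c
  proof (rule ccontr)
    assume nz: "x c \<noteq> 0"
    let ?C = "C - {c}"
    have sum_c: "(\<Sum>b\<in>C. f b) = f c + (\<Sum>b\<in>?C. f b)" for f :: "_ \<Rightarrow> 'b"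
      using finC c by (rule sum.remove)
    have "scale (x c) (v c) = - (\<Sum>b\<in>?C. scale (x b) (v b))" using x(2) sum_c by (simp add: add_eq_0_iff2)
    then have "scale (1 / x c) (scale (x c) (v c)) = (\<Sum>b\<in>?C. scale (- x b / x c) (v b))"
      by (simp add: scale_sum_right sum_negf)
    then have vc: "v c = (\<Sum>b\<in>?C. scale (- x b / x c) (v b))" using nz by simp
    have "sp ?C" unfolding sp_def
    proof (intro conjI exI ballI)
      show "?C \<subseteq> B" using CB by auto
      fix b b' assume b: "b \<in> B"
      show "a b b' + a b c * (- x b' / x c) \<in> F" if "b' \<in> ?C"
        using that b c x(1) a(1) F by (intro subfield_intros) auto
      have "v b = scale (a b c) (v c) + (\<Sum>b'\<in>?C. scale (a b b') (v b'))"
        using a(2)[OF b] sum_c[of "\<lambda>b'. scale (a b b') (v b')"] by simp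
      also have "\<dots> = (\<Sum>b'\<in>?C. scale (a b b' + a b c * (- x b' / x c)) (v b'))"
        by (subst vc) (simp add: scale_sum_right scale_left_distrib scale_left_diff_distrib sum.distrib sum_subtractf sum_negf)
      finally show "v b = (\<Sum>b'\<in>?C. scale (a b b' + a b c * (- x b' / x c)) (v b'))" .
    qed
    then have "card C \<le> card ?C" by (rule least)
    then show False using finC c by (metis card_Diff1_less linorder_not_le)
  qed
  show thesis
  proof (rule that[of C a, OF CB])
    show "\<forall>b\<in>B. \<forall>b'\<in>C. a b b' \<in> F" by (intro ballI a(1))
    show "\<forall>b\<in>B. v b = (\<Sum>b'\<in>C. scale (a b b') (v b'))" by (intro ballI a(2))
    show "\<forall>x. (\<forall>b\<in>C. x b \<in> F) \<longrightarrow> (\<Sum>b\<in>C. scale (x b) (v b)) = 0 \<longrightarrow> (\<forall>b\<in>C. x b = 0)"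
      by (intro allI impI ballI) (rule indep, simp_all)
  qed
qed

text \<open>
  The vectors \<open>v b\<close> generate a vector space over \<open>F\<close> on which \<open>c / u\<close> is an \<open>F\<close>-valued bilinear form. Springer's
  theorem applies to its coordinates in an \<open>F\<close>-basis.
\<close>

lemma springer_family:
  fixes sc :: "'o::alg_closed_field \<Rightarrow> 'x::ab_group_add \<Rightarrow> 'x"
  assumes vs: "vector_space sc"
    and c_add: "\<And>x x' y. c (x + x') y = c x y + c x' y" "\<And>x y y'. c x (y + y') = c x y + c x y'"
    and c_scale: "\<And>f x y. c (sc f x) y = f * c x y" "\<And>f x y. c x (sc f y) = f * c x y"
    and F: "is_subfield F" and B: "finite B" and u: "u \<noteq> (0::'o)"
    and cF: "\<And>b b'. b \<in> B \<Longrightarrow> b' \<in> B \<Longrightarrow> c (v b) (v b') / u \<in> F"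
    and anis: "\<And>f. (\<And>b. b \<in> B \<Longrightarrow> f b \<in> F) \<Longrightarrow>
       c (\<Sum>b\<in>B. sc (f b) (v b)) (\<Sum>b\<in>B. sc (f b) (v b)) = 0 \<Longrightarrow> (\<Sum>b\<in>B. sc (f b) (v b)) = 0"
    and m: "minimal_poly F \<alpha> m" "odd (degree m)" and W: "\<And>b. b \<in> B \<Longrightarrow> W b \<in> polys_over F"
    and q: "c (\<Sum>b\<in>B. sc (poly (W b) \<alpha>) (v b)) (\<Sum>b\<in>B. sc (poly (W b) \<alpha>) (v b)) = 0"
  shows "(\<Sum>b\<in>B. sc (poly (W b) \<alpha>) (v b)) = 0"
proof -
  interpret vector_space sc by (rule vs)
  obtain B0 a where B0: "B0 \<subseteq> B" and a1: "\<forall>b\<in>B. \<forall>b'\<in>B0. a b b' \<in> F"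
    and a2: "\<forall>b\<in>B. v b = (\<Sum>b'\<in>B0. sc (a b b') (v b'))"
    and a3: "\<forall>x. (\<forall>b\<in>B0. x b \<in> F) \<longrightarrow> (\<Sum>b\<in>B0. sc (x b) (v b)) = 0 \<longrightarrow> (\<forall>b\<in>B0. x b = 0)"
    by (rule minimal_spanning_family[OF F B, of v])
  have a: "a b b' \<in> F" if "b \<in> B" "b' \<in> B0" for b b' using a1 that by simp
  have indep: "\<forall>b\<in>B0. x b = 0" if "\<And>b. b \<in> B0 \<Longrightarrow> x b \<in> F" "(\<Sum>b\<in>B0. sc (x b) (v b)) = 0" for x
    using spec[OF a3, of x] that by simp
  have fin: "finite B0" using B0 B finite_subset by blast
  have c_0: "c 0 y = 0" "c x 0 = 0" for x y using c_scale(1)[of 0 0 y] c_scale(2)[of x 0 0] by auto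
  have c_sum: "c (\<Sum>b\<in>C. sc (f b) (v b)) (\<Sum>b\<in>C. sc (f' b) (v b)) = (\<Sum>b\<in>C. \<Sum>b'\<in>C. f b * f' b' * c (v b) (v b'))"
    if "finite C" for C f f'
  proof -
    have "c (\<Sum>b\<in>C'. sc (f b) (v b)) y = (\<Sum>b\<in>C'. f b * c (v b) y)" if "finite C'" for C' y
      using that by (induction C' rule: finite_induct) (simp_all add: c_add c_scale c_0)
    moreover have "c y (\<Sum>b\<in>C'. sc (f' b) (v b)) = (\<Sum>b\<in>C'. f' b * c y (v b))" if "finite C'" for C' y
      using that by (induction C' rule: finite_induct) (simp_all add: c_add c_scale c_0)
    ultimately show ?thesis using that by (simp only: sum_distrib_left) (subst sum.swap, simp only: mult_ac)
  qed
  have reduce: "(\<Sum>b\<in>B. sc (f b) (v b)) = (\<Sum>b'\<in>B0. sc (\<Sum>b\<in>B. f b * a b b') (v b'))" for f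
  proof -
    have "(\<Sum>b\<in>B. sc (f b) (v b)) = (\<Sum>b\<in>B. \<Sum>b'\<in>B0. sc (f b * a b b') (v b'))"
    proof (intro sum.cong refl)
      fix b assume "b \<in> B"
      then have "v b = (\<Sum>b'\<in>B0. sc (a b b') (v b'))" using a2 by simp
      then have "sc (f b) (v b) = sc (f b) (\<Sum>b'\<in>B0. sc (a b b') (v b'))" by (rule arg_cong)
      then show "sc (f b) (v b) = (\<Sum>b'\<in>B0. sc (f b * a b b') (v b'))" by (simp only: scale_sum_right scale_scale)
    qed
    then show ?thesis by (subst (asm) sum.swap) (simp add: scale_sum_left)
  qed
  define V where "V = (\<lambda>b'. \<Sum>b\<in>B. smult (a b b') (W b))"
  have V: "V b' \<in> polys_over F" if "b' \<in> B0" for b'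
    unfolding V_def using that F a W by (intro polys_over_sum polys_over_smult) auto
  have polyV: "poly (V b') \<alpha> = (\<Sum>b\<in>B. poly (W b) \<alpha> * a b b')" for b'
    by (simp add: V_def poly_sum mult.commute)
  have "\<forall>b\<in>B0. poly (V b) \<alpha> = 0"
  proof (rule springer[where d = "\<lambda>b b'. c (v b) (v b') / u", OF F fin _ _ m V])
    show "c (v b) (v b') / u \<in> F" if "b \<in> B0" "b' \<in> B0" for b b' using that B0 by (intro cF) auto
    show "(\<Sum>b\<in>B0. \<Sum>b'\<in>B0. poly (V b) \<alpha> * poly (V b') \<alpha> * (c (v b) (v b') / u)) = 0"
      using q unfolding reduce polyV[symmetric] c_sum[OF fin]
      by (simp add: sum_divide_distrib[symmetric])
    fix x assume x: "\<And>b. b \<in> B0 \<Longrightarrow> x b \<in> F"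
      and 0: "(\<Sum>b\<in>B0. \<Sum>b'\<in>B0. x b * x b' * (c (v b) (v b') / u)) = 0"
    let ?f = "\<lambda>b. if b \<in> B0 then x b else 0"
    have eq: "(\<Sum>b\<in>B. sc (?f b) (v b)) = (\<Sum>b\<in>B0. sc (x b) (v b))"
      using B0 B by (intro sum.mono_neutral_cong_right) auto
    have "c (\<Sum>b\<in>B0. sc (x b) (v b)) (\<Sum>b\<in>B0. sc (x b) (v b)) = 0"
      using 0 u unfolding c_sum[OF fin] by (simp add: sum_divide_distrib[symmetric])
    then have z: "(\<Sum>b\<in>B0. sc (x b) (v b)) = 0"
      using anis[of ?f] x F unfolding eq by (auto simp: subfield_zero)
    show "\<forall>b\<in>B0. x b = 0" by (rule indep[of x]) (simp_all only: x z)
  qed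
  then show ?thesis unfolding reduce polyV[symmetric] by simp
qed

lemma (in conic_descent) is_subfield_F: "is_subfield F"
  unfolding is_subfield_def by (intro conjI ballI F_one F_diff F_mult F_inverse)

subsection \<open>The quadratic extension of a subfield\<close>

text \<open>
  The subfield \<open>E\<close> of a large field contains a copy of \<open>k\<close> under \<open>h\<close>, and \<open>\<zeta>, \<zeta>'\<close> are the images of \<open>i\<close> and its
  conjugate. Vectors of \<open>V\<close> have coordinates \<open>r v\<close> in the \<open>k\<close>-basis \<open>B\<close>, so that functions on \<open>B\<close> with values
  in \<open>E\<close> are the vectors of \<open>V \<otimes> E\<close>.
\<close>

locale conic_setup =
  quaternion_generators \<eta> i j T N b co + right_module act
  for \<eta> :: "'k::field \<Rightarrow> 'q::ring_1" and i j T N b co and act :: "'v::ab_group_add \<Rightarrow> 'q \<Rightarrow> 'v" +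
  fixes s :: "'v \<Rightarrow> 'v \<Rightarrow> 'q" and B :: "'v set" and r :: "'v \<Rightarrow> 'v \<Rightarrow> 'k"
    and h :: "'k \<Rightarrow> 'o::field" and E :: "'o set" and \<zeta> \<zeta>' t :: 'o
  assumes s_sesq: "s \<in> Sesq \<eta> act"
    and fin_B: "finite B"
    and r_expand: "v = (\<Sum>\<beta>\<in>B. act \<beta> (\<eta> (r v \<beta>)))"
    and r_add: "r (v + w) \<beta> = r v \<beta> + r w \<beta>"
    and r_scale: "r (act v (\<eta> c)) \<beta> = c * r v \<beta>"
    and r_basis: "\<beta> \<in> B \<Longrightarrow> \<beta>' \<in> B \<Longrightarrow> r \<beta> \<beta>' = (if \<beta> = \<beta>' then 1 else 0)"
    and h_add: "h (x + y) = h x + h y" and h_mult: "h (x * y) = h x * h y" and h_one: "h 1 = 1"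
    and E: "is_subfield E" and h_E: "h x \<in> E"
    and \<zeta>_sum: "\<zeta> + \<zeta>' = h T" and \<zeta>_prod: "\<zeta> * \<zeta>' = h N" and \<zeta>_E: "\<zeta> \<notin> E"
    and t_trans: "(\<And>n. \<exists>e\<in>E. \<exists>f\<in>E. coeff p n = e + f * \<zeta>) \<Longrightarrow> poly p t = 0 \<Longrightarrow> p = 0"
begin

lemma h_zero: "h 0 = 0"
proof -
  have "h 0 + h 0 = h 0 + 0" using h_add[of 0 0] by (simp only: add_0_right)
  then show ?thesis by (rule add_left_imp_eq)
qed
lemma h_minus: "h (- x) = - h x" using h_add[of x "- x"] by (simp add: h_zero add_eq_0_iff2)
lemma h_diff: "h (x - y) = h x - h y" using h_add[of x "- y"] by (simp add: h_minus)
lemma h_eq_0: "h x = 0 \<longleftrightarrow> x = 0"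
proof
  assume "h x = 0"
  then have "h (x * inverse x) = 0" by (simp add: h_mult)
  then show "x = 0" using h_one by (cases "x = 0") auto
qed (simp add: h_zero)
lemma h_sum: "h (sum f S) = (\<Sum>x\<in>S. h (f x))"
  by (induction S rule: infinite_finite_induct) (auto simp: h_zero h_add)

lemmas h_simps = h_zero h_minus h_diff h_add h_mult h_one

definition \<delta> where "\<delta> = \<zeta> - \<zeta>'"

lemma \<zeta>_sq: "\<zeta> * \<zeta> = h T * \<zeta> - h N" and \<zeta>'_sq: "\<zeta>' * \<zeta>' = h T * \<zeta>' - h N"
  by (simp_all flip: \<zeta>_sum \<zeta>_prod add: algebra_simps)

lemma \<delta>_sq: "\<delta> * \<delta> = h (T * T - 4 * N)"
proof -
  have "h 4 = 4" using h_add[of 2 2] h_add[of 1 1] by (simp add: h_one)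
  then show ?thesis by (simp add: \<delta>_def h_diff h_mult flip: \<zeta>_sum \<zeta>_prod) (simp add: algebra_simps)
qed

lemma \<delta>_nz: "\<delta> \<noteq> 0"
proof
  assume "\<delta> = 0"
  then have "h (T * T - 4 * N) = 0" using \<delta>_sq by simp
  then show False using disc_nz h_eq_0 by blast
qed

lemma E_indep: assumes "e \<in> E" "f \<in> E" "e + f * \<zeta> = 0" shows "e = 0 \<and> f = 0"
proof -
  have "f = 0"
  proof (rule ccontr)
    assume f: "f \<noteq> 0"
    then have "\<zeta> = - e / f" using assms(3) by (simp add: eq_divide_eq add_eq_0_iff2 mult.commute minus_equation_iff)
    then show False using \<zeta>_E assms subfield_divide[OF E subfield_uminus[OF E]] by blast
  qed
  then show ?thesis using assms by simp
qed

definition K where "K = {e + f * \<zeta> |e f. e \<in> E \<and> f \<in> E}"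
definition cj where "cj x = (THE y. \<exists>e\<in>E. \<exists>f\<in>E. x = e + f * \<zeta> \<and> y = e + f * \<zeta>')"

lemma cj_eq: assumes "e \<in> E" "f \<in> E" shows "cj (e + f * \<zeta>) = e + f * \<zeta>'"
  unfolding cj_def
proof (rule the_equality)
  show "\<exists>e'\<in>E. \<exists>f'\<in>E. e + f * \<zeta> = e' + f' * \<zeta> \<and> e + f * \<zeta>' = e' + f' * \<zeta>'" using assms by blast
  fix y assume "\<exists>e'\<in>E. \<exists>f'\<in>E. e + f * \<zeta> = e' + f' * \<zeta> \<and> y = e' + f' * \<zeta>'"
  then obtain e' f' where *: "e' \<in> E" "f' \<in> E" "e + f * \<zeta> = e' + f' * \<zeta>" "y = e' + f' * \<zeta>'" by blast
  then have "(e - e') + (f - f') * \<zeta> = 0" by (simp add: algebra_simps)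
  then have "e - e' = 0 \<and> f - f' = 0" using * assms by (intro E_indep subfield_diff[OF E])
  then show "y = e + f * \<zeta>'" using * by simp
qed

lemma cj_E: "e \<in> E \<Longrightarrow> cj e = e"
  using cj_eq[of e 0] subfield_zero[OF E] by simp

lemma K_cases: assumes "x \<in> K" obtains e f where "e \<in> E" "f \<in> E" "x = e + f * \<zeta>" "cj x = e + f * \<zeta>'"
  using assms cj_eq unfolding K_def by blast

lemma K_I: "e \<in> E \<Longrightarrow> f \<in> E \<Longrightarrow> e + f * \<zeta> \<in> K" unfolding K_def by blast

lemma E_K: "e \<in> E \<Longrightarrow> e \<in> K" using K_I[of e 0] subfield_zero[OF E] by simp

lemmas E_intros = subfield_intros[OF E] h_E

lemma \<zeta>_add_swap: "\<zeta>' = h T - \<zeta>" using \<zeta>_sum by (simp add: algebra_simps flip: \<zeta>_sum)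

lemma K_ring:
  assumes "x \<in> K" "y \<in> K"
  shows "x - y \<in> K" "x * y \<in> K" "cj (x - y) = cj x - cj y" "cj (x * y) = cj x * cj y" "cj x \<in> K" "cj (cj x) = x"
    "inverse x \<in> K"
proof -
  obtain e f where x: "e \<in> E" "f \<in> E" "x = e + f * \<zeta>" "cj x = e + f * \<zeta>'" using assms(1) by (rule K_cases)
  obtain e' f' where y: "e' \<in> E" "f' \<in> E" "y = e' + f' * \<zeta>" "cj y = e' + f' * \<zeta>'" using assms(2) by (rule K_cases)
  have eq: "x - y = (e - e') + (f - f') * \<zeta>" by (simp add: x y algebra_simps)
  show "x - y \<in> K" unfolding eq using x y by (intro K_I E_intros)
  have "cj (x - y) = (e - e') + (f - f') * \<zeta>'" unfolding eq using x y by (intro cj_eq E_intros)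
  then show "cj (x - y) = cj x - cj y" by (simp add: x(4) y(4) algebra_simps)
  have eq: "x * y = (e * e' - f * f' * h N) + (e * f' + f * e' + f * f' * h T) * \<zeta>"
  proof -
    have "x * y = e * e' + (e * f' + f * e') * \<zeta> + f * f' * (\<zeta> * \<zeta>)" by (simp add: x y algebra_simps)
    then show ?thesis unfolding \<zeta>_sq by (simp add: algebra_simps)
  qed
  show "x * y \<in> K" unfolding eq using x y by (intro K_I E_intros)
  have "cj (x * y) = (e * e' - f * f' * h N) + (e * f' + f * e' + f * f' * h T) * \<zeta>'"
    unfolding eq using x y by (intro cj_eq E_intros)
  also have "\<dots> = cj x * cj y"
  proof -
    have "cj x * cj y = e * e' + (e * f' + f * e') * \<zeta>' + f * f' * (\<zeta>' * \<zeta>')"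
      unfolding x(4) y(4) by (simp add: algebra_simps)
    then show ?thesis unfolding \<zeta>'_sq by (simp add: algebra_simps)
  qed
  finally show "cj (x * y) = cj x * cj y" .
  have cjx: "cj x = (e + f * h T) + (- f) * \<zeta>"
    unfolding x(4) by (simp add: algebra_simps flip: \<zeta>_sum)
  have "cj (cj x) = (e + f * h T) + (- f) * \<zeta>'" unfolding cjx using x by (intro cj_eq E_intros)
  also have "\<dots> = x" unfolding x(3) by (simp add: algebra_simps flip: \<zeta>_sum)
  finally show "cj (cj x) = x" .
  show cjK: "cj x \<in> K" unfolding cjx using x by (intro K_I E_intros)
  show "inverse x \<in> K"
  proof (cases "x = 0")
    case True then show ?thesis using E_K[OF subfield_zero[OF E]] by simp
  next
    case False
    have n: "x * cj x = e * e + e * f * h T + f * f * h N"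
      unfolding x(4) unfolding x(3) by (simp add: algebra_simps flip: \<zeta>_sum \<zeta>_prod)
    have "cj x \<noteq> 0"
    proof
      assume "cj x = 0"
      then have *: "e + f * h T = 0 \<and> - f = 0" using x unfolding cjx by (intro E_indep E_intros)
      have "f = 0" using * by simp
      have "e = 0" using conjunct1[OF *] unfolding \<open>f = 0\<close> by simp
      then show False using False x(3) \<open>f = 0\<close> by simp
    qed
    then have "inverse x = inverse (x * cj x) * cj x" using False by simp
    also have "\<dots> = inverse (x * cj x) * (e + f * h T) + (inverse (x * cj x) * - f) * \<zeta>"
      by (subst (2) cjx) (simp add: algebra_simps)
    also have "\<dots> \<in> K" unfolding n using x by (intro K_I E_intros)
    finally show ?thesis .
  qed
qed

lemma \<delta>_K: "\<delta> \<in> K" "cj \<delta> = - \<delta>"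
proof -
  have eq: "\<delta> = - h T + 2 * \<zeta>" by (simp add: \<delta>_def algebra_simps flip: \<zeta>_sum)
  have two: "2 \<in> E" using subfield_add[OF E subfield_one[OF E] subfield_one[OF E]] by simp
  show "\<delta> \<in> K" unfolding eq using two by (intro K_I E_intros)
  have "cj \<delta> = - h T + 2 * \<zeta>'" unfolding eq using two by (intro cj_eq E_intros)
  then show "cj \<delta> = - \<delta>" by (simp add: \<delta>_def algebra_simps flip: \<zeta>_sum)
qed

subsection \<open>Coordinate vectors\<close>

definition sc :: "'o \<Rightarrow> ('v \<Rightarrow> 'o) \<Rightarrow> 'v \<Rightarrow> 'o" where "sc f x = (\<lambda>\<beta>. f * x \<beta>)"

lemma vs_sc: "vector_space sc"
  by unfold_locales (auto simp: sc_def fun_eq_iff algebra_simps)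

sublocale X: vector_space sc by (rule vs_sc)

definition vec :: "'v \<Rightarrow> 'v \<Rightarrow> 'o" where "vec v = (\<lambda>\<beta>. if \<beta> \<in> B then h (r v \<beta>) else 0)"

lemma vec_add: "vec (v + w) = vec v + vec w"
  by (auto simp: vec_def fun_eq_iff r_add h_add)
lemma vec_scale: "vec (act v (\<eta> c)) = sc (h c) (vec v)"
  by (auto simp: vec_def sc_def fun_eq_iff r_scale h_mult)

lemma extend:
  assumes add: "\<And>v w. \<phi> (v + w) = \<phi> v + \<phi> w" and scale: "\<And>v c. \<phi> (act v (\<eta> c)) = sc (h c) (\<phi> v)"
  shows "\<phi> v = (\<Sum>\<beta>\<in>B. sc (h (r v \<beta>)) (\<phi> \<beta>))"
proof -
  have "\<phi> 0 + \<phi> 0 = \<phi> 0 + 0" using add[of 0 0] by (simp only: add_0_right)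
  then have 0: "\<phi> 0 = 0" by (rule add_left_imp_eq)
  have "\<phi> (sum f S) = (\<Sum>x\<in>S. \<phi> (f x))" if "finite S" for f and S :: "'v set"
    using that by (induction S rule: finite_induct) (auto simp: add 0)
  then have "\<phi> (\<Sum>\<beta>\<in>B. act \<beta> (\<eta> (r v \<beta>))) = (\<Sum>\<beta>\<in>B. sc (h (r v \<beta>)) (\<phi> \<beta>))"
    using fin_B by (simp add: scale)
  then show ?thesis using r_expand[of v] by simp
qed

text \<open>
  Right multiplication by \<open>x\<close> on \<open>V \<otimes> E\<close>, in coordinates.
\<close>

definition mat :: "'q \<Rightarrow> ('v \<Rightarrow> 'o) \<Rightarrow> 'v \<Rightarrow> 'o" where
  "mat x e = (\<lambda>\<beta>'. \<Sum>\<beta>\<in>B. e \<beta> * h (r (act \<beta> x) \<beta>'))"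

lemma mat_extend:
  assumes "\<And>v w. \<phi> (v + w) = \<phi> v + \<phi> w" "\<And>v c. \<phi> (act v (\<eta> c)) = sc (h c) (\<phi> v)"
  shows "(\<Sum>\<beta>\<in>B. sc (mat x e \<beta>) (\<phi> \<beta>)) = (\<Sum>\<beta>\<in>B. sc (e \<beta>) (\<phi> (act \<beta> x)))"
proof -
  have "(\<Sum>\<beta>\<in>B. sc (e \<beta>) (\<phi> (act \<beta> x))) = (\<Sum>\<beta>\<in>B. \<Sum>\<beta>'\<in>B. sc (e \<beta> * h (r (act \<beta> x) \<beta>')) (\<phi> \<beta>'))"
    by (subst extend[OF assms]) (simp add: X.scale_sum_right)
  then show ?thesis by (subst (asm) sum.swap) (simp add: mat_def X.scale_sum_left)
qed

lemma mat_E: "(\<And>\<beta>. \<beta> \<in> B \<Longrightarrow> e \<beta> \<in> E) \<Longrightarrow> mat x e \<beta>' \<in> E"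
  unfolding mat_def by (intro subfield_sum[OF E] E_intros)

lemma act_right_scale: "act v (\<eta> c * x) = act (act v x) (\<eta> c)"
  by (simp add: structure_central act_mult)

text \<open>
  Up to a factor, the projection of \<open>V \<otimes> E(\<zeta>)\<close> to the eigenspace where \<open>i\<close> acts as \<open>\<zeta>\<close>. This realizes \<open>V\<close>, as a
  vector space over \<open>K = k(i)\<close>, inside a space of coordinate vectors; right multiplication by \<open>j\<close> becomes semilinear.
\<close>

definition p :: "'v \<Rightarrow> 'v \<Rightarrow> 'o" where "p v = vec (act v i) - sc \<zeta>' (vec v)"

lemma p_add: "p (v + w) = p v + p w"
  by (simp add: p_def act_add_left vec_add X.scale_right_distrib)

lemma act_swap_scale: "act (act v (\<eta> c)) x = act (act v x) (\<eta> c)"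
  by (simp only: act_mult[symmetric] structure_central)

lemma p_scale: "p (act v (\<eta> c)) = sc (h c) (p v)"
  by (simp add: p_def act_swap_scale[of v c i] vec_scale X.scale_right_diff_distrib X.scale_left_commute)

lemma act_minus_right: "act v (- x) = - act v x"
  using act_add_right[of v x "- x"] act_add_right[of v 0 0] by (simp add: add_eq_0_iff2)

lemma act_diff_right: "act v (x - y) = act v x - act v y"
  using act_add_right[of v x "- y"] by (simp add: act_minus_right)

lemma vec_minus: "vec (- v) = - vec v"
  using vec_add[of v "- v"] vec_add[of 0 0] by (simp add: add_eq_0_iff2)

lemma vec_diff: "vec (v - w) = vec v - vec w"
  using vec_add[of v "- w"] by (simp add: vec_minus)

lemma p_i: "p (act v i) = sc \<zeta> (p v)"
proof -
  have "act (act v i) i = act (act v i) (\<eta> T) - act v (\<eta> N)"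
    by (simp only: act_mult[symmetric] i_sq act_diff_right structure_central)
  then have "vec (act (act v i) i) = sc (h T) (vec (act v i)) - sc (h N) (vec v)" by (simp add: vec_diff vec_scale)
  then show ?thesis
    unfolding p_def by (simp add: X.scale_right_diff_distrib \<zeta>_prod X.scale_left_diff_distrib[symmetric] flip: \<zeta>_sum)
qed

lemma p_ij: "p (act (act v i) j) = sc \<zeta>' (p (act v j))"
proof -
  have "act (act v i) j = act (act v j) (\<eta> T) - act (act v j) i"
    by (simp only: act_mult[symmetric] i_j right_diff_distrib act_diff_right)
  then have "p (act (act v i) j) + sc \<zeta> (p (act v j)) = sc (h T) (p (act v j))"
    using p_add[of "act (act v i) j" "act (act v j) i"] by (simp add: p_i p_scale)
  then show ?thesis by (simp add: \<zeta>_add_swap X.scale_left_diff_distrib eq_diff_eq)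
qed

lemma p_jj: "p (act (act v j) j) = sc (h b) (p v)"
  by (simp only: act_mult[symmetric] j_sq p_scale)


lemma s_add: "s (v + v') w = s v w + s v' w" "s v (w + w') = s v w + s v w'"
  and s_scale: "s (act v (\<eta> c)) w = \<eta> c * s v w" "s v (act w (\<eta> c)) = \<eta> c * s v w"
  and s_act: "s (act v x) (act w y) = canonical_involution \<eta> x * s v w * y"
  using s_sesq by (simp_all add: Sesq_def k_bilinear_def structure_central)

lemma conj_one: "canonical_involution \<eta> 1 = 1"
proof -
  have "(THE c. \<eta> c = 1) = 1"
    by (rule the_equality) (simp_all add: structure_one[symmetric] \<eta>_eq del: structure_one)
  moreover have "1 \<in> range \<eta>" using structure_one by (intro range_eqI[of _ _ 1]) simp
  ultimately show ?thesis by (simp add: canonical_involution_def reduced_trace_def \<eta>_two)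
qed

lemma s_act_left: "s (act v x) w = canonical_involution \<eta> x * s v w"
  using s_act[of v x w 1] by (simp add: act_one)

lemma s_act_right: "s v (act w y) = s v w * y"
  using s_act[of v 1 w y] by (simp add: act_one conj_one)

text \<open>
  The component of \<open>s\<close> in \<open>jK\<close>. Its companions \<open>chat_right_j\<close>, \<open>chat_left_j\<close> and \<open>chat_jj\<close> show that it knows the
  other component as well.
\<close>

definition chat :: "'v \<Rightarrow> 'v \<Rightarrow> 'o" where "chat v w = h (co (s v w) 2) + \<zeta> * h (co (s v w) 3)"

lemma chat_add: "chat (v + v') w = chat v w + chat v' w" "chat v (w + w') = chat v w + chat v w'"
  by (simp_all add: chat_def s_add co_add h_add algebra_simps)

lemma chat_scale: "chat (act v (\<eta> c)) w = h c * chat v w" "chat v (act w (\<eta> c)) = h c * chat v w"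
  by (simp_all add: chat_def s_scale co_scale h_mult algebra_simps)

lemma chat_i: "chat (act v i) w = \<zeta> * chat v w" "chat v (act w i) = \<zeta> * chat v w"
  by (simp_all add: chat_def s_act_left s_act_right conj_i co_times_i co_conj_i_times h_simps distrib_left
      mult.assoc[symmetric] \<zeta>_sq) (simp_all add: algebra_simps)

lemma chat_right_j: "chat v (act w j) = h (co (s v w) 0) + \<zeta>' * h (co (s v w) 1)"
  by (simp add: chat_def s_act_right co_times_j h_simps \<zeta>_add_swap algebra_simps)

lemma chat_left_j: "chat (act v j) w = - (h (co (s v w) 0) + \<zeta> * h (co (s v w) 1))"
  unfolding chat_def s_act_left conj_j co_minus_j_times h_simps by (simp add: algebra_simps)

lemma chat_jj: "chat (act v j) (act w j) = - h b * (h (co (s v w) 2) + \<zeta>' * h (co (s v w) 3))"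
proof -
  have "s (act v j) (act w j) = (- j * s v w) * j" by (simp add: s_act conj_j)
  then show ?thesis
    unfolding chat_def by (simp only: co_times_j co_minus_j_times h_simps \<zeta>_add_swap) (simp add: algebra_simps)
qed

text \<open>
  The extension of \<open>chat\<close> to coordinate vectors; \<open>cc_p\<close> shows that on the eigenspace it is still \<open>chat\<close>, up to
  the factor \<open>\<delta>\<^sup>2\<close>.
\<close>

definition cc :: "('v \<Rightarrow> 'o) \<Rightarrow> ('v \<Rightarrow> 'o) \<Rightarrow> 'o" where
  "cc x y = (\<Sum>\<beta>\<in>B. \<Sum>\<beta>'\<in>B. x \<beta> * y \<beta>' * chat \<beta> \<beta>')"

lemma cc_add: "cc (x + x') y = cc x y + cc x' y" "cc x (y + y') = cc x y + cc x y'"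
  by (simp_all add: cc_def distrib_left distrib_right sum.distrib)

lemma cc_scale: "cc (sc f x) y = f * cc x y" "cc x (sc f y) = f * cc x y"
  by (simp_all add: cc_def sc_def sum_distrib_left mult_ac)

lemma cc_zero: "cc 0 y = 0" "cc x 0 = 0"
  by (simp_all add: cc_def)

lemma cc_diff: "cc (x - x') y = cc x y - cc x' y" "cc x (y - y') = cc x y - cc x y'"
proof -
  show "cc (x - x') y = cc x y - cc x' y"
    using cc_add(1)[of "x - x'" x' y] unfolding diff_add_cancel by (simp only: add_diff_cancel_right')
  show "cc x (y - y') = cc x y - cc x y'"
    using cc_add(2)[of x "y - y'" y'] unfolding diff_add_cancel by (simp only: add_diff_cancel_right')
qed

lemma cc_sum:
  assumes "finite S"
  shows "cc (\<Sum>\<beta>\<in>S. sc (e \<beta>) (u \<beta>)) (\<Sum>\<beta>\<in>S. sc (f \<beta>) (w \<beta>)) = (\<Sum>\<beta>\<in>S. \<Sum>\<beta>'\<in>S. e \<beta> * f \<beta>' * cc (u \<beta>) (w \<beta>'))"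
proof -
  have 1: "cc (\<Sum>\<beta>\<in>S'. sc (e \<beta>) (u \<beta>)) y = (\<Sum>\<beta>\<in>S'. e \<beta> * cc (u \<beta>) y)" if "finite S'" for S' y
    using that by (induction S' rule: finite_induct) (simp_all only: sum.empty sum.insert not_False_eq_True cc_add cc_scale cc_zero)
  have 2: "cc y (\<Sum>\<beta>\<in>S'. sc (f \<beta>) (w \<beta>)) = (\<Sum>\<beta>\<in>S'. f \<beta> * cc y (w \<beta>))" if "finite S'" for S' y
    using that by (induction S' rule: finite_induct) (simp_all only: sum.empty sum.insert not_False_eq_True cc_add cc_scale cc_zero)
  show ?thesis unfolding 1[OF assms] 2[OF assms] sum_distrib_left by (subst sum.swap) (simp only: mult_ac)
qed

lemma vec_basis: "\<beta> \<in> B \<Longrightarrow> vec \<beta> = (\<lambda>\<beta>'. if \<beta>' = \<beta> then 1 else 0)"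
  by (auto simp: vec_def r_basis h_one h_zero fun_eq_iff)

lemma cc_vec_basis: "\<beta> \<in> B \<Longrightarrow> \<beta>' \<in> B \<Longrightarrow> cc (vec \<beta>) (vec \<beta>') = chat \<beta> \<beta>'"
  using fin_B by (simp add: cc_def vec_basis if_distrib[of "\<lambda>c. c * _"] if_distrib[of "\<lambda>c. _ * c"] cong: if_cong)

lemma chat_zero: "chat 0 w = 0" "chat v 0 = 0"
proof -
  have "chat 0 w + chat 0 w = chat 0 w + 0" "chat v 0 + chat v 0 = chat v 0 + 0"
    using chat_add(1)[of 0 0 w] chat_add(2)[of v 0 0] by (simp_all only: add_0_right)
  then show "chat 0 w = 0" "chat v 0 = 0" by (simp_all only: add_left_cancel)
qed

lemma cc_vec: "cc (vec v) (vec w) = chat v w"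
proof -
  have 1: "chat (\<Sum>\<beta>\<in>S. act \<beta> (\<eta> (f \<beta>))) w = (\<Sum>\<beta>\<in>S. h (f \<beta>) * chat \<beta> w)" if "finite S" for S f w
    using that by (induction S rule: finite_induct) (simp_all add: chat_add chat_scale chat_zero)
  have 2: "chat v (\<Sum>\<beta>\<in>S. act \<beta> (\<eta> (f \<beta>))) = (\<Sum>\<beta>\<in>S. h (f \<beta>) * chat v \<beta>)" if "finite S" for S f v
    using that by (induction S rule: finite_induct) (simp_all add: chat_add chat_scale chat_zero)
  have v: "vec v = (\<Sum>\<beta>\<in>B. sc (h (r v \<beta>)) (vec \<beta>))" for v
    by (rule extend[OF vec_add vec_scale])
  have "cc (vec v) (vec w) = (\<Sum>\<beta>\<in>B. \<Sum>\<beta>'\<in>B. h (r v \<beta>) * h (r w \<beta>') * chat \<beta> \<beta>')"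
    by (subst v[of v], subst v[of w], subst cc_sum[OF fin_B]) (simp add: cc_vec_basis)
  also have "\<dots> = chat (\<Sum>\<beta>\<in>B. act \<beta> (\<eta> (r v \<beta>))) (\<Sum>\<beta>\<in>B. act \<beta> (\<eta> (r w \<beta>)))"
    unfolding 1[OF fin_B] 2[OF fin_B] sum_distrib_left by (subst sum.swap) (simp only: mult_ac)
  finally show ?thesis by (simp only: r_expand[symmetric])
qed

lemma cc_p: "cc (p v) (p w) = \<delta> * \<delta> * chat v w"
  by (simp add: p_def cc_diff cc_scale cc_vec chat_i \<delta>_def algebra_simps)

text \<open>
  The coordinate of index \<open>n\<close> of \<open>s\<close> on \<open>V \<otimes> E\<close>. A vector is isotropic when the coordinates \<open>1\<close>, \<open>2\<close> and \<open>3\<close> vanish.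
\<close>

definition form :: "nat \<Rightarrow> ('v \<Rightarrow> 'o) \<Rightarrow> ('v \<Rightarrow> 'o) \<Rightarrow> 'o" where
  "form n x y = (\<Sum>\<beta>\<in>B. \<Sum>\<beta>'\<in>B. x \<beta> * y \<beta>' * h (co (s \<beta> \<beta>') n))"

definition P :: "('v \<Rightarrow> 'o) \<Rightarrow> 'v \<Rightarrow> 'o" where "P x = (\<Sum>\<beta>\<in>B. sc (x \<beta>) (p \<beta>))"
definition PJ :: "('v \<Rightarrow> 'o) \<Rightarrow> 'v \<Rightarrow> 'o" where "PJ x = (\<Sum>\<beta>\<in>B. sc (x \<beta>) (p (act \<beta> j)))"

lemma cc_P:
  "cc (P x) (P y) = \<delta> * \<delta> * (form 2 x y + \<zeta> * form 3 x y)"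
  "cc (P x) (PJ y) = \<delta> * \<delta> * (form 0 x y + \<zeta>' * form 1 x y)"
  "cc (PJ x) (P y) = - (\<delta> * \<delta> * (form 0 x y + \<zeta> * form 1 x y))"
  "cc (PJ x) (PJ y) = - h b * (\<delta> * \<delta> * (form 2 x y + \<zeta>' * form 3 x y))"
proof -
  note unf = P_def PJ_def cc_sum[OF fin_B] form_def cc_p
  note sums = sum_distrib_left algebra_simps sum.distrib sum_subtractf sum_negf
  show "cc (P x) (P y) = \<delta> * \<delta> * (form 2 x y + \<zeta> * form 3 x y)"
    unfolding unf chat_def by (simp add: sums)
  show "cc (P x) (PJ y) = \<delta> * \<delta> * (form 0 x y + \<zeta>' * form 1 x y)"
    unfolding unf chat_right_j by (simp add: sums)
  show "cc (PJ x) (P y) = - (\<delta> * \<delta> * (form 0 x y + \<zeta> * form 1 x y))"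
    unfolding unf chat_left_j by (simp add: sums)
  show "cc (PJ x) (PJ y) = - h b * (\<delta> * \<delta> * (form 2 x y + \<zeta>' * form 3 x y))"
    unfolding unf chat_jj by (simp add: sums)
qed

lemma form_E: "(\<And>\<beta>. \<beta> \<in> B \<Longrightarrow> x \<beta> \<in> E) \<Longrightarrow> (\<And>\<beta>. \<beta> \<in> B \<Longrightarrow> y \<beta> \<in> E) \<Longrightarrow> form n x y \<in> E"
  unfolding form_def by (intro subfield_sum[OF E] E_intros)

lemma P_add: "P (\<lambda>\<beta>. x \<beta> + y \<beta>) = P x + P y" "PJ (\<lambda>\<beta>. x \<beta> + y \<beta>) = PJ x + PJ y"
  by (simp_all add: P_def PJ_def X.scale_left_distrib sum.distrib)
lemma P_scale: "P (\<lambda>\<beta>. f * x \<beta>) = sc f (P x)" "PJ (\<lambda>\<beta>. f * x \<beta>) = sc f (PJ x)"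
  by (simp_all add: P_def PJ_def X.scale_sum_right)

lemma p_act_add: "p (act (v + w) x) = p (act v x) + p (act w x)"
  by (simp add: act_add_left p_add)
lemma p_act_scale: "p (act (act v (\<eta> c)) x) = sc (h c) (p (act v x))"
  by (simp only: act_swap_scale p_scale)

lemma P_mat: "P (mat x e) = (\<Sum>\<beta>\<in>B. sc (e \<beta>) (p (act \<beta> x)))"
  unfolding P_def by (rule mat_extend[OF p_add p_scale])
lemma PJ_mat: "PJ (mat x e) = (\<Sum>\<beta>\<in>B. sc (e \<beta>) (p (act (act \<beta> x) j)))"
  unfolding PJ_def by (rule mat_extend) (simp_all only: p_act_add p_act_scale)

lemma P_mat_i: "P (mat i e) = sc \<zeta> (P e)" "PJ (mat i e) = sc \<zeta>' (PJ e)"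
  unfolding P_mat PJ_mat by (simp_all add: p_i p_ij P_def PJ_def X.scale_sum_right mult.commute)

lemma P_mat_j: "P (mat j e) = PJ e" "PJ (mat j e) = sc (h b) (P e)"
  unfolding P_mat PJ_mat by (simp_all add: p_jj P_def PJ_def X.scale_sum_right mult.commute)

lemma sum_fun_apply: "(\<Sum>\<beta>\<in>S. f \<beta>) \<gamma> = (\<Sum>\<beta>\<in>S. f \<beta> \<gamma> :: 'o)"
  by (induction S rule: infinite_finite_induct) simp_all

lemma mat_mat: "\<beta>' \<in> B \<Longrightarrow> mat y (mat x e) \<beta>' = mat (x * y) e \<beta>'"
proof -
  assume \<beta>': "\<beta>' \<in> B"
  have "(\<Sum>\<beta>\<in>B. sc (mat x e \<beta>) (vec (act \<beta> y))) = (\<Sum>\<beta>\<in>B. sc (e \<beta>) (vec (act (act \<beta> x) y)))"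
    by (rule mat_extend) (simp_all only: act_add_left vec_add act_swap_scale vec_scale)
  from fun_cong[OF this, of \<beta>'] show ?thesis
    using \<beta>' by (simp add: sum_fun_apply sc_def vec_def mat_def[of y] mat_def[of "x * y"] act_mult)
qed

lemma mat_add: "mat (x + y) e \<beta>' = mat x e \<beta>' + mat y e \<beta>'"
  by (simp add: mat_def act_add_right r_add h_add distrib_left sum.distrib)

lemma mat_\<eta>: "mat (\<eta> c * x) e \<beta>' = h c * mat x e \<beta>'"
  by (simp add: mat_def act_right_scale r_scale h_mult sum_distrib_left mult_ac)

lemma mat_cong: "(\<And>\<beta>. \<beta> \<in> B \<Longrightarrow> e \<beta> = e' \<beta>) \<Longrightarrow> mat x e = mat x e'"
  by (simp add: mat_def fun_eq_iff)

lemma mat_scale: "mat x (\<lambda>\<beta>. f * e \<beta>) \<beta>' = f * mat x e \<beta>'"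
  by (simp add: mat_def sum_distrib_left mult_ac)

lemma mat_one: "\<beta> \<in> B \<Longrightarrow> mat 1 e \<beta> = e \<beta>"
  using fin_B by (simp add: mat_def act_one r_basis if_distrib[of h] h_one h_zero if_distrib[of "\<lambda>c. _ * c"] cong: if_cong)

lemma P_apply: "\<beta> \<in> B \<Longrightarrow> P e \<beta> = mat i e \<beta> - \<zeta>' * e \<beta>"
proof -
  assume \<beta>: "\<beta> \<in> B"
  have "P e \<beta> = (\<Sum>\<beta>'\<in>B. e \<beta>' * (vec (act \<beta>' i) \<beta> - \<zeta>' * vec \<beta>' \<beta>))"
    by (simp add: P_def sum_fun_apply sc_def p_def)
  also have "\<dots> = (\<Sum>\<beta>'\<in>B. e \<beta>' * vec (act \<beta>' i) \<beta>) - \<zeta>' * (\<Sum>\<beta>'\<in>B. e \<beta>' * vec \<beta>' \<beta>)"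
    by (simp add: right_diff_distrib sum_subtractf sum_distrib_left mult_ac)
  also have "(\<Sum>\<beta>'\<in>B. e \<beta>' * vec \<beta>' \<beta>) = mat 1 e \<beta>" using \<beta> by (simp add: mat_def vec_def act_one)
  also have "(\<Sum>\<beta>'\<in>B. e \<beta>' * vec (act \<beta>' i) \<beta>) = mat i e \<beta>" using \<beta> by (simp add: mat_def vec_def)
  finally show ?thesis using \<beta> by (simp add: mat_one)
qed

text \<open>
  If both projections vanish, then \<open>i\<close> acts on \<open>x\<close> and on \<open>xj\<close> as \<open>\<zeta>'\<close>. But \<open>i\<close> and its conjugate are exchanged
  by \<open>j\<close>, so this forces \<open>xj = 0\<close>.
\<close>

lemma P_PJ_inj:
  assumes "P x = 0" "PJ x = 0" "\<beta> \<in> B" shows "x \<beta> = 0"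
proof -
  have i: "mat i x \<beta> = \<zeta>' * x \<beta>" if "\<beta> \<in> B" for \<beta> using P_apply[OF that, of x] assms(1) by simp
  have ij: "mat i (mat j x) \<beta> = \<zeta>' * mat j x \<beta>" if "\<beta> \<in> B" for \<beta>
    using P_apply[OF that, of "mat j x"] assms(2) by (simp add: P_mat_j)
  have "mat j (mat i x) = mat j (\<lambda>\<beta>. \<zeta>' * x \<beta>)" by (rule mat_cong) (rule i)
  then have ji: "mat j (mat i x) \<beta> = \<zeta>' * mat j x \<beta>" for \<beta> by (simp add: mat_scale)
  have "j * i + i * j = \<eta> T * j" using i_j by (simp add: right_diff_distrib structure_central)
  have "mat j x \<beta> = 0" if "\<beta> \<in> B" for \<beta>
  proof -
    have "mat i (mat j x) \<beta> + mat j (mat i x) \<beta> = h T * mat j x \<beta>"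
      unfolding mat_mat[OF that] mat_add[symmetric] \<open>j * i + i * j = \<eta> T * j\<close> mat_\<eta> ..
    then have "(\<zeta>' + \<zeta>') * mat j x \<beta> = (\<zeta> + \<zeta>') * mat j x \<beta>"
      unfolding ij[OF that] ji \<zeta>_sum by (simp add: distrib_right)
    then have "\<delta> * mat j x \<beta> = 0" by (auto simp: \<delta>_def algebra_simps)
    then show ?thesis using \<delta>_nz by simp
  qed
  then have "mat j (mat j x) = mat j (\<lambda>\<beta>. 0)" by (intro mat_cong)
  then have "mat j (mat j x) \<beta> = 0" by (simp add: mat_def)
  moreover have "mat j (mat j x) \<beta> = h b * x \<beta>"
    unfolding mat_mat[OF assms(3)] j_sq using mat_\<eta>[of b 1 x \<beta>] mat_one[OF assms(3), of x] by simp
  ultimately show ?thesis using b_nz h_eq_0 by simp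
qed

text \<open>
  The graph of right multiplication by \<open>j\<close> on the \<open>E\<close>-rational vectors, seen in the eigenspace.
\<close>

definition GG :: "(('v \<Rightarrow> 'o) \<times> ('v \<Rightarrow> 'o)) set" where
  "GG = {(P e, PJ e) |e. \<forall>\<beta>\<in>B. e \<beta> \<in> E}"

lemma GG_I: "(\<And>\<beta>. \<beta> \<in> B \<Longrightarrow> e \<beta> \<in> E) \<Longrightarrow> (P e, PJ e) \<in> GG" unfolding GG_def by blast

lemma GG_cases:
  assumes "(x, y) \<in> GG" obtains e where "\<And>\<beta>. \<beta> \<in> B \<Longrightarrow> e \<beta> \<in> E" "x = P e" "y = PJ e"
  using assms unfolding GG_def by blast

lemma p_GG: "(p v, p (act v j)) \<in> GG"
proof -
  have "p v = P (\<lambda>\<beta>. h (r v \<beta>))" unfolding P_def by (rule extend[OF p_add p_scale])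
  moreover have "p (act v j) = PJ (\<lambda>\<beta>. h (r v \<beta>))"
    unfolding PJ_def by (rule extend[of "\<lambda>v. p (act v j)"]) (simp_all only: p_act_add p_act_scale)
  ultimately show ?thesis using GG_I[of "\<lambda>\<beta>. h (r v \<beta>)"] h_E by simp
qed

end

locale conic_anisotropic = conic_setup +
  assumes anis: "(\<And>\<beta>. \<beta> \<in> B \<Longrightarrow> e \<beta> \<in> E) \<Longrightarrow> form 1 e e = 0 \<Longrightarrow> form 2 e e = 0 \<Longrightarrow> form 3 e e = 0 \<Longrightarrow>
     \<beta> \<in> B \<Longrightarrow> e \<beta> = 0"
begin

sublocale des: conic_descent sc K cj "h b" \<delta> t GG cc
proof unfold_locales
  show "1 \<in> K" by (intro E_K E_intros)
  show "cj 1 = 1" by (intro cj_E E_intros)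
  show "h b \<in> K" by (intro E_K E_intros)
  show "cj (h b) = h b" by (intro cj_E E_intros)
  show "h b \<noteq> 0" using b_nz h_eq_0 by simp
  show "(0, 0) \<in> GG"
    using GG_I[of "\<lambda>\<beta>. 0"] subfield_zero[OF E] by (simp add: P_def PJ_def)
  show "q = 0" if "\<And>n. coeff q n \<in> K" "poly q t = 0" for q
  proof (rule t_trans[OF _ that(2)])
    fix n show "\<exists>e\<in>E. \<exists>f\<in>E. coeff q n = e + f * \<zeta>" using that(1)[of n] by (auto simp: K_def)
  qed
  fix x y x' y' \<kappa>
  show "(x + x', y + y') \<in> GG" if xy: "(x, y) \<in> GG" "(x', y') \<in> GG"
  proof -
    obtain e e' where "\<And>\<beta>. \<beta> \<in> B \<Longrightarrow> e \<beta> \<in> E" "x = P e" "y = PJ e"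
      "\<And>\<beta>. \<beta> \<in> B \<Longrightarrow> e' \<beta> \<in> E" "x' = P e'" "y' = PJ e'"
      using GG_cases[OF xy(1)] GG_cases[OF xy(2)] by metis
    then show ?thesis using GG_I[of "\<lambda>\<beta>. e \<beta> + e' \<beta>"] by (simp add: P_add E_intros)
  qed
  show "(sc \<kappa> x, sc (cj \<kappa>) y) \<in> GG" if xy: "(x, y) \<in> GG" and \<kappa>: "\<kappa> \<in> K"
  proof -
    obtain e where e: "\<And>\<beta>. \<beta> \<in> B \<Longrightarrow> e \<beta> \<in> E" "x = P e" "y = PJ e" using GG_cases[OF xy] by metis
    obtain a f where a: "a \<in> E" "f \<in> E" "\<kappa> = a + f * \<zeta>" "cj \<kappa> = a + f * \<zeta>'" using \<kappa> by (rule K_cases)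
    have "(P (\<lambda>\<beta>. a * e \<beta> + f * mat i e \<beta>), PJ (\<lambda>\<beta>. a * e \<beta> + f * mat i e \<beta>)) \<in> GG"
      using e(1) a by (intro GG_I E_intros mat_E)
    then show ?thesis
      unfolding a(4) unfolding a(3) e(2,3) P_add P_scale P_mat_i X.scale_left_distrib X.scale_scale .
  qed
  show "(y, sc (h b) x) \<in> GG" if xy: "(x, y) \<in> GG"
  proof -
    obtain e where e: "\<And>\<beta>. \<beta> \<in> B \<Longrightarrow> e \<beta> \<in> E" "x = P e" "y = PJ e" using GG_cases[OF xy] by metis
    have "(P (mat j e), PJ (mat j e)) \<in> GG" using e(1) by (intro GG_I mat_E)
    then show ?thesis by (simp add: P_mat_j e)
  qed
  have \<delta>2: "\<delta> * \<delta> \<in> E" by (simp only: \<delta>_sq h_E)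
  show "cc x x' \<in> K" if xy: "(x, y) \<in> GG" "(x', y') \<in> GG"
  proof -
    obtain e e' where e: "\<And>\<beta>. \<beta> \<in> B \<Longrightarrow> e \<beta> \<in> E" "x = P e" "\<And>\<beta>. \<beta> \<in> B \<Longrightarrow> e' \<beta> \<in> E" "x' = P e'"
      using GG_cases[OF xy(1)] GG_cases[OF xy(2)] by metis
    have "cc x x' = \<delta> * \<delta> * form 2 e e' + (\<delta> * \<delta> * form 3 e e') * \<zeta>"
      by (simp add: e cc_P algebra_simps)
    then show ?thesis using K_I[OF subfield_mult[OF E \<delta>2 form_E[OF e(1,3)]] subfield_mult[OF E \<delta>2 form_E[OF e(1,3)]]] by simp
  qed
  show "cc y y' = - h b * cj (cc x x')" if xy: "(x, y) \<in> GG" "(x', y') \<in> GG"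
  proof -
    obtain e e' where e: "\<And>\<beta>. \<beta> \<in> B \<Longrightarrow> e \<beta> \<in> E" "x = P e" "y = PJ e"
      "\<And>\<beta>. \<beta> \<in> B \<Longrightarrow> e' \<beta> \<in> E" "x' = P e'" "y' = PJ e'"
      using GG_cases[OF xy(1)] GG_cases[OF xy(2)] by metis
    have "cc x x' = \<delta> * \<delta> * form 2 e e' + (\<delta> * \<delta> * form 3 e e') * \<zeta>"
      by (simp add: e cc_P algebra_simps)
    moreover have "cj (\<delta> * \<delta> * form 2 e e' + (\<delta> * \<delta> * form 3 e e') * \<zeta>)
        = \<delta> * \<delta> * form 2 e e' + (\<delta> * \<delta> * form 3 e e') * \<zeta>'"
      using subfield_mult[OF E \<delta>2 form_E[OF e(1,4)]] by (intro cj_eq)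
    ultimately show ?thesis by (simp add: e cc_P algebra_simps)
  qed
  show "x = 0 \<and> y = 0" if xy: "(x, y) \<in> GG" and q: "cc x x = 0" "cc x y + cc y x = 0"
  proof -
    obtain e where e: "\<And>\<beta>. \<beta> \<in> B \<Longrightarrow> e \<beta> \<in> E" "x = P e" "y = PJ e" using GG_cases[OF xy] by metis
    have "form 2 e e + form 3 e e * \<zeta> = 0" using q(1) \<delta>_nz by (simp add: e cc_P mult.commute)
    then have "form 2 e e = 0 \<and> form 3 e e = 0" by (intro E_indep form_E e(1))
    moreover have "- (\<delta> * \<delta> * \<delta>) * form 1 e e = 0"
      using q(2) by (simp add: e cc_P \<delta>_def algebra_simps)
    then have "form 1 e e = 0" using \<delta>_nz by simp
    ultimately have "e \<beta> = 0" if "\<beta> \<in> B" for \<beta> using that by (intro anis[of e \<beta>] e(1)) simp_all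
    then show ?thesis by (simp add: e P_def PJ_def)
  qed
qed (simp_all only: K_ring \<delta>_K \<delta>_nz cc_add cc_scale not_False_eq_True)

lemma psi:
  "(\<Sum>\<beta>\<in>B. sc (x \<beta>) (des.g 0 (p \<beta>) (p (act \<beta> j)))) = P x + sc t (PJ x)"
  "(\<Sum>\<beta>\<in>B. sc (x \<beta>) (des.g 0 (p (act \<beta> i)) (p (act (act \<beta> i) j)))) = sc \<zeta> (P x) + sc (t * \<zeta>') (PJ x)"
  by (simp_all add: des.g_def p_i p_ij P_def PJ_def X.scale_right_distrib sum.distrib X.scale_sum_right mult_ac)

lemma psi_isotropic:
  assumes "form 1 x x = 0" "form 2 x x = 0" "form 3 x x = 0"
  shows "cc (sc f (P x) + sc f' (PJ x)) (sc f (P x) + sc f' (PJ x)) = 0"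
  by (simp only: cc_add cc_scale cc_P assms mult_zero_left mult_zero_right add_0_right minus_zero) (simp add: algebra_simps)

lemma psi_inj:
  assumes "P x + sc t (PJ x) = 0" "sc \<zeta> (P x) + sc (t * \<zeta>') (PJ x) = 0" "\<beta> \<in> B"
  shows "x \<beta> = 0"
proof -
  have eq: "P x = - sc t (PJ x)" using assms(1) by (simp add: add_eq_0_iff2)
  have "sc (t * \<zeta>' - t * \<zeta>) (PJ x) = 0"
    using assms(2) unfolding eq by (simp add: X.scale_left_diff_distrib mult.commute)
  moreover have "t * \<zeta>' - t * \<zeta> \<noteq> 0" using \<delta>_nz des.t_nz by (simp add: \<delta>_def)
  ultimately have "PJ x = 0" using X.scale_eq_0_iff by blast
  then show ?thesis using eq P_PJ_inj[OF _ _ assms(3)] by simp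
qed

text \<open>
  A vector \<open>x\<close> over \<open>F\<close> is sent to \<open>P x + t PJ x\<close>, and \<open>x i\<close> to \<open>\<zeta> P x + t \<zeta>' PJ x\<close>. If \<open>x\<close> is isotropic, so
  are both images for \<open>cc\<close>, hence both vanish by the descent, and together they determine \<open>x\<close>.
\<close>

theorem F_common_zero:
  assumes x: "\<And>\<beta>. \<beta> \<in> B \<Longrightarrow> x \<beta> \<in> des.F"
    and forms: "form 1 x x = 0" "form 2 x x = 0" "form 3 x x = 0" and \<beta>: "\<beta> \<in> B"
  shows "x \<beta> = 0"
proof (rule psi_inj[OF _ _ \<beta>])
  show "P x + sc t (PJ x) = 0"
    unfolding psi(1)[symmetric]
  proof (rule des.F_anisotropic[where B = B and x = p and y = "\<lambda>\<beta>. p (act \<beta> j)" and f = x])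
    show "cc (\<Sum>\<beta>\<in>B. sc (x \<beta>) (des.g 0 (p \<beta>) (p (act \<beta> j)))) (\<Sum>\<beta>\<in>B. sc (x \<beta>) (des.g 0 (p \<beta>) (p (act \<beta> j)))) = 0"
      unfolding psi using psi_isotropic[OF forms, of 1 t] by (simp only: X.scale_one)
  qed (simp_all only: fin_B p_GG x)
  show "sc \<zeta> (P x) + sc (t * \<zeta>') (PJ x) = 0"
    unfolding psi(2)[symmetric]
  proof (rule des.F_anisotropic[where B = B and x = "\<lambda>\<beta>. p (act \<beta> i)" and y = "\<lambda>\<beta>. p (act (act \<beta> i) j)" and f = x])
    show "cc (\<Sum>\<beta>\<in>B. sc (x \<beta>) (des.g 0 (p (act \<beta> i)) (p (act (act \<beta> i) j))))
      (\<Sum>\<beta>\<in>B. sc (x \<beta>) (des.g 0 (p (act \<beta> i)) (p (act (act \<beta> i) j)))) = 0"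
      unfolding psi by (rule psi_isotropic[OF forms])
  qed (simp_all only: fin_B p_GG x)
qed

end

text \<open>
  The argument of \<open>F_common_zero\<close> over the extension \<open>F(\<alpha>)\<close> of odd degree: there the two images are isotropic
  for an ordinary quadratic form over \<open>F\<close>, so that Springer's theorem applies.
\<close>

theorem odd_common_zero:
  fixes E :: "'o::alg_closed_field set" and \<eta> :: "'k::field \<Rightarrow> 'q::ring_1" and act :: "'v::ab_group_add \<Rightarrow> 'q \<Rightarrow> 'v"
  assumes "conic_anisotropic \<eta> i j T N b co act s B r h E \<zeta> \<zeta>' t"
  defines "FE \<equiv> conic_descent.F (conic_setup.K E \<zeta>) (conic_setup.cj E \<zeta> \<zeta>') (h b) t"
  assumes m: "minimal_poly FE \<alpha> m" "odd (degree m)" and W: "\<And>\<beta>. \<beta> \<in> B \<Longrightarrow> W \<beta> \<in> polys_over FE"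
    and forms: "\<And>n. n \<in> {1, 2, 3} \<Longrightarrow>
      (\<Sum>\<beta>\<in>B. \<Sum>\<beta>'\<in>B. poly (W \<beta>) \<alpha> * poly (W \<beta>') \<alpha> * h (co (s \<beta> \<beta>') n)) = 0"
    and \<beta>: "\<beta> \<in> B"
  shows "poly (W \<beta>) \<alpha> = 0"
proof -
  interpret conic_anisotropic \<eta> i j T N b co act s B r h E \<zeta> \<zeta>' t by (rule assms(1))
  let ?x = "\<lambda>\<beta>. poly (W \<beta>) \<alpha>"
  have F: "is_subfield des.F" by (rule des.is_subfield_F)
  have m': "minimal_poly des.F \<alpha> m" and W': "\<And>\<beta>. \<beta> \<in> B \<Longrightarrow> W \<beta> \<in> polys_over des.F"
    using m(1) W unfolding FE_def by simp_all
  have forms': "form 1 ?x ?x = 0" "form 2 ?x ?x = 0" "form 3 ?x ?x = 0"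
    unfolding form_def by (rule forms; simp)+
  have u: "t * \<delta> \<noteq> 0" using des.t_nz \<delta>_nz by simp
  have zero: "(\<Sum>\<beta>\<in>B. sc (?x \<beta>) (des.g 0 (p (\<phi> \<beta>)) (p (act (\<phi> \<beta>) j)))) = 0"
    if "cc (\<Sum>\<beta>\<in>B. sc (?x \<beta>) (des.g 0 (p (\<phi> \<beta>)) (p (act (\<phi> \<beta>) j))))
      (\<Sum>\<beta>\<in>B. sc (?x \<beta>) (des.g 0 (p (\<phi> \<beta>)) (p (act (\<phi> \<beta>) j)))) = 0" for \<phi>
  proof (rule springer_family[where c = cc and sc = sc and F = des.F and B = B and u = "t * \<delta>"
        and v = "\<lambda>\<beta>. des.g 0 (p (\<phi> \<beta>)) (p (act (\<phi> \<beta>) j))" and W = W and \<alpha> = \<alpha> and m = m])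
    fix f assume f: "\<And>\<beta>. \<beta> \<in> B \<Longrightarrow> f \<beta> \<in> des.F"
      and 0: "cc (\<Sum>\<beta>\<in>B. sc (f \<beta>) (des.g 0 (p (\<phi> \<beta>)) (p (act (\<phi> \<beta>) j))))
        (\<Sum>\<beta>\<in>B. sc (f \<beta>) (des.g 0 (p (\<phi> \<beta>)) (p (act (\<phi> \<beta>) j)))) = 0"
    show "(\<Sum>\<beta>\<in>B. sc (f \<beta>) (des.g 0 (p (\<phi> \<beta>)) (p (act (\<phi> \<beta>) j)))) = 0"
      by (rule des.F_anisotropic[where B = B and x = "\<lambda>\<beta>. p (\<phi> \<beta>)" and y = "\<lambda>\<beta>. p (act (\<phi> \<beta>) j)" and f = f,
            OF fin_B p_GG f 0])
  next
    show "cc (des.g 0 (p (\<phi> \<beta>)) (p (act (\<phi> \<beta>) j))) (des.g 0 (p (\<phi> \<beta>')) (p (act (\<phi> \<beta>') j))) / (t * \<delta>) \<in> des.F"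
      for \<beta> \<beta>' by (rule des.c_g0_F[OF p_GG p_GG])
  qed (simp_all only: vs_sc cc_add cc_scale F fin_B u m' m(2) W' that not_False_eq_True)
  show ?thesis
  proof (rule psi_inj[OF _ _ \<beta>])
    show "P ?x + sc t (PJ ?x) = 0"
      by (rule zero[of "\<lambda>\<beta>. \<beta>", unfolded psi, OF psi_isotropic[OF forms', of 1 t, unfolded X.scale_one]])
    show "sc \<zeta> (P ?x) + sc (t * \<zeta>') (PJ ?x) = 0"
      by (rule zero[of "\<lambda>\<beta>. act \<beta> i", unfolded psi, OF psi_isotropic[OF forms']])
  qed
qed

section \<open>The generic point of the Severi--Brauer conic\<close>

subsection \<open>Evaluation of polynomials\<close>

text \<open>
  Evaluation with coefficients mapped by \<open>h\<close>. The product runs over all variables, so that \<open>ev\<close> is visibly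
  multiplicative.
\<close>

definition ev :: "('k::field \<Rightarrow> 'a::comm_ring_1) \<Rightarrow> ('i::finite \<Rightarrow> 'a) \<Rightarrow> ('i, 'k) poly_in \<Rightarrow> 'a" where
  "ev h x f = (\<Sum>m\<in>Poly_Mapping.keys f. h (Poly_Mapping.lookup f m) * (\<Prod>i\<in>UNIV. x i ^ Poly_Mapping.lookup m i))"

lemma prod_keys:
  fixes x :: "'i::finite \<Rightarrow> 'a::comm_ring_1"
  shows "(\<Prod>i\<in>Poly_Mapping.keys m. x i ^ Poly_Mapping.lookup m i) = (\<Prod>i\<in>UNIV. x i ^ Poly_Mapping.lookup m i)"
  by (rule prod.mono_neutral_left) (auto simp: in_keys_iff)

lemma eval_poly_ev: "eval_poly f (x :: 'i::finite \<Rightarrow> _) = ev to_ac x f"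
  by (simp add: eval_poly_def ev_def prod_keys)

locale coefficient_hom =
  fixes h :: "'k::field \<Rightarrow> 'a::comm_ring_1"
  assumes h_add: "h (x + y) = h x + h y" and h_mult: "h (x * y) = h x * h y" and h_one: "h 1 = 1"
begin

lemma h_zero: "h 0 = 0"
proof -
  have "h 0 + h 0 = h 0 + 0" using h_add[of 0 0] by (simp only: add_0_right)
  then show ?thesis by (rule add_left_imp_eq)
qed

lemma ev_superset:
  fixes x :: "'i::finite \<Rightarrow> 'a"
  assumes "finite S" "Poly_Mapping.keys f \<subseteq> S"
  shows "ev h x f = (\<Sum>m\<in>S. h (Poly_Mapping.lookup f m) * (\<Prod>i\<in>UNIV. x i ^ Poly_Mapping.lookup m i))"
  unfolding ev_def using assms by (intro sum.mono_neutral_left) (auto simp: in_keys_iff h_zero)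

lemma ev_add: 
  fixes x :: "'i::finite \<Rightarrow> 'a"
  shows "ev h x (f + g) = ev h x f + ev h x g"
proof -
  let ?S = "Poly_Mapping.keys f \<union> Poly_Mapping.keys g"
  have "Poly_Mapping.keys (f + g) \<subseteq> ?S" by (rule Poly_Mapping.keys_add)
  then show ?thesis by (simp add: ev_superset[of ?S] lookup_add h_add distrib_right sum.distrib)
qed

lemma ev_zero: "ev h x 0 = 0"
  by (simp add: ev_def)

lemma ev_sum: "ev h x (sum f S) = (\<Sum>s\<in>S. ev h x (f s))"
  by (induction S rule: infinite_finite_induct) (simp_all add: ev_zero ev_add)

lemma ev_single:
  fixes x :: "'i::finite \<Rightarrow> 'a"
  shows "ev h x (Poly_Mapping.single m c) = h c * (\<Prod>i\<in>UNIV. x i ^ Poly_Mapping.lookup m i)"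
  by (simp add: ev_superset[of "{m}"])

lemma ev_mult:
  fixes x :: "'i::finite \<Rightarrow> 'a"
  shows "ev h x (f * g) = ev h x f * ev h x g"
proof -
  let ?s = "\<lambda>f m. Poly_Mapping.single m (Poly_Mapping.lookup f m)"
  have expand: "f = (\<Sum>m\<in>Poly_Mapping.keys f. ?s f m)" for f :: "('i, 'k) poly_in"
    by (rule poly_mapping_eqI) (simp add: lookup_sum lookup_single when_def in_keys_iff)
  have single: "ev h x (?s f m * ?s g n) = ev h x (?s f m) * ev h x (?s g n)" for m n
    by (simp add: mult_single ev_single h_mult lookup_add power_add prod.distrib mult_ac)
  have "f * g = (\<Sum>m\<in>Poly_Mapping.keys f. \<Sum>n\<in>Poly_Mapping.keys g. ?s f m * ?s g n)"
    by (subst expand[of f], subst expand[of g]) (simp only: sum_product)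
  then have "ev h x (f * g) = (\<Sum>m\<in>Poly_Mapping.keys f. \<Sum>n\<in>Poly_Mapping.keys g. ev h x (?s f m) * ev h x (?s g n))"
    by (simp only: ev_sum single)
  also have "\<dots> = ev h x (\<Sum>m\<in>Poly_Mapping.keys f. ?s f m) * ev h x (\<Sum>n\<in>Poly_Mapping.keys g. ?s g n)"
    by (simp only: ev_sum sum_product)
  finally show ?thesis by (simp only: expand[symmetric])
qed

lemma ev_one: "ev h (x :: 'i::finite \<Rightarrow> 'a) 1 = 1"
  using ev_single[of x 0 1] by (simp add: h_one)

end

lemma ev_homogeneous:
  fixes x :: "'i::finite \<Rightarrow> 'a::comm_ring_1"
  assumes "homogeneous d f" shows "ev h (\<lambda>i. c * x i) f = c ^ d * ev h x f"
proof -
  have "(\<Prod>i\<in>UNIV. (c * x i) ^ Poly_Mapping.lookup m i) = c ^ d * (\<Prod>i\<in>UNIV. x i ^ Poly_Mapping.lookup m i)"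
    if "m \<in> Poly_Mapping.keys f" for m
  proof -
    have "(\<Sum>i\<in>UNIV. Poly_Mapping.lookup m i) = (\<Sum>i\<in>Poly_Mapping.keys m. Poly_Mapping.lookup m i)"
      by (rule sum.mono_neutral_right) (auto simp: in_keys_iff)
    then have "(\<Sum>i\<in>UNIV. Poly_Mapping.lookup m i) = d" using assms that by (simp add: homogeneous_def)
    then show ?thesis by (simp add: power_mult_distrib prod.distrib power_sum[symmetric])
  qed
  then show ?thesis by (simp add: ev_def sum_distrib_left mult_ac)
qed

lemma ev_compose:
  fixes x :: "'i::finite \<Rightarrow> 'a::comm_ring_1" and \<phi> :: "'a \<Rightarrow> 'c::comm_ring_1"
  assumes "coefficient_hom h" and add: "\<And>x y. \<phi> (x + y) = \<phi> x + \<phi> y" and mult: "\<And>x y. \<phi> (x * y) = \<phi> x * \<phi> y"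
    and one: "\<phi> 1 = 1"
  shows "\<phi> (ev h x f) = ev (\<lambda>c. \<phi> (h c)) (\<lambda>i. \<phi> (x i)) f"
proof -
  have "\<phi> 0 + \<phi> 0 = \<phi> 0 + 0" using add[of 0 0] by (simp only: add_0_right)
  then have zero: "\<phi> 0 = 0" by (rule add_left_imp_eq)
  have sum: "\<phi> (sum f S) = (\<Sum>s\<in>S. \<phi> (f s))" for f and S :: "('i \<Rightarrow>\<^sub>0 nat) set"
    by (induction S rule: infinite_finite_induct) (simp_all add: zero add)
  have power: "\<phi> (a ^ n) = \<phi> a ^ n" for a n by (induction n) (simp_all add: one mult)
  have prod: "\<phi> (prod f S) = (\<Prod>s\<in>S. \<phi> (f s))" for f and S :: "'i set"
    by (induction S rule: infinite_finite_induct) (simp_all add: one mult)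
  show ?thesis by (simp add: ev_def sum mult prod power)
qed

lemma infinite_alg_closed: "infinite (UNIV :: 'a::alg_closed_field set)"
proof
  assume fin: "finite (UNIV :: 'a set)"
  let ?q = "\<Prod>c\<in>(UNIV :: 'a set). [:- c, 1:]"
  have "degree ?q = (\<Sum>c\<in>(UNIV :: 'a set). degree [:- c, 1:])"
    by (rule degree_prod_eq_sum_degree) simp
  then have "degree ?q = card (UNIV :: 'a set)" by simp
  moreover have "card (UNIV :: 'a set) > 0" using fin by (simp add: card_gt_0_iff)
  ultimately have "degree (?q + 1) > 0" by (simp add: degree_add_eq_left)
  then obtain z where "poly (?q + 1) z = 0" using alg_closed_imp_poly_has_root by blast
  moreover have "poly ?q z = 0" using fin by (simp add: poly_prod)
  ultimately show False by simp
qed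

text \<open>
  One exceptional point is allowed because a generic parameter misses one point of the projective line.
\<close>

lemma poly_zero_cofinite:
  assumes "\<And>z. z \<noteq> a \<Longrightarrow> poly p z = 0" shows "p = (0 :: 'a::alg_closed_field poly)"
proof (rule ccontr)
  assume "p \<noteq> 0"
  then have "finite {z. poly p z = 0}" by (rule poly_roots_finite)
  moreover have "UNIV \<subseteq> insert a {z. poly p z = 0}" using assms by auto
  ultimately show False using infinite_alg_closed by (meson finite_insert finite_subset)
qed

subsection \<open>The points of the conic\<close>

locale conic_points_setup = quaternion_generators \<eta> i j T N b co
  for \<eta> :: "'k::field \<Rightarrow> 'q::ring_1" and i j T N b co +
  fixes e :: "4 \<Rightarrow> 'q" and z z' :: "'k alg_closure"
  assumes e: "is_basis4 \<eta> e" and z_sum: "z + z' = to_ac T" and z_prod: "z * z' = to_ac N"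
begin

abbreviation C where "C \<equiv> (to_ac :: 'k \<Rightarrow> 'k alg_closure)"

interpretation vs: vector_space "alg_scale \<eta>" by (rule k_algebra_vector_space) unfold_locales

definition crd :: "'q \<Rightarrow> 4 \<Rightarrow> 'k" where "crd x m = vs.representation (range e) x (e m)"

lemma basis: "vs.independent (range e)" "vs.span (range e) = UNIV" "inj e"
  using e by (simp_all add: is_basis4_def)

lemma crd_add: "crd (x + y) m = crd x m + crd y m"
  using vs.representation_add[OF basis(1), of y x] basis(2) by (simp add: crd_def)
lemma crd_scale: "crd (\<eta> c * x) m = c * crd x m"
  using vs.representation_scale[OF basis(1), of x c] basis(2) by (simp add: crd_def alg_scale_def)
lemma crd_expand: "x = (\<Sum>m\<in>UNIV. \<eta> (crd x m) * e m)"
proof -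
  have "(\<Sum>v\<in>range e. alg_scale \<eta> (vs.representation (range e) x v) v) = x"
    using vs.sum_representation_eq[OF basis(1), of x "range e"] basis(2) by simp
  then show ?thesis using basis(3) by (simp add: sum.reindex crd_def alg_scale_def)
qed

definition vec4 :: "'q \<Rightarrow> 'k alg_closure ^ 4" where "vec4 x = (\<chi> m. C (crd x m))"

text \<open>
  Right multiplication by an element of \<open>Q\<close> on \<open>Q \<otimes> k\<^sup>a\<close>, where \<open>k\<^sup>a\<close> is the algebraic closure.
\<close>

definition R :: "'q \<Rightarrow> 'k alg_closure ^ 4 \<Rightarrow> 'k alg_closure ^ 4" where "R x u = closure_mult \<eta> e u (vec4 x)"

lemma crd_sum: "crd (sum f S) m = (\<Sum>s\<in>S. crd (f s) m)" if "finite S"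
  using that
proof (induction S rule: finite_induct)
  case empty
  show ?case using crd_scale[of 0 0 m] by (simp add: \<eta>_zero)
qed (simp add: crd_add)

lemma structure_const_crd: "structure_const \<eta> e m n l = crd (e m * e n) l"
  by (simp add: structure_const_def crd_def)

lemma crd_mult: "crd (x * y) l = (\<Sum>m\<in>UNIV. \<Sum>n\<in>UNIV. crd x m * crd y n * structure_const \<eta> e m n l)"
proof -
  have "x * y = (\<Sum>m\<in>UNIV. \<Sum>n\<in>UNIV. \<eta> (crd x m) * e m * (\<eta> (crd y n) * e n))"
    by (subst crd_expand[of x], subst crd_expand[of y]) (simp only: sum_product)
  also have "\<dots> = (\<Sum>m\<in>UNIV. \<Sum>n\<in>UNIV. \<eta> (crd x m) * (\<eta> (crd y n) * (e m * e n)))"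
    by (simp only: mult.assoc central_left[of "e _"])
  finally show ?thesis
    by (simp add: crd_sum crd_scale structure_const_crd mult.assoc)
qed

lemma R_vec4: "R x (vec4 y) = vec4 (y * x)"
  by (simp add: R_def vec4_def closure_mult_def vec_eq_iff crd_mult to_ac_sum)

lemma closure_mult_add: "closure_mult \<eta> e (u + v) w = closure_mult \<eta> e u w + closure_mult \<eta> e v w"
  "closure_mult \<eta> e u (w + w') = closure_mult \<eta> e u w + closure_mult \<eta> e u w'"
  by (simp_all add: closure_mult_def vec_eq_iff distrib_left distrib_right sum.distrib)
lemma closure_mult_scale: "closure_mult \<eta> e (c *s u) w = c *s closure_mult \<eta> e u w"
  "closure_mult \<eta> e u (c *s w) = c *s closure_mult \<eta> e u w"
  by (simp_all add: closure_mult_def vec_eq_iff sum_distrib_left mult_ac)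

lemma R_linear: "R x (u + v) = R x u + R x v" "R x (c *s u) = c *s R x u"
  by (simp_all add: R_def closure_mult_add closure_mult_scale)

lemma R_sum: "finite S \<Longrightarrow> R x (sum f S) = (\<Sum>s\<in>S. R x (f s))"
proof (induction S rule: finite_induct)
  case empty
  show ?case using R_linear(2)[of x 0 0] by simp
qed (simp add: R_linear)

lemma vec4_add: "vec4 (x + y) = vec4 x + vec4 y" and vec4_scale: "vec4 (\<eta> c * x) = C c *s vec4 x"
  by (simp_all add: vec4_def vec_eq_iff crd_add crd_scale)

lemma crd_basis: "crd (e m) n = (if m = n then 1 else 0)"
  using vs.representation_basis[OF basis(1), of "e m"] basis(3) by (auto simp: crd_def inj_def)

lemma vec4_expand: "u = (\<Sum>m\<in>UNIV. u $ m *s vec4 (e m))"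
  by (simp add: vec_eq_iff vec4_def crd_basis if_distrib[of C] if_distrib[of "\<lambda>c. _ * c"] cong: if_cong)

lemma R_R: "R x (R y u) = R (y * x) u"
proof -
  have "R x (R y (vec4 v)) = R (y * x) (vec4 v)" for v by (simp add: R_vec4 mult.assoc)
  then show ?thesis by (subst (1 2) vec4_expand[of u]) (simp add: R_sum R_linear)
qed

lemma R_add: "R (x + y) u = R x u + R y u" and R_scale: "R (\<eta> c * x) u = C c *s R x u"
  by (simp_all add: R_def vec4_add vec4_scale closure_mult_add closure_mult_scale)

lemma R_one: "R 1 u = u"
  by (subst (1 2) vec4_expand[of u]) (simp add: R_sum R_linear R_vec4)

lemma R_expand: "R x u = C (co x 0) *s u + C (co x 1) *s R i u + C (co x 2) *s R j u + C (co x 3) *s R i (R j u)"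
proof -
  have "x = \<eta> (co x 0) * 1 + \<eta> (co x 1) * i + \<eta> (co x 2) * j + \<eta> (co x 3) * (j * i)"
    using co_expand[of x] by (simp add: distrib_left pull[of j] add.assoc)
  then have "R x u = R (\<eta> (co x 0) * 1 + \<eta> (co x 1) * i + \<eta> (co x 2) * j + \<eta> (co x 3) * (j * i)) u" by simp
  then show ?thesis by (simp only: R_add R_scale R_one R_R)
qed

lemma right_ideal_iff:
  assumes J: "vec.subspace J"
  shows "(\<forall>u\<in>J. \<forall>w. closure_mult \<eta> e u w \<in> J) \<longleftrightarrow> (\<forall>u\<in>J. R i u \<in> J \<and> R j u \<in> J)"
proof (intro iffI ballI allI)
  fix u assume "\<forall>u\<in>J. \<forall>w. closure_mult \<eta> e u w \<in> J" "u \<in> J"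
  then show "R i u \<in> J \<and> R j u \<in> J" by (simp add: R_def)
next
  fix u w assume *: "\<forall>u\<in>J. R i u \<in> J \<and> R j u \<in> J" and u: "u \<in> J"
  have R: "R x u \<in> J" for x
    unfolding R_expand[of x] using * u by (intro vec.subspace_add[OF J] vec.subspace_scale[OF J]) simp_all
  have "closure_mult \<eta> e u (sum f S) = (\<Sum>s\<in>S. closure_mult \<eta> e u (f s))" if "finite S" for f and S :: "4 set"
    using that
  proof (induction S rule: finite_induct)
    case empty
    show ?case using closure_mult_scale(2)[of u 0 0] by simp
  qed (simp add: closure_mult_add)
  then have "closure_mult \<eta> e u w = (\<Sum>m\<in>UNIV. w $ m *s R (e m) u)"
    by (subst vec4_expand[of w]) (simp add: closure_mult_scale R_def)
  then show "closure_mult \<eta> e u w \<in> J"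
    using R by (auto intro!: vec.subspace_sum[OF J] vec.subspace_scale[OF J])
qed

definition d where "d = z - z'"

lemma d_nz: "d \<noteq> 0"
proof
  assume "d = 0"
  have "C (T * T - 4 * N) = C T * C T - 4 * C N" by simp
  also have "\<dots> = d * d" unfolding z_sum[symmetric] z_prod[symmetric] d_def by (simp add: algebra_simps)
  finally have "C (T * T - 4 * N) = 0" by (simp only: \<open>d = 0\<close> mult_zero_left)
  then have "T * T - 4 * N = 0" by (simp only: to_ac_eq_0_iff)
  then show False using disc_nz by (rule notE[rotated])
qed

text \<open>
  A basis of eigenvectors for right multiplication by \<open>i\<close>: the eigenvalue is \<open>z\<close> on \<open>E1\<close>, \<open>E3\<close> and \<open>z'\<close> on
  \<open>E2\<close>, \<open>E4\<close>. The products with \<open>j\<close> permute these lines (\<open>R_j_E\<close>).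
\<close>

definition E1 where "E1 = (1 / d) *s (vec4 i - z' *s vec4 1)"
definition E2 where "E2 = (1 / d) *s (z *s vec4 1 - vec4 i)"
definition E3 where "E3 = (1 / d) *s (vec4 (j * i) - z' *s vec4 j)"
definition E4 where "E4 = (1 / d) *s (z *s vec4 j - vec4 (j * i))"

lemmas E_defs = E1_def E2_def E3_def E4_def

lemma vec4_E: "vec4 1 = E1 + E2" "vec4 i = z *s E1 + z' *s E2" "vec4 j = E3 + E4" "vec4 (j * i) = z *s E3 + z' *s E4"
proof -
  define c where "c = 1 / d"
  have c: "c * ((z - z') * a) = a" for a using d_nz by (simp add: c_def d_def)
  have split: "c *s (y - z' *s x) + c *s (z *s x - y) = x"
    "z *s (c *s (y - z' *s x)) + z' *s (c *s (z *s x - y)) = y" for x y :: "'k alg_closure ^ 4"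
  proof -
    have "c * (b - z' * a) + c * (z * a - b) = c * ((z - z') * a)"
      "z * (c * (b - z' * a)) + z' * (c * (z * a - b)) = c * ((z - z') * b)" for a b
      by (simp_all add: algebra_simps)
    then show "c *s (y - z' *s x) + c *s (z *s x - y) = x"
      "z *s (c *s (y - z' *s x)) + z' *s (c *s (z *s x - y)) = y" by (simp_all add: vec_eq_iff c mult.assoc)
  qed
  show "vec4 1 = E1 + E2" "vec4 i = z *s E1 + z' *s E2" "vec4 j = E3 + E4" "vec4 (j * i) = z *s E3 + z' *s E4"
    unfolding E_defs c_def[symmetric] by (simp_all only: split)
qed

lemma R_diff: "R x (u - v) = R x u - R x v"
  using R_linear(1)[of x "u - v" v] by (simp add: eq_diff_eq)

lemma vec4_diff: "vec4 (x - y) = vec4 x - vec4 y"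
  using vec4_add[of "x - y" y] by (simp add: eq_diff_eq)

lemma R_i_E: "R i E1 = z *s E1" "R i E2 = z' *s E2" "R i E3 = z *s E3" "R i E4 = z' *s E4"
proof -
  have i2: "vec4 (i * i) = (z + z') *s vec4 i - (z * z') *s vec4 1"
    using vec4_scale[of N 1] by (simp add: i_sq vec4_diff vec4_scale z_sum z_prod)
  have "j * i * i = \<eta> T * (j * i) - \<eta> N * j"
    by (simp add: mult.assoc i_sq right_diff_distrib pull[of j])
  then have ji2: "vec4 (j * i * i) = (z + z') *s vec4 (j * i) - (z * z') *s vec4 j"
    by (simp add: vec4_diff vec4_scale z_sum z_prod)
  show "R i E1 = z *s E1" "R i E2 = z' *s E2" "R i E3 = z *s E3" "R i E4 = z' *s E4"
    unfolding E_defs R_linear R_diff R_vec4 i2 ji2 by (simp_all add: vec_eq_iff algebra_simps)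
qed

lemma R_j_E: "R j E1 = E4" "R j E2 = E3" "R j E3 = C b *s E2" "R j E4 = C b *s E1"
proof -
  have ij: "vec4 (i * j) = (z + z') *s vec4 j - vec4 (j * i)"
    by (simp add: i_j right_diff_distrib vec4_diff pull(1)[of j] vec4_scale z_sum)
  have jj: "vec4 (j * j) = C b *s vec4 1" using vec4_scale[of b 1] by (simp add: j_sq)
  have "j * i * j = \<eta> b * (\<eta> T * 1) - \<eta> b * i"
  proof -
    have "j * i * j = (j * j) * (\<eta> T - i)" by (simp only: mult.assoc i_j)
    then show ?thesis by (simp add: j_sq right_diff_distrib)
  qed
  then have jij: "vec4 (j * i * j) = C b *s ((z + z') *s vec4 1 - vec4 i)"
    by (simp only: vec4_diff vec4_scale z_sum) (simp add: vec_eq_iff algebra_simps)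
  show "R j E1 = E4" "R j E2 = E3" "R j E3 = C b *s E2" "R j E4 = C b *s E1"
    unfolding E_defs R_linear R_diff R_vec4 ij jj jij by (simp_all add: vec_eq_iff algebra_simps)
qed

text \<open>
  The right ideals of dimension \<open>2\<close> are spanned by \<open>U \<mu> \<nu>\<close> in the first eigenspace of \<open>i\<close> and its product \<open>W \<mu> \<nu>\<close> with
  \<open>j\<close>, which is in the second. This parametrizes the conic over the algebraic closure by a projective line.
\<close>

definition U where "U \<mu> \<nu> = \<mu> *s E1 + \<nu> *s E3"
definition W where "W \<mu> \<nu> = \<mu> *s E4 + (\<nu> * C b) *s E2"

lemma R_U_W: "R i (U \<mu> \<nu>) = z *s U \<mu> \<nu>" "R i (W \<mu> \<nu>) = z' *s W \<mu> \<nu>" "R j (U \<mu> \<nu>) = W \<mu> \<nu>" "R j (W \<mu> \<nu>) = C b *s U \<mu> \<nu>"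
  unfolding U_def W_def R_linear R_i_E R_j_E by (simp_all add: vec_eq_iff algebra_simps)

lemma E_span: "\<exists>p q r s. u = p *s E1 + q *s E4 + r *s E3 + s *s E2"
proof -
  have e: "vec4 x = (C (co x 0) + C (co x 1) * z) *s E1 + (C (co x 2) + C (co x 3) * z') *s E4
     + (C (co x 2) + C (co x 3) * z) *s E3 + (C (co x 0) + C (co x 1) * z') *s E2" for x
  proof -
    have "vec4 x = R x (vec4 1)" by (simp add: R_vec4)
    also note R_expand[of x "vec4 1"]
    finally show ?thesis unfolding vec4_E(1) R_linear R_i_E R_j_E by (simp add: vec_eq_iff algebra_simps)
  qed
  have "\<exists>p q r s. (\<Sum>m\<in>S. u $ m *s vec4 (e m)) = p *s E1 + q *s E4 + r *s E3 + s *s E2" if "finite S" for S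
    using that
  proof (induction S rule: finite_induct)
    case empty
    show ?case by (intro exI[of _ 0]) simp
  next
    case (insert m S)
    then obtain p q r s where IH: "(\<Sum>m\<in>S. u $ m *s vec4 (e m)) = p *s E1 + q *s E4 + r *s E3 + s *s E2" by blast
    obtain p' q' r' s' where m: "vec4 (e m) = p' *s E1 + q' *s E4 + r' *s E3 + s' *s E2" using e by blast
    have "(\<Sum>m\<in>insert m S. u $ m *s vec4 (e m)) = (u $ m * p' + p) *s E1 + (u $ m * q' + q) *s E4
        + (u $ m * r' + r) *s E3 + (u $ m * s' + s) *s E2"
      using insert.hyps by (simp add: IH m) (simp add: vec_eq_iff algebra_simps)
    then show ?case by blast
  qed
  from this[of UNIV] show ?thesis by (simp only: vec4_expand[symmetric] finite True_implies_equals)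
qed

lemma E_independent:
  assumes "p *s E1 + q *s E4 + r *s E3 + s *s E2 = 0" shows "p = 0 \<and> q = 0 \<and> r = 0 \<and> s = 0"
proof -
  define A where "A = (\<lambda>n u. \<Sum>m\<in>UNIV. u $ m * C (co (e m) n))"
  have A_lin: "A n (u + v) = A n u + A n v" "A n (c *s u) = c * A n u" "A n (u - v) = A n u - A n v" for n u v c
    by (simp_all add: A_def algebra_simps sum.distrib sum_subtractf sum_distrib_left)
  have co_sum: "co (sum f S) n = (\<Sum>s\<in>S. co (f s) n)" if "finite S" "n < 4" for f S n
    using that(1)
  proof (induction S rule: finite_induct)
    case empty
    show ?case using co_scale[OF that(2), of 0 0] by (simp add: \<eta>_zero)
  qed (simp add: co_add[OF that(2)])
  have A_vec4: "A n (vec4 x) = C (co x n)" if "n < 4" for n x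
  proof -
    have "co x n = (\<Sum>m\<in>UNIV. crd x m * co (e m) n)"
      by (subst crd_expand[of x]) (simp add: co_sum[OF _ that] co_scale[OF that])
    then show ?thesis by (simp add: A_def vec4_def to_ac_sum)
  qed
  have co1: "co 1 0 = 1" "co 1 1 = 0" "co 1 2 = 0" "co 1 3 = 0"
    using co_eq[of 1 1 0 0 0] by (simp_all add: \<eta>_zero structure_one)
  have coi: "co i 0 = 0" "co i 1 = 1" "co i 2 = 0" "co i 3 = 0"
    using co_eq[of i 0 1 0 0] by (simp_all add: \<eta>_zero structure_one)
  have coj: "co j 0 = 0" "co j 1 = 0" "co j 2 = 1" "co j 3 = 0"
    using co_eq[of j 0 0 1 0] by (simp_all add: \<eta>_zero structure_one)
  have coji: "co (j * i) 0 = 0" "co (j * i) 1 = 0" "co (j * i) 2 = 0" "co (j * i) 3 = 1"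
    using co_eq[of "j * i" 0 0 0 1] by (simp_all add: \<eta>_zero structure_one)
  define L where "L = p *s E1 + q *s E4 + r *s E3 + s *s E2"
  have 0: "A n L = 0" for n
    using A_lin(2)[of n 0 0] assms unfolding L_def by simp
  have "d * A 0 L = - p * z' + s * z" "d * A 1 L = p - s" "d * A 2 L = q * z - r * z'" "d * A 3 L = r - q"
    unfolding L_def E_defs A_lin using d_nz
    by (simp_all add: A_vec4 co1 coi coj coji field_simps del: One_nat_def)
  then have eqs: "s * z = p * z'" "p = s" "q * z = r * z'" "r = q" by (simp_all add: 0)
  then have "p * d = 0" "q * d = 0" by (simp_all add: d_def algebra_simps)
  then show ?thesis using d_nz eqs by simp
qed

lemma U_W_independent:
  assumes "\<mu> \<noteq> 0 \<or> \<nu> \<noteq> 0" "\<alpha> *s U \<mu> \<nu> + \<beta> *s W \<mu> \<nu> = 0" shows "\<alpha> = 0 \<and> \<beta> = 0"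
proof -
  have "(\<alpha> * \<mu>) *s E1 + (\<beta> * \<mu>) *s E4 + (\<alpha> * \<nu>) *s E3 + (\<beta> * (\<nu> * C b)) *s E2 = 0"
    using assms(2) unfolding U_def W_def by (simp add: vec_eq_iff algebra_simps)
  from E_independent[OF this] show ?thesis using assms(1) b_nz by auto
qed

lemma U_W_dim:
  assumes nz: "\<mu> \<noteq> 0 \<or> \<nu> \<noteq> 0"
  shows "U \<mu> \<nu> \<noteq> W \<mu> \<nu>" "vec.independent {U \<mu> \<nu>, W \<mu> \<nu>}"
proof -
  show ne: "U \<mu> \<nu> \<noteq> W \<mu> \<nu>"
  proof
    assume "U \<mu> \<nu> = W \<mu> \<nu>"
    then show False using U_W_independent[OF nz, of 1 "-1"] by simp
  qed
  show "vec.independent {U \<mu> \<nu>, W \<mu> \<nu>}"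
  proof (rule vec.independent_if_scalars_zero)
    fix f x assume 0: "(\<Sum>x\<in>{U \<mu> \<nu>, W \<mu> \<nu>}. f x *s x) = 0" and x: "x \<in> {U \<mu> \<nu>, W \<mu> \<nu>}"
    have "f (U \<mu> \<nu>) *s U \<mu> \<nu> + f (W \<mu> \<nu>) *s W \<mu> \<nu> = 0" using 0 ne by simp
    from U_W_independent[OF nz this] show "f x = 0" using x by auto
  qed simp
qed

lemma span_pair: "x \<in> vec.span {u, w} \<longleftrightarrow> (\<exists>\<alpha> \<beta>. x = \<alpha> *s u + \<beta> *s w)"
  unfolding vec.span_breakdown_eq[of x u] vec.span_singleton by (simp add: image_iff diff_eq_eq add.commute)

lemma U_W_ideal:
  assumes nz: "\<mu> \<noteq> 0 \<or> \<nu> \<noteq> 0" shows "conic_ideal \<eta> e (vec.span {U \<mu> \<nu>, W \<mu> \<nu>})"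
proof -
  let ?J = "vec.span {U \<mu> \<nu>, W \<mu> \<nu>}"
  have "vec.dim ?J = 2" using vec.dim_span_eq_card_independent[OF U_W_dim(2)[OF nz]] U_W_dim(1)[OF nz] by simp
  moreover have "R i u \<in> ?J \<and> R j u \<in> ?J" if uJ: "u \<in> ?J" for u
  proof -
    obtain \<alpha> \<beta> where u: "u = \<alpha> *s U \<mu> \<nu> + \<beta> *s W \<mu> \<nu>" using uJ unfolding span_pair by blast
    have "R i u = (\<alpha> * z) *s U \<mu> \<nu> + (\<beta> * z') *s W \<mu> \<nu>" "R j u = (\<beta> * C b) *s U \<mu> \<nu> + \<alpha> *s W \<mu> \<nu>"
      unfolding u R_linear R_U_W by (simp_all add: vec_eq_iff algebra_simps)
    then show ?thesis unfolding span_pair by blast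
  qed
  ultimately show ?thesis unfolding conic_ideal_def right_ideal_iff[OF vec.subspace_span] by (simp add: vec.subspace_span)
qed

text \<open>
  Projecting a nonzero element of \<open>J\<close>, or its product with \<open>j\<close>, to the first eigenspace of \<open>i\<close> gives a nonzero
  vector \<open>U \<mu> \<nu>\<close> of \<open>J\<close>; then \<open>W \<mu> \<nu>\<close> is in \<open>J\<close> too, and dimensions agree.
\<close>

lemma ideal_is_U_W:
  assumes J: "conic_ideal \<eta> e J" shows "\<exists>\<mu> \<nu>. (\<mu> \<noteq> 0 \<or> \<nu> \<noteq> 0) \<and> J = vec.span {U \<mu> \<nu>, W \<mu> \<nu>}"
proof -
  have sub: "vec.subspace J" and dim: "vec.dim J = 2" and cl: "\<forall>u\<in>J. \<forall>w. closure_mult \<eta> e u w \<in> J"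
    subgoal using J unfolding conic_ideal_def by (rule conjunct1)
    subgoal using J unfolding conic_ideal_def by (rule conjunct1[OF conjunct2])
    subgoal using J unfolding conic_ideal_def by (rule conjunct2[OF conjunct2])
    done
  have R: "R i u \<in> J" "R j u \<in> J" if "u \<in> J" for u
    using cl that unfolding right_ideal_iff[OF sub] by simp_all
  have "\<not> J \<subseteq> {0}" using dim vec.dim_eq_0[of J] by simp
  then obtain u where u: "u \<in> J" "u \<noteq> 0" by auto
  obtain p q r s where pq: "u = p *s E1 + q *s E4 + r *s E3 + s *s E2" using E_span by blast
  have step: "U p r \<in> J \<and> W p r \<in> J" if "u \<in> J" "u = p *s E1 + q *s E4 + r *s E3 + s *s E2" for u p q r s
  proof -
    define c where "c = 1 / d"
    have c: "c * (z * a - z' * a) = a" for a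
      using d_nz by (simp add: c_def left_diff_distrib[symmetric] flip: d_def)
    have "c *s (R i u + (- z') *s u) = (c * (z * p - z' * p)) *s E1 + (c * (z * r - z' * r)) *s E3"
      unfolding that(2) R_linear R_i_E by (simp add: vec_eq_iff algebra_simps)
    then have "U p r = c *s (R i u + (- z') *s u)" unfolding c U_def ..
    then have "U p r \<in> J"
      using that(1) R by (simp only: vec.subspace_add[OF sub] vec.subspace_scale[OF sub])
    then show ?thesis using R(2)[of "U p r"] by (simp add: R_U_W)
  qed
  have Rju: "R j u = (q * C b) *s E1 + p *s E4 + s *s E3 + (r * C b) *s E2"
    unfolding pq R_linear R_j_E by (simp add: vec_eq_iff algebra_simps)
  have UW: "U p r \<in> J \<and> W p r \<in> J" by (rule step[OF u(1) pq])
  have UW': "U (q * C b) s \<in> J \<and> W (q * C b) s \<in> J" by (rule step[OF R(2)[OF u(1)] Rju])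
  have "\<exists>\<mu> \<nu>. (\<mu> \<noteq> 0 \<or> \<nu> \<noteq> 0) \<and> U \<mu> \<nu> \<in> J \<and> W \<mu> \<nu> \<in> J"
  proof (cases "p \<noteq> 0 \<or> r \<noteq> 0")
    case False
    then have "q \<noteq> 0 \<or> s \<noteq> 0" using u(2) pq by auto
    then have "q * C b \<noteq> 0 \<or> s \<noteq> 0" using b_nz by simp
    with UW' show ?thesis by (intro exI[of _ "q * C b"] exI[of _ s] conjI) simp_all
  next
    case True
    with UW show ?thesis by (intro exI[of _ p] exI[of _ r] conjI) simp_all
  qed
  then obtain \<mu> \<nu> where nz: "\<mu> \<noteq> 0 \<or> \<nu> \<noteq> 0" and in_J: "U \<mu> \<nu> \<in> J" "W \<mu> \<nu> \<in> J" by blast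
  have "vec.span {U \<mu> \<nu>, W \<mu> \<nu>} \<subseteq> J" using in_J by (intro vec.span_minimal sub) auto
  moreover have "vec.dim (vec.span {U \<mu> \<nu>, W \<mu> \<nu>}) = 2" using U_W_ideal[OF nz] by (simp add: conic_ideal_def)
  ultimately have "vec.span {U \<mu> \<nu>, W \<mu> \<nu>} = J"
    using dim by (intro vec.subspace_dim_equal vec.subspace_span sub) simp_all
  with nz show ?thesis by (intro exI[of _ \<mu>] exI[of _ \<nu>] conjI) simp_all
qed

lemma pluecker_U_W_point: "\<mu> \<noteq> 0 \<or> \<nu> \<noteq> 0 \<Longrightarrow> pluecker (U \<mu> \<nu>) (W \<mu> \<nu>) \<in> conic_points \<eta> e"
  unfolding conic_points_def using U_W_ideal by blast

lemma conic_point_cases: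
  assumes "x \<in> conic_points \<eta> e"
  obtains c \<mu> \<nu> where "\<mu> \<noteq> 0 \<or> \<nu> \<noteq> 0" "x = (\<lambda>m. c * pluecker (U \<mu> \<nu>) (W \<mu> \<nu>) m)"
proof -
  obtain u w J where x: "x = pluecker u w" and J: "conic_ideal \<eta> e J" and span: "vec.span {u, w} = J"
    using assms unfolding conic_points_def by blast
  obtain \<mu> \<nu> where nz: "\<mu> \<noteq> 0 \<or> \<nu> \<noteq> 0" and JU: "J = vec.span {U \<mu> \<nu>, W \<mu> \<nu>}" using ideal_is_U_W[OF J] by blast
  have "u \<in> J" "w \<in> J" unfolding span[symmetric] by (simp_all add: vec.span_base)
  then obtain \<alpha> \<beta> \<gamma> \<epsilon> where "u = \<alpha> *s U \<mu> \<nu> + \<beta> *s W \<mu> \<nu>" "w = \<gamma> *s U \<mu> \<nu> + \<epsilon> *s W \<mu> \<nu>"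
    unfolding JU span_pair by (elim exE)
  then have "x = (\<lambda>m. (\<alpha> * \<epsilon> - \<beta> * \<gamma>) * pluecker (U \<mu> \<nu>) (W \<mu> \<nu>) m)"
    unfolding x by (auto simp: fun_eq_iff pluecker_def algebra_simps)
  with nz show ?thesis by (rule that)
qed

text \<open>
  The Pluecker coordinates of the ideal with parameter \<open>(1, \<sigma>)\<close>, as polynomials in \<open>\<sigma>\<close>. In \<open>DP'\<close> the parameter is
  \<open>(\<sigma>, 1)\<close>; this chart contains the point \<open>(0, 1)\<close> missed by the first.
\<close>

definition DP :: "4 \<times> 4 \<Rightarrow> 'k alg_closure poly" where
  "DP = (\<lambda>(m, n). [:E1 $ m, E3 $ m:] * [:E4 $ n, C b * E2 $ n:] - [:E1 $ n, E3 $ n:] * [:E4 $ m, C b * E2 $ m:])"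
definition DP' :: "4 \<times> 4 \<Rightarrow> 'k alg_closure poly" where
  "DP' = (\<lambda>(m, n). [:E3 $ m, E1 $ m:] * [:C b * E2 $ n, E4 $ n:] - [:E3 $ n, E1 $ n:] * [:C b * E2 $ m, E4 $ m:])"

lemma poly_DP: "poly (DP m) \<sigma> = pluecker (U 1 \<sigma>) (W 1 \<sigma>) m" "poly (DP' m) \<sigma> = pluecker (U \<sigma> 1) (W \<sigma> 1) m"
  by (cases m; simp add: DP_def DP'_def pluecker_def U_def W_def algebra_simps)+

lemma pluecker_scale: "pluecker (U (c * \<mu>) (c * \<nu>)) (W (c * \<mu>) (c * \<nu>)) m = c ^ 2 * pluecker (U \<mu> \<nu>) (W \<mu> \<nu>) m"
  by (cases m) (simp add: pluecker_def U_def W_def power2_eq_square algebra_simps)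

sublocale cpoly: coefficient_hom "\<lambda>c. [:C c:]" by unfold_locales (simp_all add: one_pCons)
sublocale chom: coefficient_hom C by unfold_locales simp_all

lemma poly_ev: "poly (ev (\<lambda>c. [:C c:]) D f) \<sigma> = ev C (\<lambda>m. poly (D m) \<sigma>) f" for D :: "'i::finite \<Rightarrow> 'k alg_closure poly"
  using ev_compose[OF cpoly.coefficient_hom_axioms, of "\<lambda>p. poly p \<sigma>" D f] by simp

text \<open>
  A form vanishing at the generic point vanishes on the whole first chart, and by homogeneity on all points
  of the second chart but one. A polynomial with that many zeros is zero, so the form vanishes also at the point \<open>(0, 1)\<close>.
\<close>

theorem generic_nonzero:
  assumes g: "homogeneous n g" and x: "x \<in> conic_points \<eta> e" "eval_poly g x \<noteq> 0"
  shows "ev (\<lambda>c. [:C c:]) DP g \<noteq> 0"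
proof
  assume 0: "ev (\<lambda>c. [:C c:]) DP g = 0"
  have zero: "ev C (pluecker (U 1 \<sigma>) (W 1 \<sigma>)) g = 0" for \<sigma>
    using poly_ev[of DP g \<sigma>] 0 by (simp add: poly_DP)
  have scaled: "ev C (pluecker (U (c * \<mu>) (c * \<nu>)) (W (c * \<mu>) (c * \<nu>))) g = (c ^ 2) ^ n * ev C (pluecker (U \<mu> \<nu>) (W \<mu> \<nu>)) g" for c \<mu> \<nu>
    unfolding ev_homogeneous[OF g, symmetric] by (rule arg_cong[of _ _ "\<lambda>x. ev C x g"]) (simp add: pluecker_scale fun_eq_iff)
  have nonzero: "ev C (pluecker (U \<mu> \<nu>) (W \<mu> \<nu>)) g = 0" if "\<mu> \<noteq> 0" for \<mu> \<nu>
    using scaled[of \<mu> 1 "\<nu> / \<mu>"] zero that by simp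
  have "ev (\<lambda>c. [:C c:]) DP' g = 0"
    by (rule poly_zero_cofinite[of 0]) (simp add: poly_ev poly_DP nonzero)
  then have "ev C (pluecker (U 0 1) (W 0 1)) g = 0" using poly_ev[of DP' g 0] by (simp add: poly_DP)
  then have "ev C (pluecker (U \<mu> \<nu>) (W \<mu> \<nu>)) g = 0" for \<mu> \<nu>
    using nonzero[of \<mu> \<nu>] scaled[of \<nu> 0 1] by (cases "\<mu> = 0") simp_all
  moreover obtain c \<mu> \<nu> where "x = (\<lambda>m. c * pluecker (U \<mu> \<nu>) (W \<mu> \<nu>) m)" using conic_point_cases[OF x(1)] .
  ultimately show False using x(2) by (simp add: eval_poly_ev ev_homogeneous[OF g])
qed

theorem generic_zero:
  assumes "\<And>x. x \<in> conic_points \<eta> e \<Longrightarrow> eval_poly f x * eval_poly g' x = eval_poly f' x * eval_poly g x"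
  shows "ev (\<lambda>c. [:C c:]) DP f * ev (\<lambda>c. [:C c:]) DP g' = ev (\<lambda>c. [:C c:]) DP f' * ev (\<lambda>c. [:C c:]) DP g"
proof -
  have "ev (\<lambda>c. [:C c:]) DP f * ev (\<lambda>c. [:C c:]) DP g' - ev (\<lambda>c. [:C c:]) DP f' * ev (\<lambda>c. [:C c:]) DP g = 0"
  proof (rule poly_zero_cofinite[of 0])
    fix \<sigma>
    have "(\<lambda>m. poly (DP m) \<sigma>) \<in> conic_points \<eta> e" using pluecker_U_W_point[of 1 \<sigma>] by (simp add: poly_DP)
    from assms[OF this] show "poly (ev (\<lambda>c. [:C c:]) DP f * ev (\<lambda>c. [:C c:]) DP g' - ev (\<lambda>c. [:C c:]) DP f' * ev (\<lambda>c. [:C c:]) DP g) \<sigma> = 0"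
      by (simp add: poly_ev eval_poly_ev)
  qed
  then show ?thesis by simp
qed

lemma generic_point:
  assumes "ev (\<lambda>c. [:C c:]) DP g \<noteq> 0" shows "\<exists>x\<in>conic_points \<eta> e. eval_poly g x \<noteq> 0"
proof (rule ccontr)
  assume none: "\<not> (\<exists>x\<in>conic_points \<eta> e. eval_poly g x \<noteq> 0)"
  have "ev (\<lambda>c. [:C c:]) DP g = 0"
  proof (rule poly_zero_cofinite[of 0])
    fix \<sigma>
    have "(\<lambda>m. poly (DP m) \<sigma>) \<in> conic_points \<eta> e" using pluecker_U_W_point[of 1 \<sigma>] by (simp add: poly_DP)
    then show "poly (ev (\<lambda>c. [:C c:]) DP g) \<sigma> = 0" using none by (simp add: poly_ev eval_poly_ev[symmetric])
  qed
  then show False using assms by simp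
qed

end

section \<open>Anisotropy after scalar extension\<close>

subsection \<open>An algebraically closed field with a transcendental element\<close>

text \<open>
  The algebraic closure of \<open>C(t)\<close>, for a field \<open>C\<close>, contains the polynomials under \<open>\<iota>\<close>
  and the constants under \<open>\<epsilon>\<close>.
\<close>

definition \<iota> :: "'c::field poly \<Rightarrow> 'c poly fract alg_closure" where "\<iota> p = to_ac (Fract p 1)"
definition \<epsilon> :: "'c::field \<Rightarrow> 'c poly fract alg_closure" where "\<epsilon> c = \<iota> [:c:]"
definition indet :: "'c::field poly fract alg_closure" where "indet = \<iota> [:0, 1:]"

lemma \<iota>_add: "\<iota> (p + q) = \<iota> p + \<iota> q" and \<iota>_mult: "\<iota> (p * q) = \<iota> p * \<iota> q" and \<iota>_one: "\<iota> 1 = 1"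
  by (simp_all add: \<iota>_def One_fract_def[symmetric] flip: to_ac_add to_ac_mult)

lemma \<iota>_eq_0: "\<iota> p = 0 \<longleftrightarrow> p = 0"
  by (simp add: \<iota>_def Zero_fract_def eq_fract)

lemma \<iota>_zero: "\<iota> 0 = 0" by (simp add: \<iota>_eq_0)

lemma \<iota>_diff: "\<iota> (p - q) = \<iota> p - \<iota> q"
  using \<iota>_add[of "p - q" q] by (simp add: eq_diff_eq)

lemma \<iota>_power: "\<iota> (p ^ n) = \<iota> p ^ n"
  by (induction n) (simp_all add: \<iota>_one \<iota>_mult)

lemma \<iota>_sum: "\<iota> (sum f S) = (\<Sum>s\<in>S. \<iota> (f s))"
  by (induction S rule: infinite_finite_induct) (simp_all add: \<iota>_zero \<iota>_add)

lemma \<epsilon>_add: "\<epsilon> (x + y) = \<epsilon> x + \<epsilon> y" and \<epsilon>_mult: "\<epsilon> (x * y) = \<epsilon> x * \<epsilon> y" and \<epsilon>_one: "\<epsilon> 1 = 1"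
  and \<epsilon>_diff: "\<epsilon> (x - y) = \<epsilon> x - \<epsilon> y"
  by (simp_all add: \<epsilon>_def \<iota>_one mult.commute flip: \<iota>_add \<iota>_mult \<iota>_diff one_pCons)

lemma \<epsilon>_eq_0: "\<epsilon> x = 0 \<longleftrightarrow> x = 0"
  by (simp add: \<epsilon>_def \<iota>_eq_0)

lemma \<epsilon>_zero: "\<epsilon> 0 = 0" by (simp add: \<epsilon>_eq_0)

lemma \<epsilon>_eq: "\<epsilon> x = \<epsilon> y \<longleftrightarrow> x = y"
  using \<epsilon>_eq_0[of "x - y"] by (simp add: \<epsilon>_diff)

text \<open>
  Polynomials over the constants embed, since \<open>\<iota>\<close> is injective.
\<close>

lemma indet_transcendental:
  fixes p :: "'c::field poly fract alg_closure poly"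
  assumes "\<And>n. coeff p n \<in> range \<epsilon>" "poly p indet = 0" shows "p = 0"
proof -
  have "\<forall>n. \<exists>c. coeff p n = \<epsilon> c" using assms(1) by blast
  then obtain g :: "nat \<Rightarrow> 'c" where g: "\<And>n. coeff p n = \<epsilon> (g n)" by metis
  define q where "q = (\<Sum>n\<le>degree p. monom (g n) n)"
  have "\<iota> (monom c n) = \<epsilon> c * indet ^ n" for c :: 'c and n
    by (simp add: \<epsilon>_def indet_def monom_altdef flip: \<iota>_mult \<iota>_power)
  then have "\<iota> q = poly p indet" by (simp add: q_def \<iota>_sum poly_altdef g)
  then have "q = 0" using assms(2) \<iota>_eq_0 by metis
  have "coeff p n = 0" for n
  proof (cases "n \<le> degree p")
    case True
    then have "g n = coeff q n" by (simp add: q_def coeff_sum)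
    then show ?thesis using \<open>q = 0\<close> by (simp add: g \<epsilon>_eq_0)
  qed (simp add: coeff_eq_0)
  then show ?thesis by (simp add: poly_eq_iff)
qed

context coefficient_hom
begin

lemma h_eq_0: "h x = 0 \<longleftrightarrow> x = 0"
proof
  assume "h x = 0"
  show "x = 0"
  proof (rule ccontr)
    assume "x \<noteq> 0"
    then have "h (x * inverse x) = 1" by (simp add: h_one)
    then show False using \<open>h x = 0\<close> by (simp add: h_mult)
  qed
qed (simp add: h_zero)

lemma h_sum: "h (sum f S) = (\<Sum>x\<in>S. h (f x))"
  by (induction S rule: infinite_finite_induct) (simp_all add: h_zero h_add)

lemma h_diff: "h (x - y) = h x - h y"
  using h_add[of "x - y" y] by (simp add: eq_diff_eq)

lemma map_poly_add: "map_poly h (p + q) = map_poly h p + map_poly h q"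
  and map_poly_diff: "map_poly h (p - q) = map_poly h p - map_poly h q"
  and map_poly_mult: "map_poly h (p * q) = map_poly h p * map_poly h q"
  and map_poly_smult: "map_poly h (smult c p) = smult (h c) (map_poly h p)"
  by (simp_all add: poly_eq_iff coeff_map_poly h_zero h_add h_diff h_mult coeff_mult h_sum)

lemma map_poly_sum: "map_poly h (sum f S) = (\<Sum>x\<in>S. map_poly h (f x))"
  by (induction S rule: infinite_finite_induct) (simp_all add: map_poly_add)

lemma degree_map_poly: "degree (map_poly h p) = degree p"
  by (cases "p = 0") (simp_all add: map_poly_degree_eq h_eq_0)

end

lemma is_subfield_image:
  fixes h :: "'a::field \<Rightarrow> 'b::field"
  assumes "coefficient_hom h" "is_subfield E" shows "is_subfield (h ` E)"
proof -
  interpret coefficient_hom h by (rule assms(1))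
  have inv: "h (inverse x) = inverse (h x)" for x
  proof (cases "x = 0")
    case False
    then have "h x * h (inverse x) = 1" by (simp add: h_one flip: h_mult)
    then show ?thesis by (metis inverse_unique)
  qed (simp add: h_zero)
  have "1 \<in> h ` E" using subfield_one[OF assms(2)] h_one by (metis image_eqI)
  then show ?thesis unfolding is_subfield_def using assms(2)
    by (auto simp: subfield_intros simp flip: h_diff inv h_mult)
qed

subsection \<open>A basis of the module\<close>

lemma module_vector_space:
  assumes "k_algebra \<eta>" "right_module act" shows "vector_space (\<lambda>c v. act v (\<eta> c))"
proof -
  interpret k_algebra \<eta> by (rule assms(1))
  interpret right_module act by (rule assms(2))
  show ?thesis
    by unfold_locales
       (simp_all add: act_add_left act_add_right structure_add structure_one act_one structure_mult \<eta>_comm flip: act_mult)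
qed

lemma module_basis:
  fixes \<eta> :: "'k::field \<Rightarrow> 'q::division_ring" and act :: "'v::ab_group_add \<Rightarrow> 'q \<Rightarrow> 'v"
  assumes Q: "quaternion_algebra \<eta>" and M: "right_module act" and fg: "finitely_generated act"
  obtains B r where "finite B" "\<And>v. v = (\<Sum>\<beta>\<in>B. act \<beta> (\<eta> (r v \<beta>)))"
    "\<And>v w \<beta>. r (v + w) \<beta> = r v \<beta> + r w \<beta>" "\<And>v c \<beta>. r (act v (\<eta> c)) \<beta> = c * r v \<beta>"
    "\<And>\<beta> \<beta>'. \<beta> \<in> B \<Longrightarrow> \<beta>' \<in> B \<Longrightarrow> r \<beta> \<beta>' = (if \<beta> = \<beta>' then 1 else 0)"
proof -
  interpret quaternion_algebra \<eta> by (rule Q)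
  interpret right_module act by (rule M)
  interpret vs: vector_space "\<lambda>c v. act v (\<eta> c)" by (rule module_vector_space) unfold_locales
  interpret q: vector_space "alg_scale \<eta>" by (rule k_algebra_vector_space) unfold_locales
  obtain S0 where S0: "finite S0" "q.span S0 = UNIV" "card S0 = 4" using basis_four[OF Q] .
  obtain S where S: "finite S" "\<And>v. \<exists>c. v = (\<Sum>x\<in>S. act x (c x))" using fg unfolding finitely_generated_def by blast
  let ?G = "(\<lambda>(x, y). act x y) ` (S \<times> S0)"
  have gen: "act x y \<in> vs.span ?G" if "x \<in> S" for x y
  proof -
    have "y \<in> range (\<lambda>u. \<Sum>a\<in>S0. alg_scale \<eta> (u a) a)" using S0(2) unfolding q.span_finite[OF S0(1)] by blast
    then obtain u where "y = (\<Sum>a\<in>S0. alg_scale \<eta> (u a) a)" by blast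
    moreover have "act x (\<Sum>a\<in>T. alg_scale \<eta> (u a) a) \<in> vs.span ?G" if "T \<subseteq> S0" "finite T" for T
      using that(2,1)
    proof (induction T rule: finite_induct)
      case empty
      have "act x 0 = 0" using act_add_right[of x 0 0] by simp
      then show ?case by (simp add: vs.span_zero)
    next
      case (insert a T)
      have "act x (alg_scale \<eta> (u a) a) = act (act x a) (\<eta> (u a))"
        by (simp add: alg_scale_def structure_central act_mult)
      moreover have "act x a \<in> vs.span ?G" using \<open>x \<in> S\<close> insert.prems by (intro vs.span_base) force
      ultimately have "act x (alg_scale \<eta> (u a) a) \<in> vs.span ?G" by (simp add: vs.span_scale)
      then show ?case using insert by (simp add: act_add_right vs.span_add)
    qed
    ultimately show ?thesis using S0(1) by simp
  qed
  have "v \<in> vs.span ?G" for v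
  proof -
    obtain c where "v = (\<Sum>x\<in>S. act x (c x))" using S(2) by blast
    then show ?thesis using gen by (auto intro: vs.span_sum)
  qed
  obtain B where B: "B \<subseteq> ?G" "vs.independent B" "?G \<subseteq> vs.span B" by (rule vs.maximal_independent_subset)
  have fin: "finite B" using B(1) S(1) S0(1) by (meson finite_SigmaI finite_imageI finite_subset)
  have span: "vs.span B = UNIV"
    using \<open>\<And>v. v \<in> vs.span ?G\<close> vs.span_minimal[OF B(3) vs.subspace_span] by auto
  show thesis
  proof (rule that[of B "vs.representation B"])
    show "v = (\<Sum>\<beta>\<in>B. act \<beta> (\<eta> (vs.representation B v \<beta>)))" for v
      using vs.sum_representation_eq[OF B(2) _ fin order_refl, of v] span by simp
    show "vs.representation B (v + w) \<beta> = vs.representation B v \<beta> + vs.representation B w \<beta>" for v w \<beta>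
      using vs.representation_add[OF B(2), of w v] span by simp
    show "vs.representation B (act v (\<eta> c)) \<beta> = c * vs.representation B v \<beta>" for v c \<beta>
      using vs.representation_scale[OF B(2), of v c] span by simp
    show "vs.representation B \<beta> \<beta>' = (if \<beta> = \<beta>' then 1 else 0)" if "\<beta> \<in> B" "\<beta>' \<in> B" for \<beta> \<beta>'
      using vs.representation_basis[OF B(2) that(1)] by auto
  qed (rule fin)
qed

subsection \<open>From isotropic vectors to common zeros of three forms\<close>

text \<open>
  An anisotropic form on a space with \<open>k\<close>-basis \<open>B\<close>. Isotropic vectors after a scalar extension \<open>\<phi>\<close> correspond to
  \<open>common_zero \<phi>\<close>.
\<close>

locale form_coordinates = quaternion_generators \<eta> i j T N b co + right_module act
  for \<eta> :: "'k::field \<Rightarrow> 'q::ring_1" and i j T N b co and act :: "'v::ab_group_add \<Rightarrow> 'q \<Rightarrow> 'v" +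
  fixes s :: "'v \<Rightarrow> 'v \<Rightarrow> 'q" and B :: "'v set" and r :: "'v \<Rightarrow> 'v \<Rightarrow> 'k"
  assumes s_sesq: "s \<in> Sesq \<eta> act"
    and fin_B: "finite B"
    and r_expand: "v = (\<Sum>\<beta>\<in>B. act \<beta> (\<eta> (r v \<beta>)))"
    and r_add: "r (v + w) \<beta> = r v \<beta> + r w \<beta>"
    and r_scale: "r (act v (\<eta> c)) \<beta> = c * r v \<beta>"
    and r_basis: "\<beta> \<in> B \<Longrightarrow> \<beta>' \<in> B \<Longrightarrow> r \<beta> \<beta>' = (if \<beta> = \<beta>' then 1 else 0)"
    and no_isotropic: "v \<noteq> 0 \<Longrightarrow> s v v \<notin> range \<eta>"
begin

definition common_zero :: "('k \<Rightarrow> 'l::field) \<Rightarrow> ('v \<Rightarrow> 'l) \<Rightarrow> bool" where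
  "common_zero \<phi> x \<longleftrightarrow> (\<forall>n\<in>{1, 2, 3}. (\<Sum>\<beta>\<in>B. \<Sum>\<beta>'\<in>B. x \<beta> * x \<beta>' * \<phi> (co (s \<beta> \<beta>') n)) = 0)"

lemma s_add: "s (v + v') w = s v w + s v' w" "s v (w + w') = s v w + s v w'"
  and s_scale: "s (act v (\<eta> c)) w = \<eta> c * s v w" "s v (act w (\<eta> c)) = \<eta> c * s v w"
  using s_sesq by (simp_all add: Sesq_def k_bilinear_def structure_central)

lemma co_sum: "n < 4 \<Longrightarrow> co (sum f S) n = (\<Sum>x\<in>S. co (f x) n)"
proof (induction S rule: infinite_finite_induct)
  case empty
  show ?case using co_scale[OF empty, of 0 0] by (simp add: \<eta>_zero)
next
  case (infinite A)
  show ?case using infinite co_scale[OF infinite(2), of 0 0] by (simp add: \<eta>_zero)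
qed (simp add: co_add)

lemma base_common_zero:
  assumes 0: "common_zero (\<lambda>c. c) x" and \<beta>: "\<beta> \<in> B" shows "x \<beta> = 0"
proof -
  define w where "w = (\<lambda>S. \<Sum>\<beta>\<in>S. act \<beta> (\<eta> (x \<beta>)))"
  have s0: "s 0 v = 0" "s v 0 = 0" for v
    using s_add(1)[of 0 0 v] s_add(2)[of v 0 0] by simp_all
  have 1: "s (w S) v = (\<Sum>\<beta>\<in>S. \<eta> (x \<beta>) * s \<beta> v)" if "finite S" for S v
    using that by (induction S rule: finite_induct) (simp_all add: w_def s_add s_scale s0)
  have 2: "s v (w S) = (\<Sum>\<beta>\<in>S. \<eta> (x \<beta>) * s v \<beta>)" if "finite S" for S v
    using that by (induction S rule: finite_induct) (simp_all add: w_def s_add s_scale s0)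
  have "co (s (w B) (w B)) n = (\<Sum>\<beta>\<in>B. \<Sum>\<beta>'\<in>B. x \<beta> * x \<beta>' * co (s \<beta> \<beta>') n)" if "n < 4" for n
    unfolding 1[OF fin_B] 2[OF fin_B] by (simp add: co_sum[OF that] co_scale[OF that] sum_distrib_left mult.assoc) (subst sum.swap, simp add: mult.left_commute)
  then have "co (s (w B) (w B)) 1 = 0" "co (s (w B) (w B)) 2 = 0" "co (s (w B) (w B)) 3 = 0"
    using 0 by (simp_all add: common_zero_def)
  then have "w B = 0" using no_isotropic[of "w B"] co_range by blast
  have "r 0 \<beta> + r 0 \<beta> = r 0 \<beta> + 0" using r_add[of 0 0 \<beta>] by (simp only: add_0_right)
  then have r0: "r 0 \<beta> = 0" by (rule add_left_imp_eq)
  have "r (w S) \<beta> = (\<Sum>\<beta>'\<in>S. x \<beta>' * r \<beta>' \<beta>)" if "finite S" for S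
    using that by (induction S rule: finite_induct) (simp_all add: w_def r_add r_scale r0)
  from this[OF fin_B] have "r (w B) \<beta> = (\<Sum>\<beta>'\<in>B. if \<beta>' = \<beta> then x \<beta>' else 0)"
    using \<beta> by (simp add: r_basis if_distrib[of "\<lambda>c. _ * c"] cong: if_cong)
  then show ?thesis using \<beta> fin_B \<open>w B = 0\<close> r0 by simp
qed

lemma range_common_zero:
  fixes \<phi> :: "'k \<Rightarrow> 'l::field"
  assumes "coefficient_hom \<phi>" and x: "\<And>\<beta>. \<beta> \<in> B \<Longrightarrow> x \<beta> \<in> range \<phi>" and 0: "common_zero \<phi> x" and \<beta>: "\<beta> \<in> B"
  shows "x \<beta> = 0"
proof -
  interpret coefficient_hom \<phi> by (rule assms(1))
  have "\<forall>\<beta>\<in>B. \<exists>c. x \<beta> = \<phi> c" using x by blast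
  then obtain g where g: "\<And>\<beta>. \<beta> \<in> B \<Longrightarrow> x \<beta> = \<phi> (g \<beta>)" by metis
  have "common_zero (\<lambda>c. c) g"
    unfolding common_zero_def
  proof
    fix n :: nat assume n: "n \<in> {1, 2, 3}"
    have "\<phi> (\<Sum>\<beta>\<in>B. \<Sum>\<beta>'\<in>B. g \<beta> * g \<beta>' * co (s \<beta> \<beta>') n) = (\<Sum>\<beta>\<in>B. \<Sum>\<beta>'\<in>B. x \<beta> * x \<beta>' * \<phi> (co (s \<beta> \<beta>') n))"
      by (simp add: h_sum h_mult g)
    also have "\<dots> = 0" using 0 n unfolding common_zero_def by (rule bspec)
    finally show "(\<Sum>\<beta>\<in>B. \<Sum>\<beta>'\<in>B. g \<beta> * g \<beta>' * co (s \<beta> \<beta>') n) = 0" by (simp only: h_eq_0)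
  qed
  from base_common_zero[OF this \<beta>] show ?thesis by (simp add: g[OF \<beta>] h_zero)
qed

text \<open>
  Elements of \<open>Herm_plus\<close> take values in \<open>L\<close> on the diagonal, so the choice of a representative does not
  matter. Applying the \<open>L\<close>-linear coordinate functions of \<open>Q \<otimes> L\<close> to \<open>s\<^sub>L(v, v) \<in> L\<close> gives the three equations.
\<close>

lemma isotropic_common_zero:
  assumes ext: "scalar_extension \<eta> act s jj \<tau>Q \<eta>L \<tau>V actL sL" and iso: "isotropic \<eta>L (form_class \<eta>L actL sL)"
  shows "\<exists>f. common_zero jj f \<and> (\<exists>\<beta>\<in>B. f \<beta> \<noteq> 0)"
proof -
  interpret scalar_extension \<eta> act s jj \<tau>Q \<eta>L \<tau>V actL sL by (rule ext)
  interpret J: k_algebra jj by (rule extension)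
  interpret L: right_module actL by (rule module_ext)
  have vsj: "vector_space (alg_scale jj)" by (rule k_algebra_vector_space) (rule extension)
  have vsQ: "vector_space (alg_scale \<eta>)" by (rule k_algebra_vector_space) unfold_locales
  have vsV: "vector_space (\<lambda>c v. act v (\<eta> c))" by (rule module_vector_space) unfold_locales
  note tQ = tensor_bilinear[OF algebra_tensor vsQ vsj] and tV = tensor_bilinear[OF module_tensor vsV vsj]
  have \<eta>L_add: "\<eta>L (a + a') = \<eta>L a + \<eta>L a'" for a a' by (simp add: algebra_structure tQ(2))
  have tV0: "\<tau>V v 0 = 0" for v using tV(2)[of v 0 0] by simp
  have pure: "actL (\<tau>V v 1) (\<eta>L a) = \<tau>V v a" for v a
    by (simp add: algebra_structure module_act act_one)
  have bil: "sL (v + v') w = sL v w + sL v' w" "sL v (w + w') = sL v w + sL v w'"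
    "sL (actL v (\<eta>L c)) w = sL v w * \<eta>L c" "sL v (actL w (\<eta>L c)) = sL v w * \<eta>L c" for v v' w w' c
    using form_bilinear by (simp_all add: k_bilinear_def)
  have s_pure: "sL (\<tau>V v a) (\<tau>V w a') = \<tau>Q (s v w) (a * a')" for v w a a'
  proof -
    have "sL (\<tau>V v a) (\<tau>V w a') = \<tau>Q (s v w) 1 * \<eta>L a * \<eta>L a'"
      unfolding pure[of v a, symmetric] pure[of w a', symmetric] bil form_extends ..
    then show ?thesis by (simp add: algebra_structure algebra_mult mult.commute)
  qed
  have coords: "\<exists>f. x = (\<Sum>\<beta>\<in>B. \<tau>V \<beta> (f \<beta>))" for x
  proof (rule tensor_induct[OF module_tensor vsj vsV, where P = "\<lambda>x. \<exists>f. x = (\<Sum>\<beta>\<in>B. \<tau>V \<beta> (f \<beta>))"])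
    fix x y assume "\<exists>f. x = (\<Sum>\<beta>\<in>B. \<tau>V \<beta> (f \<beta>))" "\<exists>f. y = (\<Sum>\<beta>\<in>B. \<tau>V \<beta> (f \<beta>))"
    then obtain f f' where "x = (\<Sum>\<beta>\<in>B. \<tau>V \<beta> (f \<beta>))" "y = (\<Sum>\<beta>\<in>B. \<tau>V \<beta> (f' \<beta>))" by (elim exE)
    then have "x + y = (\<Sum>\<beta>\<in>B. \<tau>V \<beta> (f \<beta> + f' \<beta>))" by (simp add: tV(2) sum.distrib)
    then show "\<exists>f. x + y = (\<Sum>\<beta>\<in>B. \<tau>V \<beta> (f \<beta>))" by (rule exI[of _ "\<lambda>\<beta>. f \<beta> + f' \<beta>"])
  next
    show "\<exists>f. 0 = (\<Sum>\<beta>\<in>B. \<tau>V \<beta> (f \<beta>))" by (intro exI[of _ "\<lambda>\<beta>. 0"]) (simp add: tV0)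
  next
    fix v a
    have t0: "\<tau>V 0 a = 0" using tV(1)[of 0 0 a] by simp
    have "\<tau>V (\<Sum>\<beta>\<in>S. act \<beta> (\<eta> (u \<beta>))) a = (\<Sum>\<beta>\<in>S. \<tau>V \<beta> (jj (u \<beta>) * a))" if "finite S" for S u
      using that
    proof (induction S rule: finite_induct)
      case (insert \<beta> S)
      have "\<tau>V (act \<beta> (\<eta> (u \<beta>))) a = \<tau>V \<beta> (jj (u \<beta>) * a)"
        using tV(3)[of \<beta> "u \<beta>" a] tV(4)[of \<beta> "u \<beta>" a] by (simp add: alg_scale_def)
      then show ?case using insert by (simp add: tV(1))
    qed (simp add: t0)
    from this[OF fin_B, of "r v"] have "\<tau>V v a = (\<Sum>\<beta>\<in>B. \<tau>V \<beta> (jj (r v \<beta>) * a))" by (simp only: r_expand[symmetric])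
    then show "\<exists>f. \<tau>V v a = (\<Sum>\<beta>\<in>B. \<tau>V \<beta> (f \<beta>))" by (rule exI[of _ "\<lambda>\<beta>. jj (r v \<beta>) * a"])
  qed
  obtain s' v where s': "s' \<in> form_class \<eta>L actL sL" and v: "v \<noteq> 0" and q: "q_map \<eta>L s' v = range \<eta>L"
    using iso unfolding isotropic_def by blast
  have \<eta>L0: "\<eta>L 0 = 0" using \<eta>L_add[of 0 0] by simp
  have "s' v v \<in> q_map \<eta>L s' v" unfolding q_map_def mem_Collect_eq by (intro exI[of _ 0]) (simp add: \<eta>L0)
  then obtain a where a: "s' v v = \<eta>L a" unfolding q by blast
  obtain h where h: "h \<in> Herm_plus \<eta>L actL" "s' = (\<lambda>v w. sL v w + h v w)"
    using s' unfolding form_class_def by blast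
  then obtain s1 where "h = (\<lambda>v w. s1 v w + dagger \<eta>L s1 v w)" unfolding Herm_plus_def by blast
  then have "h v v = \<eta>L (reduced_trace \<eta>L (s1 v v))" by (simp add: dagger_def canonical_involution_def)
  then have "sL v v + \<eta>L (reduced_trace \<eta>L (s1 v v)) = \<eta>L (a - reduced_trace \<eta>L (s1 v v)) + \<eta>L (reduced_trace \<eta>L (s1 v v))"
    using a h(2) by (simp flip: \<eta>L_add)
  then have "sL v v = \<eta>L (a - reduced_trace \<eta>L (s1 v v))" by (rule add_right_imp_eq)
  then obtain a' where a': "sL v v = \<eta>L a'" by blast
  obtain f where f: "v = (\<Sum>\<beta>\<in>B. \<tau>V \<beta> (f \<beta>))" using coords by blast
  have s0: "sL 0 w = 0" "sL w 0 = 0" for w using bil(1)[of 0 0 w] bil(2)[of w 0 0] by simp_all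
  have 1: "sL (sum g S) w = (\<Sum>\<beta>\<in>S. sL (g \<beta>) w)" "sL w (sum g S) = (\<Sum>\<beta>\<in>S. sL w (g \<beta>))" if "finite S" for g and S :: "'v set" and w
    using that by (induction S rule: finite_induct) (simp_all add: s0 bil(1,2))
  have s_v: "sL v v = (\<Sum>\<beta>\<in>B. \<Sum>\<beta>'\<in>B. \<tau>Q (s \<beta> \<beta>') (f \<beta> * f \<beta>'))"
    unfolding f 1[OF fin_B] s_pure by (rule sum.swap)
  have "common_zero jj f" unfolding common_zero_def
  proof
    fix n :: nat assume "n \<in> {1, 2, 3}"
    then have n: "n < 4" "co 1 n = 0" using co_eq[of 1 1 0 0 0] by (auto simp: \<eta>_zero structure_one)
    obtain L where L_add: "\<And>x y. L (x + y) = L x + L y" and L: "\<And>x a. L (\<tau>Q x a) = jj (co x n) * a"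
    proof (rule tensor_universal[OF algebra_tensor vsj, of "\<lambda>x a. jj (co x n) * a"])
      show "jj (co (x + x') n) * a = jj (co x n) * a + jj (co x' n) * a" for x x' a
        by (simp add: co_add[OF n(1)] J.structure_add distrib_right)
      show "jj (co x n) * (a + a') = jj (co x n) * a + jj (co x n) * a'" for x a a' by (simp add: distrib_left)
      show "jj (co (alg_scale \<eta> c x) n) * a = alg_scale jj c (jj (co x n) * a)" for c x a
        by (simp add: alg_scale_def co_scale[OF n(1)] J.structure_mult mult.assoc)
      show "jj (co x n) * alg_scale jj c a = alg_scale jj c (jj (co x n) * a)" for c x a
        by (simp add: alg_scale_def mult.left_commute)
    qed (rule that)
    have "L 0 + L 0 = L 0 + 0" using L_add[of 0 0] by (simp only: add_0_right)
    then have L0: "L 0 = 0" by (rule add_left_imp_eq)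
    have L_sum: "L (sum g S) = (\<Sum>\<beta>\<in>S. L (g \<beta>))" for g and S :: "'v set"
      by (induction S rule: infinite_finite_induct) (simp_all add: L0 L_add)
    have "(\<Sum>\<beta>\<in>B. \<Sum>\<beta>'\<in>B. f \<beta> * f \<beta>' * jj (co (s \<beta> \<beta>') n)) = L (sL v v)"
      unfolding s_v by (simp add: L_sum L mult.commute)
    also have "\<dots> = 0" unfolding a' algebra_structure L n(2) by (simp add: J.\<eta>_zero)
    finally show "(\<Sum>\<beta>\<in>B. \<Sum>\<beta>'\<in>B. f \<beta> * f \<beta>' * jj (co (s \<beta> \<beta>') n)) = 0" .
  qed
  moreover have "\<exists>\<beta>\<in>B. f \<beta> \<noteq> 0"
  proof (rule ccontr)
    assume "\<not> (\<exists>\<beta>\<in>B. f \<beta> \<noteq> 0)"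
    then have "v = 0" unfolding f by (intro sum.neutral) (simp add: tV0)
    then show False using v by simp
  qed
  ultimately show ?thesis by (intro exI[of _ f] conjI)
qed

lemma conic_anisotropicI:
  fixes h :: "'k \<Rightarrow> 'o::field"
  assumes "coefficient_hom h" "is_subfield E" "\<And>c. h c \<in> E" "\<zeta> + \<zeta>' = h T" "\<zeta> * \<zeta>' = h N" "\<zeta> \<notin> E"
    and "\<And>p. (\<And>n. \<exists>e\<in>E. \<exists>f\<in>E. coeff p n = e + f * \<zeta>) \<Longrightarrow> poly p t = 0 \<Longrightarrow> p = 0"
    and anis: "\<And>x \<beta>. (\<And>\<beta>. \<beta> \<in> B \<Longrightarrow> x \<beta> \<in> E) \<Longrightarrow> common_zero h x \<Longrightarrow> \<beta> \<in> B \<Longrightarrow> x \<beta> = 0"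
  shows "conic_anisotropic \<eta> i j T N b co act s B r h E \<zeta> \<zeta>' t"
proof -
  interpret coefficient_hom h by (rule assms(1))
  have conic: "conic_setup \<eta> i j T N b co act s B r h E \<zeta> \<zeta>' t"
    by unfold_locales (fact s_sesq fin_B r_expand r_add r_scale r_basis h_add h_mult h_one assms(2-7))+
  interpret conic_setup \<eta> i j T N b co act s B r h E \<zeta> \<zeta>' t by (rule conic)
  show ?thesis
  proof unfold_locales
    fix x \<beta> assume x: "\<And>\<beta>. \<beta> \<in> B \<Longrightarrow> x \<beta> \<in> E" and 0: "form 1 x x = 0" "form 2 x x = 0" "form 3 x x = 0" and \<beta>: "\<beta> \<in> B"
    have "common_zero h x" unfolding common_zero_def using 0 unfolding form_def by simp
    from anis[OF x this \<beta>] show "x \<beta> = 0" .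
  qed
qed

end

lemma alg_closed_quadratic:
  fixes T N :: "'a::alg_closed_field" obtains z z' where "z + z' = T" "z * z' = N"
proof -
  have "degree [:N, - T, 1:] > 0" by simp
  then obtain z where "poly [:N, - T, 1:] z = 0" using alg_closed_imp_poly_has_root by blast
  then have "z + (T - z) = T" "z * (T - z) = N" by (simp_all add: algebra_simps)
  then show ?thesis by (rule that)
qed

lemma range_\<epsilon>_K:
  assumes "E \<subseteq> range \<epsilon>" "\<exists>e\<in>E. \<exists>f\<in>E. y = e + f * \<epsilon> z" shows "y \<in> range \<epsilon>"
proof -
  obtain e f where "e \<in> E" "f \<in> E" "y = e + f * \<epsilon> z" using assms(2) by blast
  moreover obtain e' f' where "e = \<epsilon> e'" "f = \<epsilon> f'" using assms(1) \<open>e \<in> E\<close> \<open>f \<in> E\<close> by blast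
  ultimately have "y = \<epsilon> (e' + f' * z)" by (simp add: \<epsilon>_add \<epsilon>_mult)
  then show ?thesis by simp
qed


lemma \<epsilon>_divide: "\<epsilon> (x / y) = \<epsilon> x / \<epsilon> y"
proof (cases "y = 0")
  case False
  then have "\<epsilon> (x / y) * \<epsilon> y = \<epsilon> x" by (simp flip: \<epsilon>_mult)
  then show ?thesis using False by (simp add: field_simps \<epsilon>_eq_0)
next
  case True
  then show ?thesis by (simp add: \<epsilon>_zero)
qed

lemma \<iota>_linear: "\<iota> [:a, c:] = \<epsilon> a + indet * \<epsilon> c"
  by (simp add: \<epsilon>_def indet_def flip: \<iota>_mult \<iota>_add)

lemma coefficient_hom_\<epsilon>_ac: "coefficient_hom (\<lambda>c. \<epsilon> (to_ac c))"
  by unfold_locales (simp_all add: \<epsilon>_add \<epsilon>_mult \<epsilon>_one)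

lemma is_subfield_UNIV: "is_subfield UNIV"
  by (simp add: is_subfield_def)

lemma (in form_coordinates) common_zero_hom:
  fixes \<phi> :: "'k \<Rightarrow> 'l::field" and \<rho> :: "'l \<Rightarrow> 'm::field"
  assumes "coefficient_hom \<rho>"
  shows "common_zero (\<lambda>c. \<rho> (\<phi> c)) (\<lambda>\<beta>. \<rho> (x \<beta>)) \<longleftrightarrow> common_zero \<phi> x"
proof -
  interpret coefficient_hom \<rho> by (rule assms(1))
  show ?thesis unfolding common_zero_def by (simp only: h_mult[symmetric] h_sum[symmetric] h_eq_0)
qed

lemma (in form_coordinates) common_zero_cong:
  "(\<And>\<beta>. \<beta> \<in> B \<Longrightarrow> x \<beta> = y \<beta>) \<Longrightarrow> common_zero \<phi> x \<longleftrightarrow> common_zero \<phi> y"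
  by (simp add: common_zero_def)

subsection \<open>The function field of the conic\<close>

lemma homogeneous_UNIV:
  fixes f :: "('i::finite, 'k::field) poly_in"
  shows "homogeneous d f \<longleftrightarrow> (\<forall>m\<in>Poly_Mapping.keys f. (\<Sum>i\<in>UNIV. Poly_Mapping.lookup m i) = d)"
proof -
  have "(\<Sum>i\<in>Poly_Mapping.keys m. Poly_Mapping.lookup m i) = (\<Sum>i\<in>UNIV. Poly_Mapping.lookup m i)" for m :: "'i \<Rightarrow>\<^sub>0 nat"
    by (rule sum.mono_neutral_left) (auto simp: in_keys_iff)
  then show ?thesis by (simp add: homogeneous_def)
qed

lemma homogeneous_add: "homogeneous d f \<Longrightarrow> homogeneous d g \<Longrightarrow> homogeneous d (f + g)"
  using Poly_Mapping.keys_add[of f g] by (auto simp: homogeneous_def)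

lemma homogeneous_mult:
  fixes f g :: "('i::finite, 'k::field) poly_in"
  assumes "homogeneous d f" "homogeneous d' g" shows "homogeneous (d + d') (f * g)"
  unfolding homogeneous_UNIV
proof
  fix m assume "m \<in> Poly_Mapping.keys (f * g)"
  then obtain a c where "m = a + c" "a \<in> Poly_Mapping.keys f" "c \<in> Poly_Mapping.keys g"
    using Poly_Mapping.keys_mult[of f g] by blast
  then show "(\<Sum>i\<in>UNIV. Poly_Mapping.lookup m i) = d + d'"
    using assms by (simp add: homogeneous_UNIV lookup_add sum.distrib)
qed

lemma homogeneous_const: "homogeneous 0 (Poly_Mapping.single 0 c)"
  by (auto simp: homogeneous_def)

text \<open>
  The function field of the conic is embedded with \<open>t\<close> as the generic parameter; \<open>K\<close> and \<open>F\<close> are those of the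
  descent over the image of \<open>k\<close> itself.
\<close>

locale conic_generic_point = form_coordinates \<eta> i j T N b co act s B r + conic_points_setup \<eta> i j T N b co e z z'
  for \<eta> :: "'k::field \<Rightarrow> 'q::ring_1" and i j T N b co and act :: "'v::ab_group_add \<Rightarrow> 'q \<Rightarrow> 'v" and s B r e z z'
begin

abbreviation hh where "hh c \<equiv> \<epsilon> (C c)"

lemma hom_hh: "coefficient_hom hh" by (rule coefficient_hom_\<epsilon>_ac)

lemma z_not_range: "\<epsilon> z \<notin> range hh"
proof
  assume "\<epsilon> z \<in> range hh"
  then obtain c where c: "z = C c" by (auto simp: \<epsilon>_eq)
  have "z * z - (z + z') * z + z * z' = 0" by (simp add: algebra_simps)
  then have "C (c * c - T * c + N) = 0" unfolding z_sum z_prod unfolding c by simp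
  then show False using no_root[of c] by (simp only: to_ac_eq_0_iff)
qed

lemma conic: "conic_anisotropic \<eta> i j T N b co act s B r hh (range hh) (\<epsilon> z) (\<epsilon> z') indet"
proof (rule conic_anisotropicI[OF hom_hh])
  show "is_subfield (range hh)" by (rule is_subfield_image[OF hom_hh is_subfield_UNIV])
  show "\<epsilon> z + \<epsilon> z' = hh T" "\<epsilon> z * \<epsilon> z' = hh N" by (simp_all add: z_sum z_prod flip: \<epsilon>_add \<epsilon>_mult)
  show "\<epsilon> z \<notin> range hh" by (rule z_not_range)
  have "range hh \<subseteq> range \<epsilon>" by blast
  then show "p = 0" if "\<And>n. \<exists>e\<in>range hh. \<exists>f\<in>range hh. coeff p n = e + f * \<epsilon> z" "poly p indet = 0" for p
    using range_\<epsilon>_K[OF _ that(1)] by (intro indet_transcendental that(2))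
  show "hh c \<in> range hh" for c by (rule rangeI)
  show "x \<beta> = 0" if "\<And>\<beta>. \<beta> \<in> B \<Longrightarrow> x \<beta> \<in> range hh" "common_zero hh x" "\<beta> \<in> B" for x \<beta>
    by (rule range_common_zero[OF hom_hh that])
qed

sublocale con: conic_anisotropic \<eta> i j T N b co act s B r hh "range hh" "\<epsilon> z" "\<epsilon> z'" indet by (rule conic)

lemma \<delta>_eq: "con.\<delta> = \<epsilon> d"
  by (simp add: con.\<delta>_def d_def \<epsilon>_diff)

lemma conjugate_coordinates:
  defines "a \<equiv> \<lambda>x y. \<epsilon> ((1 / d) * (C y - z' * C x))" and "a' \<equiv> \<lambda>x y. \<epsilon> ((1 / d) * (z * C x - C y))"
  shows "a x y \<in> con.K" "con.cj (a x y) = a' x y"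
proof -
  have K: "hh c \<in> con.K" "con.cj (hh c) = hh c" for c by (simp_all add: con.E_K con.cj_E)
  have z: "\<epsilon> z \<in> con.K" "con.cj (\<epsilon> z) = \<epsilon> z'"
    using con.K_I[of 0 1] con.cj_eq[of 0 1] subfield_zero[OF con.E] subfield_one[OF con.E] by simp_all
  then have z': "\<epsilon> z' \<in> con.K" "con.cj (\<epsilon> z') = \<epsilon> z" using con.K_ring(5,6)[OF z(1) z(1)] by simp_all
  have eq: "a x y = (hh y - \<epsilon> z' * hh x) / con.\<delta>" "a' x y = (\<epsilon> z * hh x - hh y) / con.\<delta>"
    by (simp_all add: a_def a'_def \<delta>_eq \<epsilon>_mult \<epsilon>_diff \<epsilon>_divide \<epsilon>_one)
  show "a x y \<in> con.K" unfolding eq by (intro con.des.K_intros K z')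
  have "con.cj (a x y) = (hh y - \<epsilon> z * hh x) / - con.\<delta>"
    unfolding eq(1) by (simp only: con.des.cj_simps con.des.K_intros K z' con.\<delta>_K)
  also have "\<dots> = a' x y" unfolding eq(2) by (simp add: divide_inverse algebra_simps)
  finally show "con.cj (a x y) = a' x y" .
qed

lemma E_conjugate:
  "\<epsilon> (E1 $ m) \<in> con.K" "con.cj (\<epsilon> (E1 $ m)) = \<epsilon> (E2 $ m)" "\<epsilon> (E3 $ m) \<in> con.K" "con.cj (\<epsilon> (E3 $ m)) = \<epsilon> (E4 $ m)"
  using conjugate_coordinates[of "crd i m" "crd 1 m"] conjugate_coordinates[of "crd (j * i) m" "crd j m"]
  by (simp_all add: E_defs vec4_def)

text \<open>
  The factor \<open>t \<delta>\<close> makes the generic Pluecker coordinates invariant under the automorphism defining \<open>F\<close>. Values of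
  fractions of the same degree do not see it.
\<close>

definition y :: "4 \<times> 4 \<Rightarrow> 'k alg_closure poly fract alg_closure" where "y m = \<iota> (DP m) / (indet * con.\<delta>)"

text \<open>
  The four eigenvectors are conjugate in pairs, so the coordinate is a trace \<open>al \<kappa> 1\<close> plus a constant fixed by the
  conjugation.
\<close>

lemma y_A: "y m \<in> con.des.A"
proof -
  obtain p q where m: "m = (p, q)" by (cases m)
  define u v u' v' where "u = (\<lambda>n. \<epsilon> (E1 $ n))" and "v = (\<lambda>n. \<epsilon> (E3 $ n))"
    and "u' = (\<lambda>n. \<epsilon> (E2 $ n))" and "v' = (\<lambda>n. \<epsilon> (E4 $ n))"
  note def = u_def v_def u'_def v'_def
  have K: "u n \<in> con.K" "v n \<in> con.K" and cj: "con.cj (u n) = u' n" "con.cj (v n) = v' n" for n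
    unfolding def by (rule E_conjugate)+
  have K': "u' n \<in> con.K" "v' n \<in> con.K" and cj': "con.cj (u' n) = u n" "con.cj (v' n) = v n" for n
    unfolding cj[symmetric] using K by (simp_all add: con.des.cj_K con.des.cj_cj)
  note mem = con.des.K_intros K K'
  define \<kappa> where "\<kappa> = hh b * (v p * u' q - v q * u' p) / con.\<delta>"
  define \<mu> where "\<mu> = (hh b * (u p * u' q - u q * u' p) + (v p * v' q - v q * v' p)) / con.\<delta>"
  have \<kappa>: "\<kappa> \<in> con.K" and \<mu>: "\<mu> \<in> con.K" unfolding \<kappa>_def \<mu>_def by (intro mem)+
  have cj_\<kappa>: "con.cj \<kappa> = hh b * (v' p * u q - v' q * u p) / - con.\<delta>"
    unfolding \<kappa>_def by (simp only: con.des.cj_simps mem cj cj' con.\<delta>_K con.des.cj_b)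
  have "con.cj \<mu> = (hh b * (u' p * u q - u' q * u p) + (v' p * v q - v' q * v p)) / - con.\<delta>"
    unfolding \<mu>_def by (simp only: con.des.cj_simps mem cj cj' con.\<delta>_K con.des.cj_b)
  also have "\<dots> = \<mu>" by (simp add: \<mu>_def divide_inverse algebra_simps)
  finally have cj_\<mu>: "con.cj \<mu> = \<mu>" .
  have DP_m: "\<iota> (DP m) = (u p + indet * v p) * (v' q + indet * (hh b * u' q)) - (u q + indet * v q) * (v' p + indet * (hh b * u' p))"
    by (simp only: m DP_def case_prod_conv \<iota>_diff \<iota>_mult \<iota>_linear \<epsilon>_mult def)
  have quotient: "((u1 + t * v1) * (v2' + t * (\<beta> * u2')) - (u2 + t * v2) * (v1' + t * (\<beta> * u1'))) / (t * \<delta>) =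
     \<beta> * (v1 * u2' - v2 * u1') / \<delta> * t + \<beta> * (v1' * u2 - v2' * u1) / - \<delta> * (1 / (\<beta> * t)) +
     (\<beta> * (u1 * u2' - u2 * u1') + (v1 * v2' - v2 * v1')) / \<delta>"
    if "t \<noteq> 0" "\<beta> \<noteq> 0" "\<delta> \<noteq> 0" for t \<beta> \<delta> u1 v1 u2 v2 u1' v1' u2' v2' :: "'k alg_closure poly fract alg_closure"
  proof -
    have "((t * x + e) * t - y) / (t * \<delta>) = x / \<delta> * t + \<beta> * y / - \<delta> * (1 / (\<beta> * t)) + e / \<delta>"
      for x y e :: "'k alg_closure poly fract alg_closure"
      using that by (simp add: field_simps)
    note * = this[of "\<beta> * (v1 * u2' - v2 * u1')" "\<beta> * (u1 * u2' - u2 * u1') + (v1 * v2' - v2 * v1')" "v1' * u2 - v2' * u1"]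
    have num: "(u1 + t * v1) * (v2' + t * (\<beta> * u2')) - (u2 + t * v2) * (v1' + t * (\<beta> * u1')) =
      (t * (\<beta> * (v1 * u2' - v2 * u1')) + (\<beta> * (u1 * u2' - u2 * u1') + (v1 * v2' - v2 * v1'))) * t - (v1' * u2 - v2' * u1)"
      by (simp add: algebra_simps)
    show ?thesis unfolding num by (rule *)
  qed
  note nz = con.des.t_nz con.des.b_nz con.\<delta>_nz
  have "y m = con.des.al \<kappa> 1 + \<mu>"
    unfolding y_def DP_m quotient[OF nz] con.des.al_def cj_\<kappa> con.des.\<tau>_def power_one_right
    unfolding \<kappa>_def \<mu>_def ..
  then show ?thesis using con.des.A_al'[OF \<kappa>] con.des.A_const'[OF \<mu> cj_\<mu>] by (simp only: con.des.A_add)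
qed

abbreviation G where "G f \<equiv> ev (\<lambda>c. [:C c:]) DP f"

lemma ev_y: assumes "homogeneous n f" shows "ev hh y f = (1 / (indet * con.\<delta>)) ^ n * \<iota> (G f)"
proof -
  have y: "y = (\<lambda>m. 1 / (indet * con.\<delta>) * \<iota> (DP m))" by (simp add: fun_eq_iff y_def)
  have "ev hh y f = (1 / (indet * con.\<delta>)) ^ n * ev hh (\<lambda>m. \<iota> (DP m)) f"
    unfolding y by (rule ev_homogeneous[OF assms])
  moreover have "\<iota> (G f) = ev hh (\<lambda>m. \<iota> (DP m)) f"
    using ev_compose[OF cpoly.coefficient_hom_axioms \<iota>_add \<iota>_mult \<iota>_one] by (simp only: \<epsilon>_def)
  ultimately show ?thesis by simp
qed

lemma ev_y_A: "ev hh y f \<in> con.des.A"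
  unfolding ev_def
  by (intro con.des.A_sum con.des.A_mult con.des.A_prod con.des.A_power y_A con.des.A_const' con.E_K con.cj_E rangeI)

lemma fraction:
  assumes "(f, g) \<in> rational_fractions (conic_points \<eta> e)"
  shows "G g \<noteq> 0" "\<iota> (G f) / \<iota> (G g) \<in> con.des.F"
proof -
  obtain n x where n: "homogeneous n f" "homogeneous n g" and x: "x \<in> conic_points \<eta> e" "eval_poly g x \<noteq> 0"
    using assms unfolding rational_fractions_def by blast
  show nz: "G g \<noteq> 0" by (rule generic_nonzero[OF n(2) x])
  define c where "c = (1 / (indet * con.\<delta>)) ^ n"
  have c: "c \<noteq> 0" using con.des.t_nz con.\<delta>_nz by (simp add: c_def)
  have "ev hh y g \<noteq> 0" unfolding ev_y[OF n(2)] c_def[symmetric] using c nz by (simp add: \<iota>_eq_0)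
  moreover have "\<iota> (G f) / \<iota> (G g) = ev hh y f / ev hh y g"
    unfolding ev_y[OF n(1)] ev_y[OF n(2)] c_def[symmetric] using c by simp
  ultimately show "\<iota> (G f) / \<iota> (G g) \<in> con.des.F" unfolding con.des.F_def using ev_y_A by blast
qed

lemma rational_fractionsI:
  assumes "homogeneous n f" "homogeneous n g" "G g \<noteq> 0"
  shows "(f, g) \<in> rational_fractions (conic_points \<eta> e)"
  using assms generic_point[OF assms(3)] unfolding rational_fractions_def by blast

text \<open>
  Evaluation at the generic point is a field homomorphism \<open>\<rho>\<close> over \<open>k\<close> from the function field into \<open>F\<close>: it
  does not depend on the representing fraction by \<open>generic_zero\<close>. It maps a common zero to a common zero in \<open>F\<close>.
\<close>

lemma function_field_common_zero:
  fixes jj :: "'k \<Rightarrow> 'f::field"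
  assumes ff: "is_function_field (conic_points \<eta> e) jj" and x: "common_zero jj x" and \<beta>: "\<beta> \<in> B"
  shows "x \<beta> = 0"
proof -
  let ?R = "rational_fractions (conic_points \<eta> e)"
  obtain \<Phi> :: "((4 \<times> 4, 'k) poly_in \<times> (4 \<times> 4, 'k) poly_in) \<Rightarrow> 'f" where
    surj: "\<Phi> ` ?R = UNIV" and
    eq: "\<forall>r\<in>?R. \<forall>r'\<in>?R. \<Phi> r = \<Phi> r' \<longleftrightarrow> same_fraction (conic_points \<eta> e) r r'" and
    ring: "\<forall>(f, g)\<in>?R. \<forall>(f', g')\<in>?R. \<Phi> (f * g' + f' * g, g * g') = \<Phi> (f, g) + \<Phi> (f', g') \<and>
        \<Phi> (f * f', g * g') = \<Phi> (f, g) * \<Phi> (f', g')" and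
    const: "\<forall>c. \<Phi> (Poly_Mapping.single 0 c, 1) = jj c"
    using ff unfolding is_function_field_def by (elim exE conjE) (rule that)
  have ring': "\<Phi> (f * g' + f' * g, g * g') = \<Phi> (f, g) + \<Phi> (f', g')" "\<Phi> (f * f', g * g') = \<Phi> (f, g) * \<Phi> (f', g')"
    if "(f, g) \<in> ?R" "(f', g') \<in> ?R" for f g f' g'
    using bspec[OF bspec[OF ring that(1), unfolded prod.case] that(2)] by simp_all
  define val where "val = (\<lambda>(f, g). \<iota> (G f) / \<iota> (G g))"
  define rep where "rep = (\<lambda>a. SOME r. r \<in> ?R \<and> \<Phi> r = a)"
  define \<rho> where "\<rho> = (\<lambda>a. val (rep a))"
  have rep: "rep a \<in> ?R \<and> \<Phi> (rep a) = a" for a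
    unfolding rep_def
  proof (rule someI_ex)
    have "a \<in> \<Phi> ` ?R" unfolding surj by (rule UNIV_I)
    then show "\<exists>r. r \<in> ?R \<and> \<Phi> r = a" by auto
  qed
  have \<rho>: "\<rho> (\<Phi> (f, g)) = \<iota> (G f) / \<iota> (G g)" if fg: "(f, g) \<in> ?R" for f g
  proof -
    obtain f' g' where fg': "rep (\<Phi> (f, g)) = (f', g')" by (cases "rep (\<Phi> (f, g))")
    then have R': "(f', g') \<in> ?R" and "\<Phi> (f', g') = \<Phi> (f, g)" using rep[of "\<Phi> (f, g)"] by simp_all
    then have "same_fraction (conic_points \<eta> e) (f', g') (f, g)" using eq fg by blast
    then have "G f' * G g = G f * G g'" unfolding same_fraction_def by (intro generic_zero) simp
    then have "\<iota> (G f') * \<iota> (G g) = \<iota> (G f) * \<iota> (G g')" by (simp only: \<iota>_mult[symmetric])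
    then show ?thesis using fraction(1)[OF fg] fraction(1)[OF R']
      by (simp add: \<rho>_def fg' val_def frac_eq_eq \<iota>_eq_0)
  qed
  have cases: "\<exists>f g. (f, g) \<in> ?R \<and> a = \<Phi> (f, g)" for a
    using rep[of a] by (cases "rep a") auto
  have hom: "\<rho> (a + c) = \<rho> a + \<rho> c \<and> \<rho> (a * c) = \<rho> a * \<rho> c" for a c
  proof -
    obtain f g where fg: "(f, g) \<in> ?R" "a = \<Phi> (f, g)" using cases by blast
    obtain f' g' where fg': "(f', g') \<in> ?R" "c = \<Phi> (f', g')" using cases by blast
    obtain n where n: "homogeneous n f" "homogeneous n g" using fg(1) unfolding rational_fractions_def by blast
    obtain n' where n': "homogeneous n' f'" "homogeneous n' g'" using fg'(1) unfolding rational_fractions_def by blast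
    have nz: "G g \<noteq> 0" "G g' \<noteq> 0" using fraction(1) fg fg' by blast+
    have hom: "homogeneous (n + n') (f * g')" "homogeneous (n + n') (f' * g)" "homogeneous (n + n') (g * g')" "homogeneous (n + n') (f * f')"
      using homogeneous_mult[OF n(1) n'(2)] homogeneous_mult[OF n'(1) n(2)] homogeneous_mult[OF n(2) n'(2)]
        homogeneous_mult[OF n(1) n'(1)] by (simp_all add: add.commute)
    then have R: "(f * g' + f' * g, g * g') \<in> ?R" "(f * f', g * g') \<in> ?R"
      using nz by (auto intro!: rational_fractionsI[OF homogeneous_add[OF hom(1,2)] hom(3)] rational_fractionsI[OF hom(4,3)] simp: cpoly.ev_mult)
    have "\<Phi> (f * g' + f' * g, g * g') = a + c" "\<Phi> (f * f', g * g') = a * c" using ring'[OF fg(1) fg'(1)] fg(2) fg'(2) by simp_all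
    then have "\<rho> (a + c) = \<iota> (G (f * g' + f' * g)) / \<iota> (G (g * g'))" "\<rho> (a * c) = \<iota> (G (f * f')) / \<iota> (G (g * g'))"
      using \<rho>[OF R(1)] \<rho>[OF R(2)] by simp_all
    moreover have "\<rho> a = \<iota> (G f) / \<iota> (G g)" "\<rho> c = \<iota> (G f') / \<iota> (G g')" using \<rho> fg fg' by simp_all
    ultimately show ?thesis using nz
      by (simp add: cpoly.ev_mult cpoly.ev_add \<iota>_add \<iota>_mult \<iota>_eq_0 add_frac_eq)
  qed
  have \<rho>_jj: "\<rho> (jj c) = hh c" for c
  proof -
    have G1: "G 1 = 1" by (rule cpoly.ev_one)
    have "homogeneous 0 (1 :: (4 \<times> 4, 'k) poly_in)" using homogeneous_const[of 1] by simp
    then have "(Poly_Mapping.single 0 c, 1) \<in> ?R" by (rule rational_fractionsI[OF homogeneous_const]) (simp add: G1)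
    from \<rho>[OF this] have "\<rho> (jj c) = \<iota> (G (Poly_Mapping.single 0 c))" using const by (simp add: G1 \<iota>_one)
    then show ?thesis by (simp add: cpoly.ev_single \<epsilon>_def)
  qed
  have "jj 1 = 1"
  proof -
    have "\<Phi> (1, 1) = jj 1" using spec[OF const, of 1] by simp
    moreover have "(1, 1) \<in> ?R" using homogeneous_const[of 1] by (intro rational_fractionsI[of 0]) (simp_all add: cpoly.ev_one)
    then have "\<Phi> (1 * 1, 1 * 1) = \<Phi> (1, 1) * \<Phi> (1, 1)" using ring'(2) by blast
    ultimately have "jj 1 = jj 1 * jj 1" by simp
    moreover have "jj 1 \<noteq> 0"
    proof
      assume "jj 1 = 0"
      then have "hh 1 = \<rho> 0" using \<rho>_jj[of 1] by simp
      moreover have "\<rho> 0 = \<rho> 0 + \<rho> 0" using hom[of 0 0] by simp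
      then have "\<rho> 0 + 0 = \<rho> 0 + \<rho> 0" by simp
      then have "0 = \<rho> 0" by (rule add_left_imp_eq)
      ultimately show False by (simp add: \<epsilon>_one)
    qed
    ultimately show ?thesis by simp
  qed
  have "coefficient_hom \<rho>"
  proof
    show "\<rho> 1 = 1" using \<rho>_jj[of 1] \<open>jj 1 = 1\<close> by (simp add: \<epsilon>_one)
  qed (simp_all add: hom)
  then interpret \<rho>: coefficient_hom \<rho> .
  have "common_zero hh (\<lambda>\<beta>. \<rho> (x \<beta>))"
    using x common_zero_hom[OF \<open>coefficient_hom \<rho>\<close>, of jj x] by (simp add: \<rho>_jj)
  then have forms: "con.form 1 (\<lambda>\<beta>. \<rho> (x \<beta>)) (\<lambda>\<beta>. \<rho> (x \<beta>)) = 0" "con.form 2 (\<lambda>\<beta>. \<rho> (x \<beta>)) (\<lambda>\<beta>. \<rho> (x \<beta>)) = 0"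
    "con.form 3 (\<lambda>\<beta>. \<rho> (x \<beta>)) (\<lambda>\<beta>. \<rho> (x \<beta>)) = 0"
    by (simp_all add: common_zero_def con.form_def)
  have "\<rho> a \<in> con.des.F" for a
  proof -
    obtain f g where "(f, g) \<in> ?R" "a = \<Phi> (f, g)" using cases by blast
    then show ?thesis using fraction(2) \<rho> by simp
  qed
  from con.F_common_zero[OF this forms \<beta>] show ?thesis by (simp add: \<rho>.h_eq_0)
qed

end

subsection \<open>Extensions of odd degree\<close>

text \<open>
  The degree of a root of a quadratic polynomial is at most \<open>2\<close>, and odd here.
\<close>

lemma (in field_extension) quadratic_root_odd:
  assumes odd: "odd (alg_dim j)" and root: "x * x - j T * x + j N = 0"
  shows "\<exists>c. c * c - T * c + N = 0"
proof -
  note R = is_subfield_range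
  obtain m where m: "minimal_poly (range j) x m" using odd_minimal_poly(1)[OF odd R order_refl] by blast
  have "odd (degree m)" by (rule odd_minimal_poly(2)[OF odd R order_refl m])
  moreover have "degree m \<le> degree [:j N, - j T, 1:]"
  proof (rule minimal_poly_degree_le[OF m])
    show "[:j N, - j T, 1:] \<in> polys_over (range j)"
      by (intro polys_over_pCons[OF R] polys_over_zero[OF R] subfield_uminus[OF R] subfield_one[OF R] rangeI)
    show "poly [:j N, - j T, 1:] x = 0" using root by (simp add: algebra_simps)
  qed simp
  moreover have "degree [:j N, - j T, 1:] = 2" by simp
  moreover have "n = 1" if "odd n" "n \<le> 2" for n :: nat using that by presburger
  ultimately have deg: "degree m = 1" by simp
  obtain a c where ac: "m = [:a, c:]" "c \<noteq> 0"
  proof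
    show "m = [:coeff m 0, coeff m 1:]"
      using deg by (simp add: poly_eq_iff coeff_pCons coeff_eq_0 split: nat.split)
    show "coeff m 1 \<noteq> 0" using deg minimal_polyD(2)[OF m] by (metis leading_coeff_0_iff)
  qed
  have "a \<in> range j" "c \<in> range j"
    using polys_over_coeff[OF minimal_polyD(1)[OF m], of 0] polys_over_coeff[OF minimal_polyD(1)[OF m], of 1] by (simp_all add: ac(1))
  then have "- a / c \<in> range j" by (intro subfield_divide[OF R] subfield_uminus[OF R])
  moreover have "x = - a / c" using minimal_polyD(3)[OF m] ac by (simp add: field_simps eq_neg_iff_add_eq_0)
  ultimately obtain y where y: "x = j y" by blast
  have "j (y * y - T * y + N) = 0" using root unfolding y by (simp add: structure_add structure_mult \<eta>_diff)
  then show ?thesis unfolding j_eq_0 by (rule exI)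
qed

text \<open>
  One step of the tower. A common zero in \<open>E(\<theta>)\<close> is given by polynomials \<open>W \<beta>\<close> evaluated at \<open>\<theta>\<close>. The same polynomials
  evaluated at \<open>\<alpha>\<close> give a common zero over \<open>F(\<alpha>)\<close>, hence vanish. This contradicts the invertibility
  of a nonzero \<open>W \<beta>\<close> modulo the minimal polynomial of \<open>\<theta>\<close>.
\<close>

lemma (in form_coordinates) adjoin_common_zero:
  fixes jj :: "'k \<Rightarrow> 'l::field"
  assumes ext: "k_algebra jj" and no_root': "\<And>x. x * x - jj T * x + jj N \<noteq> 0"
    and E: "is_subfield E" "range jj \<subseteq> E"
    and anis: "\<And>x \<beta>. (\<And>\<beta>. \<beta> \<in> B \<Longrightarrow> x \<beta> \<in> E) \<Longrightarrow> common_zero jj x \<Longrightarrow> \<beta> \<in> B \<Longrightarrow> x \<beta> = 0"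
    and m: "minimal_poly E \<theta> m" "odd (degree m)"
    and x: "\<And>\<beta>. \<beta> \<in> B \<Longrightarrow> x \<beta> \<in> adjoin E \<theta>" and 0: "common_zero jj x" and \<beta>: "\<beta> \<in> B"
  shows "x \<beta> = 0"
proof (rule ccontr)
  assume nz: "x \<beta> \<noteq> 0"
  interpret J: k_algebra jj by (rule ext)
  define hl :: "'l \<Rightarrow> 'l alg_closure poly fract alg_closure" where "hl = (\<lambda>c. \<epsilon> (to_ac c))"
  have hom_hl: "coefficient_hom hl" unfolding hl_def by (rule coefficient_hom_\<epsilon>_ac)
  interpret hl: coefficient_hom hl by (rule hom_hl)
  define h where "h = (\<lambda>c. hl (jj c))"
  have hom_h: "coefficient_hom h"
    by unfold_locales (simp_all add: h_def J.structure_add J.structure_mult J.structure_one hl.h_add hl.h_mult hl.h_one)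
  obtain z z' where z: "z + z' = to_ac (jj T)" "z * z' = to_ac (jj N)" by (rule alg_closed_quadratic)
  have con: "conic_anisotropic \<eta> i j T N b co act s B r h (hl ` E) (\<epsilon> z) (\<epsilon> z') indet"
  proof (rule conic_anisotropicI[OF hom_h])
    show "is_subfield (hl ` E)" by (rule is_subfield_image[OF hom_hl E(1)])
    show "h c \<in> hl ` E" for c using E(2) by (auto simp: h_def)
    show "\<epsilon> z + \<epsilon> z' = h T" "\<epsilon> z * \<epsilon> z' = h N" by (simp_all add: z h_def hl_def flip: \<epsilon>_add \<epsilon>_mult)
    show "\<epsilon> z \<notin> hl ` E"
    proof
      assume "\<epsilon> z \<in> hl ` E"
      then obtain c where c: "z = to_ac c" by (auto simp: \<epsilon>_eq hl_def)
      have "z * z - (z + z') * z + z * z' = 0" by (simp add: algebra_simps)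
      then have "to_ac (c * c - jj T * c + jj N) = 0" unfolding z unfolding c by simp
      then show False using no_root'[of c] by (simp only: to_ac_eq_0_iff)
    qed
    have "hl ` E \<subseteq> range \<epsilon>" by (auto simp: hl_def)
    then show "p = 0" if "\<And>n. \<exists>e\<in>hl ` E. \<exists>f\<in>hl ` E. coeff p n = e + f * \<epsilon> z" "poly p indet = 0" for p
      using range_\<epsilon>_K[OF _ that(1)] by (intro indet_transcendental that(2))
    fix y \<beta> assume y: "\<And>\<beta>. \<beta> \<in> B \<Longrightarrow> y \<beta> \<in> hl ` E" and 0: "common_zero h y" and \<beta>: "\<beta> \<in> B"
    have "\<forall>\<beta>\<in>B. \<exists>a. a \<in> E \<and> y \<beta> = hl a" using y by blast
    then obtain a where a: "\<forall>\<beta>\<in>B. a \<beta> \<in> E \<and> y \<beta> = hl (a \<beta>)" by (rule bchoice[THEN exE])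
    have "common_zero h (\<lambda>\<beta>. hl (a \<beta>))" using 0 a common_zero_cong[of y "\<lambda>\<beta>. hl (a \<beta>)" h] by simp
    then have "common_zero jj a" unfolding h_def common_zero_hom[OF hom_hl] .
    then show "y \<beta> = 0" using anis[of a \<beta>] a \<beta> by (simp add: hl.h_zero)
  qed
  interpret con: conic_anisotropic \<eta> i j T N b co act s B r h "hl ` E" "\<epsilon> z" "\<epsilon> z'" indet by (rule con)
  have hl_F: "hl a \<in> con.des.F" if "a \<in> E" for a
    using that by (intro con.des.A_F con.des.A_const' con.E_K con.cj_E imageI)
  have map_F: "map_poly hl p \<in> polys_over con.des.F" if "p \<in> polys_over E" for p
    using that hl_F by (simp add: polys_over_def coeff_map_poly hl.h_zero)
  have "odd (degree (map_poly hl m))" using m(2) by (simp add: hl.degree_map_poly)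
  then obtain \<alpha> m' where m': "minimal_poly con.des.F \<alpha> m'" "odd (degree m')" and \<alpha>: "poly (map_poly hl m) \<alpha> = 0"
    using odd_degree_root[OF con.des.is_subfield_F map_F[OF minimal_polyD(1)[OF m(1)]]] by blast
  have root: "poly (map_poly hl p) \<alpha> = 0" if p: "p \<in> polys_over E" "poly p \<theta> = 0" for p
  proof -
    obtain a where "p = m * a" using minimal_poly_dvd[OF m(1) p] by blast
    then show ?thesis by (simp add: hl.map_poly_mult \<alpha>)
  qed
  have "\<forall>\<beta>\<in>B. \<exists>p. p \<in> polys_over E \<and> x \<beta> = poly p \<theta>" using x unfolding adjoin_def by blast
  then obtain W where W: "\<forall>\<beta>\<in>B. W \<beta> \<in> polys_over E \<and> x \<beta> = poly (W \<beta>) \<theta>" by (rule bchoice[THEN exE])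
  have "poly (map_poly hl (W \<beta>)) \<alpha> = 0"
  proof (rule odd_common_zero[OF con m', where W = "\<lambda>\<beta>. map_poly hl (W \<beta>)"])
    show "map_poly hl (W \<beta>) \<in> polys_over con.des.F" if "\<beta> \<in> B" for \<beta> using that W map_F by blast
    fix n :: nat assume n: "n \<in> {1, 2, 3}"
    define p where "p = (\<Sum>\<beta>\<in>B. \<Sum>\<beta>'\<in>B. smult (jj (co (s \<beta> \<beta>') n)) (W \<beta> * W \<beta>'))"
    have pE: "p \<in> polys_over E" unfolding p_def using W E(2)
      by (intro polys_over_sum[OF E(1)] polys_over_smult[OF E(1)] polys_over_mult[OF E(1)]) auto
    have "poly p \<theta> = (\<Sum>\<beta>\<in>B. \<Sum>\<beta>'\<in>B. x \<beta> * x \<beta>' * jj (co (s \<beta> \<beta>') n))"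
      unfolding p_def poly_sum using W by (intro sum.cong refl) simp
    also have "\<dots> = 0" using 0 n unfolding common_zero_def by (rule bspec)
    finally have "poly p \<theta> = 0" .
    with pE have "poly (map_poly hl p) \<alpha> = 0" by (rule root)
    then show "(\<Sum>\<beta>\<in>B. \<Sum>\<beta>'\<in>B. poly (map_poly hl (W \<beta>)) \<alpha> * poly (map_poly hl (W \<beta>')) \<alpha> * h (co (s \<beta> \<beta>') n)) = 0"
      by (simp add: p_def hl.map_poly_sum hl.map_poly_smult hl.map_poly_mult poly_sum h_def mult.commute)
  qed (rule \<beta>)
  moreover have "inverse (x \<beta>) \<in> adjoin E \<theta>"
    using subfield_inverse[OF is_subfield_adjoin[OF E(1) m(1)] x[OF \<beta>]] .
  then obtain a where a: "a \<in> polys_over E" "inverse (x \<beta>) = poly a \<theta>" unfolding adjoin_def by blast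
  have "poly (map_poly hl (W \<beta> * a - 1)) \<alpha> = 0"
  proof (rule root)
    have "1 \<in> polys_over E"
      using polys_over_pCons[OF E(1) subfield_one[OF E(1)] polys_over_zero[OF E(1)]] by (simp add: one_pCons)
    then show "W \<beta> * a - 1 \<in> polys_over E"
      using W \<beta> a(1) by (intro polys_over_diff[OF E(1)] polys_over_mult[OF E(1)]) auto
    show "poly (W \<beta> * a - 1) \<theta> = 0" using W \<beta> a(2) nz by (simp flip: a(2))
  qed
  moreover have "map_poly hl 1 = 1" by (simp add: one_pCons map_poly_pCons hl.h_zero hl.h_one)
  ultimately show False by (simp add: hl.map_poly_diff hl.map_poly_mult)
qed

lemma (in form_coordinates) odd_extension_common_zero:
  fixes jj :: "'k \<Rightarrow> 'l::field"
  assumes ext: "k_algebra jj" and odd: "odd (alg_dim jj)" and 0: "common_zero jj x" and \<beta>: "\<beta> \<in> B"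
  shows "x \<beta> = 0"
proof -
  interpret L: field_extension jj unfolding field_extension_def by (rule ext)
  have hom: "coefficient_hom jj" by unfold_locales (simp_all add: L.structure_add L.structure_mult L.structure_one)
  have no_root': "y * y - jj T * y + jj N \<noteq> 0" for y using L.quadratic_root_odd[OF odd] no_root by blast
  define P where "P = (\<lambda>E. \<forall>x. (\<forall>\<beta>\<in>B. x \<beta> \<in> E) \<longrightarrow> common_zero jj x \<longrightarrow> (\<forall>\<beta>\<in>B. x \<beta> = 0))"
  have "P UNIV"
  proof (rule L.odd_tower_induct[where P = P, OF odd])
    show "P (range jj)" unfolding P_def using range_common_zero[OF hom] by simp
    fix E \<theta> m
    assume *: "is_subfield E" "range jj \<subseteq> E" "P E" "minimal_poly E \<theta> m" "odd (degree m)"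
    show "P (adjoin E \<theta>)" unfolding P_def
    proof (intro allI impI ballI)
      fix x \<beta> assume x: "\<forall>\<beta>\<in>B. x \<beta> \<in> adjoin E \<theta>" "common_zero jj x" "\<beta> \<in> B"
      show "x \<beta> = 0"
      proof (rule adjoin_common_zero[OF ext no_root' *(1,2) _ *(4,5) _ x(2,3)])
        show "y \<beta> = 0" if "\<And>\<beta>. \<beta> \<in> B \<Longrightarrow> y \<beta> \<in> E" "common_zero jj y" "\<beta> \<in> B" for y \<beta>
          using *(3) that unfolding P_def by simp
        show "x \<beta> \<in> adjoin E \<theta>" if "\<beta> \<in> B" for \<beta> using x(1) that by (rule bspec)
      qed
    qed
  qed
  then show ?thesis using 0 \<beta> by (simp add: P_def)
qed

subsection \<open>The theorem\<close>

lemma (in k_algebra) canonical_involution_zero: "canonical_involution \<eta> 0 = 0"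
proof -
  have "0 \<in> range \<eta>" using \<eta>_zero by (metis rangeI)
  moreover have "(THE c. \<eta> c = 0) = 0" by (simp add: \<eta>_eq_0)
  ultimately show ?thesis by (simp add: canonical_involution_def reduced_trace_def \<eta>_zero)
qed

lemma (in k_algebra) isotropicI:
  assumes v: "v \<noteq> 0" "s v v \<in> range \<eta>" shows "isotropic \<eta> (form_class \<eta> act s)"
proof -
  have "(\<lambda>v w. 0) \<in> Sesq \<eta> act" by (simp add: Sesq_def k_bilinear_def)
  then have "(\<lambda>v w. 0 + dagger \<eta> (\<lambda>v w. 0) v w) \<in> Herm_plus \<eta> act" unfolding Herm_plus_def
    by (intro CollectI exI[of _ "\<lambda>v w. 0"] conjI refl)
  then have "(\<lambda>v w. 0) \<in> Herm_plus \<eta> act" by (simp add: dagger_def canonical_involution_zero)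
  then have "(\<lambda>v w. s v w + 0) \<in> form_class \<eta> act s" unfolding form_class_def
    by (intro CollectI exI[of _ "\<lambda>v w. 0"] conjI refl)
  then have "s \<in> form_class \<eta> act s" by simp
  moreover obtain a where a: "s v v = \<eta> a" using v(2) by blast
  have "q_map \<eta> s v = range \<eta>"
  proof
    show "q_map \<eta> s v \<subseteq> range \<eta>" by (auto simp: q_map_def a simp flip: structure_add)
    have "\<eta> c = s v v + \<eta> (c - a)" for c by (simp add: a \<eta>_diff)
    then show "range \<eta> \<subseteq> q_map \<eta> s v" unfolding q_map_def by (intro image_subsetI CollectI exI conjI TrueI)
  qed
  ultimately show ?thesis using v(1) unfolding isotropic_def by (intro bexI exI conjI)
qed

theorem mainTheorem1:
  fixes \<eta> :: "'k::field \<Rightarrow> 'q::division_ring"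
    and act :: "'v::ab_group_add \<Rightarrow> 'q \<Rightarrow> 'v"
    and s :: "'v \<Rightarrow> 'v \<Rightarrow> 'q"
  assumes "quaternion_algebra \<eta>"
    and "s \<in> Sesq \<eta> act"
    and "generalized_quadratic_space \<eta> act (form_class \<eta> act s)"
    and "anisotropic \<eta> (form_class \<eta> act s)"
  shows
    "(\<forall>(j :: 'k \<Rightarrow> 'f::field) (\<tau>Q :: 'q \<Rightarrow> 'f \<Rightarrow> 'r::ring_1) \<eta>F
        (\<tau>V :: 'v \<Rightarrow> 'f \<Rightarrow> 'w::ab_group_add) actF sF.
        conic_function_field \<eta> j \<and> scalar_extension \<eta> act s j \<tau>Q \<eta>F \<tau>V actF sF
          \<longrightarrow> anisotropic \<eta>F (form_class \<eta>F actF sF)) \<and>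
     (\<forall>(j :: 'k \<Rightarrow> 'l::field) (\<tau>Q :: 'q \<Rightarrow> 'l \<Rightarrow> 'r'::ring_1) \<eta>L
        (\<tau>V :: 'v \<Rightarrow> 'l \<Rightarrow> 'w'::ab_group_add) actL sL.
        odd (alg_dim j) \<and> scalar_extension \<eta> act s j \<tau>Q \<eta>L \<tau>V actL sL
          \<longrightarrow> anisotropic \<eta>L (form_class \<eta>L actL sL))"
proof -
  interpret quaternion_algebra \<eta> by (rule assms(1))
  obtain i j T N b co where gens: "quaternion_generators \<eta> i j T N b co"
    using quaternion_generators_exist[OF assms(1)] by (elim exE) (rule that)
  have M: "right_module act" and fg: "finitely_generated act"
    using assms(3) by (simp_all add: generalized_quadratic_space_def)
  obtain B r where B: "finite B" "\<And>v. v = (\<Sum>\<beta>\<in>B. act \<beta> (\<eta> (r v \<beta>)))"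
    "\<And>v w \<beta>. r (v + w) \<beta> = r v \<beta> + r w \<beta>" "\<And>v c \<beta>. r (act v (\<eta> c)) \<beta> = c * r v \<beta>"
    "\<And>\<beta> \<beta>'. \<beta> \<in> B \<Longrightarrow> \<beta>' \<in> B \<Longrightarrow> r \<beta> \<beta>' = (if \<beta> = \<beta>' then 1 else 0)"
    by (rule module_basis[OF assms(1) M fg]) (rule that)
  have no_iso: "v \<noteq> 0 \<Longrightarrow> s v v \<notin> range \<eta>" for v using isotropicI[of v s act] assms(4) by blast
  interpret form_coordinates \<eta> i j T N b co act s B r
    by (intro form_coordinates.intro form_coordinates_axioms.intro gens M) (fact assms(2) B no_iso)+
  show ?thesis
  proof (intro conjI allI impI notI; elim conjE)
    fix jj :: "'k \<Rightarrow> 'f" and \<tau>Q :: "'q \<Rightarrow> 'f \<Rightarrow> 'r" and \<eta>F and \<tau>V :: "'v \<Rightarrow> 'f \<Rightarrow> 'w" and actF sF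
    assume ff: "conic_function_field \<eta> jj" and ext: "scalar_extension \<eta> act s jj \<tau>Q \<eta>F \<tau>V actF sF"
      and iso: "isotropic \<eta>F (form_class \<eta>F actF sF)"
    obtain e where basis_e: "is_basis4 \<eta> e" "is_function_field (conic_points \<eta> e) jj"
      using ff unfolding conic_function_field_def by blast
    obtain z z' :: "'k alg_closure" where z: "z + z' = to_ac T" "z * z' = to_ac N" by (rule alg_closed_quadratic)
    interpret conic_generic_point \<eta> i j T N b co act s B r e z z' by unfold_locales (fact basis_e(1) z)+
    obtain x \<beta> where x: "common_zero jj x" "\<beta> \<in> B" "x \<beta> \<noteq> 0" using isotropic_common_zero[OF ext iso] by blast
    from function_field_common_zero[OF basis_e(2) x(1,2)] x(3) show False by contradiction
  next
    fix jj :: "'k \<Rightarrow> 'l" and \<tau>Q :: "'q \<Rightarrow> 'l \<Rightarrow> 'r'" and \<eta>L and \<tau>V :: "'v \<Rightarrow> 'l \<Rightarrow> 'w'" and actL sL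
    assume odd: "odd (alg_dim jj)" and ext: "scalar_extension \<eta> act s jj \<tau>Q \<eta>L \<tau>V actL sL"
      and iso: "isotropic \<eta>L (form_class \<eta>L actL sL)"
    interpret scalar_extension \<eta> act s jj \<tau>Q \<eta>L \<tau>V actL sL by (rule ext)
    obtain x \<beta> where x: "common_zero jj x" "\<beta> \<in> B" "x \<beta> \<noteq> 0" using isotropic_common_zero[OF ext iso] by blast
    from odd_extension_common_zero[OF extension odd x(1,2)] x(3) show False by contradiction
  qed
qed

end
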